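(* Let $E$ be a metric space. The following statements hold. (i) $(B_b(E),\tau_{\mathcal{K}})^*=\left(\mathbf{ba}_{\mathcal{C}}(E)\cap C_b(E)^\perp\right)\oplus\mathbf{ca}(E)$. More explicitly, for each $\Lambda\in(B_b(E),\tau_{\mathcal{K}})^*$ there exist unique $\mu\in\mathbf{ba}_{\mathcal{C}}(E)\cap C_b(E)^\perp$ and $\nu\in\mathbf{ca}(E)$ such that $$\Lambda(f)=\int_Ef\,d(\mu+\nu)\qquad\forall f\in B_b(E),$$ where the integral is in the Darboux sense. (ii) $(C_b(E),\tau_{\mathcal{K}})^*=\mathbf{ca}(E)$. More explicitly, for each $\Lambda\in(C_b(E),\tau_{\mathcal{K}})^*$ there exists a unique $\nu\in\mathbf{ca}(E)$ such that $$\Lambda(f)=\int_Ef\,d\nu\qquad\forall f\in C_b(E).$$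
   Context: $B_b(E)$ and $C_b(E)$ are the spaces of bounded Borel, respectively bounded continuous, real-valued functions on $E$; a star denotes the topological dual. $\mathbf{ba}(E)$ is the space of finitely additive signed measures of bounded total variation on the Borel $\sigma$-algebra $\mathcal{E}$ of $E$; it is identified with the dual of $(B_b(E),|\cdot|_\infty)$ via $\mu\mapsto\left(f\mapsto\int_Ef\,d\mu\right)$, the integral being in the Darboux sense (equal to the Lebesgue integral for countably additive $\mu$). $\mathbf{ca}(E)\subset\mathbf{ba}(E)$ is the subspace of countably additive finite signed measures. Set $$\mathbf{ba}_{\mathcal{C}}(E)=\{\mu\in\mathbf{ba}(E):\ \exists\,K\subset E\text{ compact with }|\mu|(K^c)=0\},$$ $$C_b(E)^\perp=\left\{\mu\in\mathbf{ba}(E):\ \int_Ef\,d\mu=0\ \ \forall f\in C_b(E)\right\}.$$ $\tau_{\mathcal{K}}$ is the locally convex topology generated by the seminorms $p_{K,\mu}(f)=\sup_{x\in K}|f(x)|+\left|\int_Ef\,d\mu\right|$, where $K$ ranges over the non-empty compact subsets of $E$ and $\mu$ over $\mathbf{ca}(E)$. The identifications of duals in the claim are through integration. *)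

theory Defs
  imports "HOL-Analysis.Analysis"
begin

text \<open>A metric space \<open>E\<close> is a type \<open>'a::metric_space\<close>, with Borel sets
  \<open>sets (borel :: 'a measure)\<close>.\<close>

definition B_b :: "('a::topological_space \<Rightarrow> real) set" where
  "B_b = {f. f \<in> borel_measurable borel \<and> bounded (range f)}"

definition C_b :: "('a::topological_space \<Rightarrow> real) set" where
  "C_b = {f. continuous_on UNIV f \<and> bounded (range f)}"

definition borel_partitions :: "'a::topological_space set \<Rightarrow> 'a set set set" where
  "borel_partitions A = {P. finite P \<and> P \<subseteq> sets borel \<and> partition_on A P}"

definition total_variation :: "('a::topological_space set \<Rightarrow> real) \<Rightarrow> 'a set \<Rightarrow> ennreal" where
  "total_variation \<mu> A = (SUP P \<in> borel_partitions A. \<Sum>B\<in>P. ennreal \<bar>\<mu> B\<bar>)"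

text \<open>A set function on the Borel sets is represented by a total function on all sets that
  vanishes off the Borel sets, so that equality of set functions is equality on the Borel sets.\<close>

definition ba :: "('a::topological_space set \<Rightarrow> real) set" where
  "ba = {\<mu>. (\<forall>A. A \<notin> sets borel \<longrightarrow> \<mu> A = 0) \<and>
            \<mu> {} = 0 \<and>
            (\<forall>A\<in>sets borel. \<forall>B\<in>sets borel. A \<inter> B = {} \<longrightarrow> \<mu> (A \<union> B) = \<mu> A + \<mu> B) \<and>
            total_variation \<mu> UNIV < \<infinity>}"

definition ca :: "('a::topological_space set \<Rightarrow> real) set" where
  "ca = {\<mu> \<in> ba. \<forall>A :: nat \<Rightarrow> 'a set. range A \<subseteq> sets borel \<longrightarrow> disjoint_family A \<longrightarrow>
            (\<lambda>i. \<mu> (A i)) sums \<mu> (\<Union>i. A i)}"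

text \<open>Jordan decomposition: \<open>\<mu>\<^sup>+ A\<close> is the supremum of \<open>\<mu>\<close> over the Borel subsets of \<open>A\<close>.\<close>

definition pos_part :: "('a::topological_space set \<Rightarrow> real) \<Rightarrow> 'a set \<Rightarrow> real" where
  "pos_part \<mu> A = (SUP B \<in> {B \<in> sets borel. B \<subseteq> A}. \<mu> B)"

definition neg_part :: "('a::topological_space set \<Rightarrow> real) \<Rightarrow> 'a set \<Rightarrow> real" where
  "neg_part \<mu> = pos_part (\<lambda>A. - \<mu> A)"

text \<open>Darboux integral of a bounded function with respect to a nonnegative charge \<open>m\<close>. The cells
  of a partition are nonempty, so the infima and suprema over them are genuine.\<close>

definition lower_integral :: "('a::topological_space set \<Rightarrow> real) \<Rightarrow> ('a \<Rightarrow> real) \<Rightarrow> real" where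
  "lower_integral m f = (SUP P \<in> borel_partitions UNIV. \<Sum>B\<in>P. (INF x\<in>B. f x) * m B)"

definition upper_integral :: "('a::topological_space set \<Rightarrow> real) \<Rightarrow> ('a \<Rightarrow> real) \<Rightarrow> real" where
  "upper_integral m f = (INF P \<in> borel_partitions UNIV. \<Sum>B\<in>P. (SUP x\<in>B. f x) * m B)"

definition pos_darboux_integral ::
    "('a::topological_space set \<Rightarrow> real) \<Rightarrow> ('a \<Rightarrow> real) \<Rightarrow> real" where
  "pos_darboux_integral m f = (THE I. lower_integral m f = I \<and> upper_integral m f = I)"

definition darboux_integral ::
    "('a::topological_space set \<Rightarrow> real) \<Rightarrow> ('a \<Rightarrow> real) \<Rightarrow> real" where
  "darboux_integral \<mu> f =
     pos_darboux_integral (pos_part \<mu>) f - pos_darboux_integral (neg_part \<mu>) f"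

definition ba_C :: "('a::topological_space set \<Rightarrow> real) set" where
  "ba_C = {\<mu> \<in> ba. \<exists>K. compact K \<and> total_variation \<mu> (- K) = 0}"

definition C_b_perp :: "('a::topological_space set \<Rightarrow> real) set" where
  "C_b_perp = {\<mu> \<in> ba. \<forall>f\<in>C_b. darboux_integral \<mu> f = 0}"

definition p_K :: "'a::topological_space set \<Rightarrow> ('a set \<Rightarrow> real) \<Rightarrow> ('a \<Rightarrow> real) \<Rightarrow> real" where
  "p_K K \<mu> f = (SUP x\<in>K. \<bar>f x\<bar>) + \<bar>darboux_integral \<mu> f\<bar>"

text \<open>The topology on a space \<open>V\<close> of functions generated by a family \<open>S\<close> of seminorms: the
  seminorm balls form a subbase.\<close>

definition seminorm_topology ::
    "('a \<Rightarrow> real) set \<Rightarrow> (('a \<Rightarrow> real) \<Rightarrow> real) set \<Rightarrow> ('a \<Rightarrow> real) topology" where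
  "seminorm_topology V S =
     topology_generated_by
       {{g \<in> V. p (\<lambda>x. g x - f x) < e} | p f e. p \<in> S \<and> f \<in> V \<and> 0 < e}"

definition tau_K :: "('a::topological_space \<Rightarrow> real) set \<Rightarrow> ('a \<Rightarrow> real) topology" where
  "tau_K V = seminorm_topology V {p_K K \<mu> | K \<mu>. compact K \<and> K \<noteq> {} \<and> \<mu> \<in> ca}"

text \<open>Functionals on \<open>V\<close> are extensional (\<open>undefined\<close> off \<open>V\<close>), so that equality of functionals
  is equality on \<open>V\<close>.\<close>

definition linear_functional_on ::
    "('a \<Rightarrow> real) set \<Rightarrow> (('a \<Rightarrow> real) \<Rightarrow> real) \<Rightarrow> bool" where
  "linear_functional_on V \<Lambda> \<longleftrightarrow>
     (\<forall>f\<in>V. \<forall>g\<in>V. \<Lambda> (\<lambda>x. f x + g x) = \<Lambda> f + \<Lambda> g) \<and>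
     (\<forall>c. \<forall>f\<in>V. \<Lambda> (\<lambda>x. c * f x) = c * \<Lambda> f)"

definition dual_tau_K :: "('a::topological_space \<Rightarrow> real) set \<Rightarrow> (('a \<Rightarrow> real) \<Rightarrow> real) set" where
  "dual_tau_K V =
     {\<Lambda> \<in> extensional V. linear_functional_on V \<Lambda> \<and> continuous_map (tau_K V) euclideanreal \<Lambda>}"

definition integration_on ::
    "('a::topological_space \<Rightarrow> real) set \<Rightarrow> ('a set \<Rightarrow> real) \<Rightarrow> ('a \<Rightarrow> real) \<Rightarrow> real" where
  "integration_on V \<mu> = restrict (darboux_integral \<mu>) V"

end

theory Submission
  imports Defs
begin

text \<open>
  Write \<open>1_A\<close> for the indicator of \<open>A\<close>. The Darboux integral against a bounded charge \<open>\<mu>\<close> is the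
  one sup-norm bounded linear functional on \<open>B_b\<close> that sends \<open>1_A\<close> to \<open>\<mu> A\<close>, because simple
  functions are uniformly dense (\<open>bounded_functional_eqI\<close>, \<open>darboux_unique\<close>). Charges and bounded
  functionals are thus interchangeable (\<open>darboux_charge_of\<close>), and for countably additive charges
  the functional is a difference of two Lebesgue integrals, so that dominated convergence holds
  (\<open>darboux_dominated_convergence\<close>).

  Continuity for the seminorms \<open>p_K\<close> enters through one consequence. A neighbourhood of \<open>0\<close>
  on which \<open>\<Lambda>\<close> is bounded involves finitely many compact sets; with \<open>K\<close> their union, dominated
  convergence shows that \<open>\<Lambda> (f n)\<close> tends to \<open>0\<close> whenever \<open>f n\<close> is uniformly bounded, tends to
  \<open>0\<close> pointwise, and does so uniformly on \<open>K\<close> (\<open>dual_tau_K_smooth_modulo\<close>).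

  On \<open>C_b\<close> this property suffices for a Daniell representation. If \<open>f n\<close> decreases to \<open>0\<close>, Dini's
  theorem gives uniform convergence on \<open>K\<close>, so the positive part of \<open>\<Lambda>\<close> and its difference from
  \<open>\<Lambda>\<close> are positive functionals that are continuous along decreasing sequences. Such a functional
  \<open>I\<close> is the integral of a finite measure: the content \<open>I (g - f)\<close> of the region between two graphs
  \<open>f \<le> g\<close> is countably additive on a semiring in \<open>E \<times> \<real>\<close>, and the extended measure of
  \<open>A \<times> {0..<1}\<close> is the required measure of \<open>A\<close> (\<open>smooth_functional_representation\<close>). Uniqueness
  follows since indicators of open sets are bounded limits of continuous functions
  (\<open>ca_determined_by_C_b\<close>).

  On \<open>B_b\<close> one may cut functions along the Borel set \<open>K\<close>. The functional \<open>\<Lambda> (f 1_{- K})\<close> is given by a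
  countably additive charge, as smoothness modulo \<open>K\<close> is there continuity from above at the empty
  set. The functional \<open>\<Lambda> (f 1_K)\<close> is given by a charge \<open>m\<close> carried by \<open>K\<close> that need not be countably
  additive; on \<open>C_b\<close>, however, it is represented by a countably additive \<open>\<nu>2\<close>, again carried by
  \<open>K\<close>. So \<open>m - \<nu>2\<close> annihilates \<open>C_b\<close>, and \<open>\<nu>2\<close> joins the countably additive part
  (\<open>dual_B_b_decomposition\<close>).
\<close>

section \<open>Bounded functions and functionals on them\<close>

lemma B_bI: "f \<in> borel_measurable borel \<Longrightarrow> (\<And>x. \<bar>f x\<bar> \<le> c) \<Longrightarrow> f \<in> B_b"
  unfolding B_b_def bounded_iff by auto

lemma C_bI: "continuous_on UNIV f \<Longrightarrow> (\<And>x. \<bar>f x\<bar> \<le> c) \<Longrightarrow> f \<in> C_b"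
  unfolding C_b_def bounded_iff by auto

lemma C_b_subset_B_b: "C_b \<subseteq> B_b"
  unfolding C_b_def B_b_def by (auto intro: borel_measurable_continuous_onI)

lemma B_b_measurable: "f \<in> B_b \<Longrightarrow> f \<in> borel_measurable borel"
  by (simp add: B_b_def)

lemma C_b_continuous: "f \<in> C_b \<Longrightarrow> continuous_on UNIV f"
  by (simp add: C_b_def)

lemma B_bE:
  assumes "f \<in> B_b"
  obtains c where "0 < c" "\<And>x. \<bar>f x\<bar> \<le> c"
  using assms unfolding B_b_def bounded_pos by auto

lemma C_bE:
  assumes "f \<in> C_b"
  obtains c where "0 < c" "\<And>x. \<bar>f x\<bar> \<le> c"
  using assms unfolding C_b_def bounded_pos by auto

lemma B_b_add:
  assumes "f \<in> B_b" "g \<in> B_b"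
  shows "(\<lambda>x. f x + g x) \<in> B_b"
proof -
  obtain c d where "\<And>x. \<bar>f x\<bar> \<le> c" "\<And>x. \<bar>g x\<bar> \<le> d" using assms B_bE by metis
  then have "\<bar>f x + g x\<bar> \<le> c + d" for x using abs_triangle_ineq[of "f x" "g x"] add_mono by (meson order_trans)
  moreover have "(\<lambda>x. f x + g x) \<in> borel_measurable borel"
    using assms[THEN B_b_measurable] by measurable
  ultimately show ?thesis by (rule B_bI[rotated])
qed

lemma B_b_mult:
  assumes "f \<in> B_b" "g \<in> B_b"
  shows "(\<lambda>x. f x * g x) \<in> B_b"
proof -
  obtain c d where "\<And>x. \<bar>f x\<bar> \<le> c" "\<And>x. \<bar>g x\<bar> \<le> d" using assms B_bE by metis
  then have "\<bar>f x * g x\<bar> \<le> c * d" for x by (simp add: abs_mult mult_mono')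
  moreover have "(\<lambda>x. f x * g x) \<in> borel_measurable borel"
    using assms[THEN B_b_measurable] by measurable
  ultimately show ?thesis by (rule B_bI[rotated])
qed

lemma C_b_add:
  assumes "f \<in> C_b" "g \<in> C_b"
  shows "(\<lambda>x. f x + g x) \<in> C_b"
  using B_b_add[of f g] assms C_b_subset_B_b unfolding C_b_def B_b_def by (auto intro: continuous_on_add)

lemma C_b_mult:
  assumes "f \<in> C_b" "g \<in> C_b"
  shows "(\<lambda>x. f x * g x) \<in> C_b"
  using B_b_mult[of f g] assms C_b_subset_B_b unfolding C_b_def B_b_def by (auto intro: continuous_on_mult)

lemma B_b_const [simp]: "(\<lambda>x. c) \<in> B_b"
  by (rule B_bI[of _ "\<bar>c\<bar>"]) auto

lemma C_b_const [simp]: "(\<lambda>x. c) \<in> C_b"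
  by (rule C_bI[of _ "\<bar>c\<bar>"]) auto

lemma B_b_scale: "f \<in> B_b \<Longrightarrow> (\<lambda>x. c * f x) \<in> B_b"
  by (rule B_b_mult) auto

lemma C_b_scale: "f \<in> C_b \<Longrightarrow> (\<lambda>x. c * f x) \<in> C_b"
  by (rule C_b_mult) auto

lemma B_b_diff: "f \<in> B_b \<Longrightarrow> g \<in> B_b \<Longrightarrow> (\<lambda>x. f x - g x) \<in> B_b"
  using B_b_add[OF _ B_b_scale[of g "-1"], of f] by simp

lemma C_b_diff: "f \<in> C_b \<Longrightarrow> g \<in> C_b \<Longrightarrow> (\<lambda>x. f x - g x) \<in> C_b"
  using C_b_add[OF _ C_b_scale[of g "-1"], of f] by simp

lemma C_b_min:
  assumes "f \<in> C_b" "g \<in> C_b"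
  shows "(\<lambda>x. min (f x) (g x)) \<in> C_b"
proof -
  obtain c d where "\<And>x. \<bar>f x\<bar> \<le> c" "\<And>x. \<bar>g x\<bar> \<le> d" using assms C_bE by metis
  then have "\<bar>min (f x) (g x)\<bar> \<le> max c d" for x by (simp add: min_def le_max_iff_disj)
  then show ?thesis using assms by (intro C_bI) (auto dest: C_b_continuous intro: continuous_on_min)
qed

lemma C_b_max:
  assumes "f \<in> C_b" "g \<in> C_b"
  shows "(\<lambda>x. max (f x) (g x)) \<in> C_b"
proof -
  have "(\<lambda>x. -1 * min (-1 * f x) (-1 * g x)) \<in> C_b"
    using assms by (intro C_b_scale C_b_min)
  moreover have "-1 * min (-1 * f x) (-1 * g x) = max (f x) (g x)" for x by (simp add: min_def max_def)
  ultimately show ?thesis by simp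
qed

lemma B_b_indicator: "A \<in> sets borel \<Longrightarrow> indicat_real A \<in> B_b"
  by (rule B_bI[of _ 1]) (auto simp: indicator_def)

lemma B_b_indicator_mult: "A \<in> sets borel \<Longrightarrow> f \<in> B_b \<Longrightarrow> (\<lambda>x. f x * indicator A x) \<in> B_b"
  by (intro B_b_mult B_b_indicator)

lemma B_b_sum: "finite F \<Longrightarrow> (\<And>i. i \<in> F \<Longrightarrow> f i \<in> B_b) \<Longrightarrow> (\<lambda>x. \<Sum>i\<in>F. f i x) \<in> B_b"
  by (induction F rule: finite_induct) (auto intro: B_b_add)

definition bounded_functional_on ::
    "('a \<Rightarrow> real) set \<Rightarrow> (('a \<Rightarrow> real) \<Rightarrow> real) \<Rightarrow> bool" where
  "bounded_functional_on V \<Lambda> \<longleftrightarrow> linear_functional_on V \<Lambda> \<and>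
     (\<exists>C. \<forall>f\<in>V. \<forall>c. (\<forall>x. \<bar>f x\<bar> \<le> c) \<longrightarrow> \<bar>\<Lambda> f\<bar> \<le> C * c)"

lemma linear_functional_onD:
  assumes "linear_functional_on V \<Lambda>"
  shows "f \<in> V \<Longrightarrow> g \<in> V \<Longrightarrow> \<Lambda> (\<lambda>x. f x + g x) = \<Lambda> f + \<Lambda> g"
    and "f \<in> V \<Longrightarrow> \<Lambda> (\<lambda>x. c * f x) = c * \<Lambda> f"
  using assms unfolding linear_functional_on_def by auto

lemma linear_functional_on_subset:
  "linear_functional_on V \<Lambda> \<Longrightarrow> W \<subseteq> V \<Longrightarrow> linear_functional_on W \<Lambda>"
  unfolding linear_functional_on_def by blast

lemma linear_functional_on_diff:
  assumes "linear_functional_on V \<Lambda>" and "\<And>c f. f \<in> V \<Longrightarrow> (\<lambda>x. c * f x) \<in> V" and "f \<in> V" "g \<in> V"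
  shows "\<Lambda> (\<lambda>x. f x - g x) = \<Lambda> f - \<Lambda> g"
  using linear_functional_onD(1)[OF assms(1,3) assms(2)[of g "-1"]]
    linear_functional_onD(2)[OF assms(1,4), of "-1"] assms(4) by simp

lemma linear_functional_on_sum:
  assumes "linear_functional_on B_b \<Lambda>" "finite F" "\<And>i. i \<in> F \<Longrightarrow> f i \<in> B_b"
  shows "\<Lambda> (\<lambda>x. \<Sum>i\<in>F. f i x) = (\<Sum>i\<in>F. \<Lambda> (f i))"
  using assms(2,3)
proof (induction F rule: finite_induct)
  case empty
  show ?case using linear_functional_onD(2)[OF assms(1) B_b_const, of 0 0] by simp
next
  case (insert i F)
  then show ?case
    using linear_functional_onD(1)[OF assms(1), of "f i" "\<lambda>x. \<Sum>i\<in>F. f i x"] B_b_sum[of F f] by simp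
qed

lemma bounded_functional_on_combine:
  assumes "bounded_functional_on V \<Lambda>" "bounded_functional_on V \<Gamma>"
  shows "bounded_functional_on V (\<lambda>f. a * \<Lambda> f + b * \<Gamma> f)"
proof -
  obtain C D where C: "\<And>f c. f \<in> V \<Longrightarrow> \<forall>x. \<bar>f x\<bar> \<le> c \<Longrightarrow> \<bar>\<Lambda> f\<bar> \<le> C * c"
    and D: "\<And>f c. f \<in> V \<Longrightarrow> \<forall>x. \<bar>f x\<bar> \<le> c \<Longrightarrow> \<bar>\<Gamma> f\<bar> \<le> D * c"
    using assms unfolding bounded_functional_on_def by metis
  have "\<bar>a * \<Lambda> f + b * \<Gamma> f\<bar> \<le> (\<bar>a\<bar> * C + \<bar>b\<bar> * D) * c" if "f \<in> V" "\<forall>x. \<bar>f x\<bar> \<le> c" for f c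
  proof -
    have "\<bar>a * \<Lambda> f + b * \<Gamma> f\<bar> \<le> \<bar>a\<bar> * \<bar>\<Lambda> f\<bar> + \<bar>b\<bar> * \<bar>\<Gamma> f\<bar>"
      by (metis abs_mult abs_triangle_ineq)
    also have "\<dots> \<le> \<bar>a\<bar> * (C * c) + \<bar>b\<bar> * (D * c)"
      using C[OF that] D[OF that] by (intro add_mono mult_left_mono) auto
    finally show ?thesis by (simp add: algebra_simps)
  qed
  moreover have "linear_functional_on V (\<lambda>f. a * \<Lambda> f + b * \<Gamma> f)"
    using assms unfolding bounded_functional_on_def linear_functional_on_def by (simp add: algebra_simps)
  ultimately show ?thesis unfolding bounded_functional_on_def by blast
qed

lemma borel_partitionsD:
  assumes "P \<in> borel_partitions UNIV"
  shows "finite P" "B \<in> P \<Longrightarrow> B \<in> sets borel" "B \<in> P \<Longrightarrow> B \<noteq> {}" "\<exists>B\<in>P. x \<in> B"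
    "B \<in> P \<Longrightarrow> C \<in> P \<Longrightarrow> x \<in> B \<Longrightarrow> x \<in> C \<Longrightarrow> B = C"
proof -
  have P: "finite P" "P \<subseteq> sets borel" "\<Union>P = UNIV" "disjoint P" "{} \<notin> P"
    using assms unfolding borel_partitions_def partition_on_def by auto
  show "finite P" "B \<in> P \<Longrightarrow> B \<in> sets borel" "B \<in> P \<Longrightarrow> B \<noteq> {}" using P by auto
  show "\<exists>B\<in>P. x \<in> B" using P(3) by blast
  show "B \<in> P \<Longrightarrow> C \<in> P \<Longrightarrow> x \<in> B \<Longrightarrow> x \<in> C \<Longrightarrow> B = C"
    using disjointD[OF P(4), of B C] by blast
qed

lemma sum_partition_indicator:
  assumes "P \<in> borel_partitions UNIV" "B \<in> P" "x \<in> B"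
  shows "(\<Sum>C\<in>P. a C * indicat_real C x) = a B"
proof -
  have "(\<Sum>C\<in>P. a C * indicat_real C x) = (\<Sum>C\<in>P. if C = B then a B else 0)"
    using assms borel_partitionsD(5)[OF assms(1)] by (intro sum.cong) (auto simp: indicator_def)
  then show ?thesis using assms borel_partitionsD(1)[OF assms(1)] by simp
qed

text \<open>The level sets \<open>{k e \<le> f < (k + 1) e}\<close> of a bounded function are finitely many; this is what makes
  a bounded Borel function Darboux integrable against every charge, and simple functions uniformly
  dense.\<close>

lemma small_oscillation_partition:
  assumes "f \<in> B_b" "0 < e"
  obtains P where "P \<in> borel_partitions UNIV"
    "\<And>B x y. B \<in> P \<Longrightarrow> x \<in> B \<Longrightarrow> y \<in> B \<Longrightarrow> \<bar>f x - f y\<bar> \<le> e"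
proof -
  define k where "k x = \<lfloor>f x / e\<rfloor>" for x
  define P where "P = range (\<lambda>x. {y. k y = k x})"
  obtain c where c: "\<And>x. \<bar>f x\<bar> \<le> c" using assms(1) B_bE by metis
  have f[measurable]: "f \<in> borel_measurable borel" using assms(1) by (rule B_b_measurable)
  have "k x \<in> {\<lfloor>- c / e\<rfloor>..\<lfloor>c / e\<rfloor>}" for x
  proof -
    have "- c \<le> f x" "f x \<le> c" using c[of x] by auto
    then have "- c / e \<le> f x / e" "f x / e \<le> c / e" using assms(2) divide_right_mono[of "- c" "f x" e] divide_right_mono[of "f x" c e] by auto
    then show ?thesis unfolding k_def by (auto intro!: floor_mono)
  qed
  then have "range k \<subseteq> {\<lfloor>- c / e\<rfloor>..\<lfloor>c / e\<rfloor>}" by blast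
  then have "finite (range k)" by (rule finite_subset) simp
  moreover have "P = (\<lambda>i. {y. k y = i}) ` range k" unfolding P_def by auto
  ultimately have "finite P" by simp
  moreover have "B \<in> sets borel" if "B \<in> P" for B
  proof -
    have "k \<in> measurable borel (count_space UNIV)" unfolding k_def by measurable
    from measurable_sets[OF this, of "{i}" for i] that show ?thesis
      unfolding P_def by (auto simp: vimage_def)
  qed
  moreover have "partition_on UNIV P" unfolding P_def
    by (rule partition_onI) (auto simp: disjnt_def)
  ultimately have "P \<in> borel_partitions UNIV" unfolding borel_partitions_def by auto
  moreover have "\<bar>f x - f y\<bar> \<le> e" if "B \<in> P" "x \<in> B" "y \<in> B" for B x y
  proof -
    have "\<lfloor>f x / e\<rfloor> = \<lfloor>f y / e\<rfloor>" using that unfolding P_def k_def by auto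
    then have "\<bar>f x / e - f y / e\<bar> \<le> 1" by linarith
    then have "\<bar>(f x - f y) / e\<bar> \<le> 1" by (simp add: diff_divide_distrib)
    then show ?thesis using assms(2) by (simp add: abs_divide)
  qed
  ultimately show ?thesis by (rule that)
qed

text \<open>Uniform density of the simple functions, in the form in which it identifies functionals. It stands
  in for every computation with upper and lower sums once the integral is known to be a bounded
  functional.\<close>

lemma bounded_functional_eqI:
  assumes L: "bounded_functional_on B_b \<Lambda>" and G: "bounded_functional_on B_b \<Gamma>"
    and ind: "\<And>A. A \<in> sets borel \<Longrightarrow> \<Lambda> (indicat_real A) = \<Gamma> (indicat_real A)"
    and f: "f \<in> B_b"
  shows "\<Lambda> f = \<Gamma> f"
proof -
  define D where "D f = 1 * \<Lambda> f + (-1) * \<Gamma> f" for f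
  have D: "bounded_functional_on B_b D"
    unfolding D_def using L G by (rule bounded_functional_on_combine)
  then have lin: "linear_functional_on B_b D" unfolding bounded_functional_on_def by simp
  obtain C where C: "\<And>f c. f \<in> B_b \<Longrightarrow> \<forall>x. \<bar>f x\<bar> \<le> c \<Longrightarrow> \<bar>D f\<bar> \<le> C * c"
    using D unfolding bounded_functional_on_def by metis
  have "\<bar>D f\<bar> \<le> C * e" if e: "0 < e" for e
  proof -
    obtain P where P: "P \<in> borel_partitions UNIV"
      "\<And>B x y. B \<in> P \<Longrightarrow> x \<in> B \<Longrightarrow> y \<in> B \<Longrightarrow> \<bar>f x - f y\<bar> \<le> e"
      by (rule small_oscillation_partition[OF f e]) blast
    define s where "s x = (\<Sum>B\<in>P. f (SOME z. z \<in> B) * indicat_real B x)" for x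
    have sB: "(\<lambda>x. f (SOME z. z \<in> B) * indicat_real B x) \<in> B_b" if "B \<in> P" for B
      using borel_partitionsD(2)[OF P(1) that] by (intro B_b_scale B_b_indicator)
    have s: "s \<in> B_b" unfolding s_def by (intro B_b_sum sB borel_partitionsD(1)[OF P(1)])
    have "D s = (\<Sum>B\<in>P. D (\<lambda>x. f (SOME z. z \<in> B) * indicat_real B x))"
      unfolding s_def by (intro linear_functional_on_sum[OF lin] sB borel_partitionsD(1)[OF P(1)])
    also have "\<dots> = (\<Sum>B\<in>P. f (SOME z. z \<in> B) * D (indicat_real B))"
      using borel_partitionsD(2)[OF P(1)] by (intro sum.cong refl linear_functional_onD(2)[OF lin] B_b_indicator)
    also have "\<dots> = 0" using ind borel_partitionsD(2)[OF P(1)] unfolding D_def by (intro sum.neutral) auto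
    finally have "D s = 0" .
    then have "D f = D (\<lambda>x. f x - s x)"
      using linear_functional_on_diff[OF lin B_b_scale f s] by simp
    moreover have "\<bar>f x - s x\<bar> \<le> e" for x
    proof -
      obtain B where B: "B \<in> P" "x \<in> B" using borel_partitionsD(4)[OF P(1)] by blast
      then have "s x = f (SOME z. z \<in> B)" unfolding s_def by (rule sum_partition_indicator[OF P(1)])
      moreover have "(SOME z. z \<in> B) \<in> B" using B by (rule_tac someI)
      ultimately show ?thesis using P(2)[OF B] by simp
    qed
    ultimately show ?thesis using C[OF B_b_diff[OF f s]] by simp
  qed
  note small = this
  have "\<bar>D f\<bar> \<le> 0 + e" if "0 < e" for e
  proof -
    have "\<bar>D f\<bar> \<le> C * (e / (\<bar>C\<bar> + 1))" using that by (intro small) auto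
    also have "\<dots> \<le> (\<bar>C\<bar> + 1) * (e / (\<bar>C\<bar> + 1))" using that by (intro mult_right_mono) auto
    finally show ?thesis by simp
  qed
  then have "\<bar>D f\<bar> \<le> 0" by (rule field_le_epsilon)
  then show ?thesis unfolding D_def by simp
qed

section \<open>The Darboux integral against a nonnegative charge\<close>

definition nonneg_charge :: "('a::topological_space set \<Rightarrow> real) \<Rightarrow> bool" where
  "nonneg_charge m \<longleftrightarrow> m {} = 0 \<and> (\<forall>A\<in>sets borel. 0 \<le> m A) \<and>
     (\<forall>A\<in>sets borel. \<forall>B\<in>sets borel. A \<inter> B = {} \<longrightarrow> m (A \<union> B) = m A + m B)"

text \<open>Relativizing to a Borel set \<open>D\<close> and carrying a constant \<open>a\<close> makes the induction go through
  without a common refinement: a new set \<open>A j\<close> only splits \<open>D\<close> into \<open>D \<inter> A j\<close>, where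
  \<open>c j\<close> is added to the constant, and \<open>D - A j\<close>.\<close>

lemma simple_sum_nonneg_on:
  assumes m: "nonneg_charge m" and "finite F" "\<And>i. i \<in> F \<Longrightarrow> A i \<in> sets borel"
    and "D \<in> sets borel" "\<And>x. x \<in> D \<Longrightarrow> 0 \<le> (\<Sum>i\<in>F. c i * indicat_real (A i) x) + a"
  shows "0 \<le> (\<Sum>i\<in>F. c i * m (A i \<inter> D)) + a * m D"
  using assms(2-)
proof (induction F arbitrary: D a rule: finite_induct)
  case empty
  then show ?case using m by (cases "D = {}") (auto simp: nonneg_charge_def)
next
  case (insert j F)
  have meas: "D \<inter> A j \<in> sets borel" "D - A j \<in> sets borel" using insert.prems by auto
  have split: "m (B \<inter> D) = m (B \<inter> (D \<inter> A j)) + m (B \<inter> (D - A j))" if "B \<in> sets borel" for B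
  proof -
    have "B \<inter> D = B \<inter> (D \<inter> A j) \<union> B \<inter> (D - A j)" by auto
    then show ?thesis using m that meas unfolding nonneg_charge_def by (metis (no_types, lifting) Diff_disjoint Int_Diff Int_commute Int_left_commute inf_bot_right sets.Int)
  qed
  have 1: "0 \<le> (\<Sum>i\<in>F. c i * m (A i \<inter> (D \<inter> A j))) + (c j + a) * m (D \<inter> A j)"
  proof (rule insert.IH)
    show "0 \<le> (\<Sum>i\<in>F. c i * indicat_real (A i) x) + (c j + a)" if "x \<in> D \<inter> A j" for x
      using insert.prems(3)[of x] insert.hyps that by (simp del: sum_mult_indicator)
  qed (use insert.prems(1) meas in auto)
  have 2: "0 \<le> (\<Sum>i\<in>F. c i * m (A i \<inter> (D - A j))) + a * m (D - A j)"
  proof (rule insert.IH)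
    show "0 \<le> (\<Sum>i\<in>F. c i * indicat_real (A i) x) + a" if "x \<in> D - A j" for x
      using insert.prems(3)[of x] insert.hyps that by (simp del: sum_mult_indicator)
  qed (use insert.prems(1) meas in auto)
  have s: "(\<Sum>i\<in>F. c i * m (A i \<inter> D)) =
      (\<Sum>i\<in>F. c i * m (A i \<inter> (D \<inter> A j))) + (\<Sum>i\<in>F. c i * m (A i \<inter> (D - A j)))"
    using insert.prems(1) split by (simp add: sum.distrib[symmetric] distrib_left cong: sum.cong)
  have "m D = m (D \<inter> A j) + m (D - A j)"
    using split[of UNIV] by simp
  then show ?case using 1 2 s insert.hyps by (simp add: algebra_simps Int_commute)
qed

lemma simple_sum_mono:
  assumes m: "nonneg_charge m" and "finite F" "\<And>i. i \<in> F \<Longrightarrow> A i \<in> sets borel"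
    and "finite G" "\<And>j. j \<in> G \<Longrightarrow> B j \<in> sets borel"
    and le: "\<And>x. (\<Sum>i\<in>F. c i * indicat_real (A i) x) \<le> (\<Sum>j\<in>G. d j * indicat_real (B j) x)"
  shows "(\<Sum>i\<in>F. c i * m (A i)) \<le> (\<Sum>j\<in>G. d j * m (B j))"
proof -
  define S where "S = (case_sum A B)"
  define h where "h = (case_sum (\<lambda>i. - c i) d)"
  have "0 \<le> (\<Sum>i\<in>F <+> G. h i * m (S i \<inter> UNIV)) + 0 * m UNIV"
  proof (rule simple_sum_nonneg_on[OF m])
    show "0 \<le> (\<Sum>i\<in>F <+> G. h i * indicat_real (S i) x) + 0" for x
      unfolding sum.Plus[OF assms(2,4)] using le[of x] by (simp add: h_def S_def sum_negf)
  qed (use assms in \<open>auto simp: S_def\<close>)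
  then show ?thesis using assms(2,4) by (simp add: sum.Plus h_def S_def sum_negf)
qed

lemma B_b_bdd:
  assumes "f \<in> B_b"
  shows "bdd_above (f ` B)" "bdd_below (f ` B)"
proof -
  obtain c where c: "\<And>x. \<bar>f x\<bar> \<le> c" using assms B_bE by metis
  show "bdd_above (f ` B)" using c by (intro bdd_aboveI2[where M=c]) (auto simp: abs_le_iff)
  have "- c \<le> f x" for x using c[of x] by auto
  then show "bdd_below (f ` B)" by (intro bdd_belowI2[where m="- c"])
qed

lemma trivial_borel_partition: "{UNIV} \<in> borel_partitions UNIV"
  unfolding borel_partitions_def partition_on_def by auto

lemma step_le_upper_sum:
  assumes "nonneg_charge m" "f \<in> B_b" "P \<in> borel_partitions UNIV"
    and "finite F" "\<And>i. i \<in> F \<Longrightarrow> A i \<in> sets borel"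
    and le: "\<And>x. (\<Sum>i\<in>F. c i * indicat_real (A i) x) \<le> f x"
  shows "(\<Sum>i\<in>F. c i * m (A i)) \<le> (\<Sum>B\<in>P. (SUP x\<in>B. f x) * m B)"
proof (rule simple_sum_mono[OF assms(1,4,5)])
  fix x
  obtain B where B: "B \<in> P" "x \<in> B" using borel_partitionsD(4)[OF assms(3)] by blast
  then have "f x \<le> (SUP x\<in>B. f x)" using B_b_bdd[OF assms(2)] by (intro cSUP_upper)
  then show "(\<Sum>i\<in>F. c i * indicat_real (A i) x) \<le> (\<Sum>B\<in>P. (SUP x\<in>B. f x) * indicat_real B x)"
    unfolding sum_partition_indicator[OF assms(3) B] using le[of x] by simp
qed (use borel_partitionsD[OF assms(3)] in auto)

lemma lower_sum_le_step:
  assumes "nonneg_charge m" "f \<in> B_b" "P \<in> borel_partitions UNIV"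
    and "finite F" "\<And>i. i \<in> F \<Longrightarrow> A i \<in> sets borel"
    and le: "\<And>x. f x \<le> (\<Sum>i\<in>F. c i * indicat_real (A i) x)"
  shows "(\<Sum>B\<in>P. (INF x\<in>B. f x) * m B) \<le> (\<Sum>i\<in>F. c i * m (A i))"
proof (rule simple_sum_mono[OF assms(1) _ _ assms(4,5)])
  fix x
  obtain B where B: "B \<in> P" "x \<in> B" using borel_partitionsD(4)[OF assms(3)] by blast
  then have "(INF x\<in>B. f x) \<le> f x" using B_b_bdd[OF assms(2)] by (intro cINF_lower)
  then show "(\<Sum>B\<in>P. (INF x\<in>B. f x) * indicat_real B x) \<le> (\<Sum>i\<in>F. c i * indicat_real (A i) x)"
    unfolding sum_partition_indicator[OF assms(3) B] using le[of x] by simp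
qed (use borel_partitionsD[OF assms(3)] in auto)

lemma lower_step_le:
  assumes "f \<in> B_b" "P \<in> borel_partitions UNIV"
  shows "(\<Sum>B\<in>P. (INF x\<in>B. f x) * indicat_real B x) \<le> f x"
proof -
  obtain B where B: "B \<in> P" "x \<in> B" using borel_partitionsD(4)[OF assms(2)] by blast
  then have "(INF x\<in>B. f x) \<le> f x" using B_b_bdd[OF assms(1)] by (intro cINF_lower)
  then show ?thesis unfolding sum_partition_indicator[OF assms(2) B] .
qed

lemma lower_sum_le_upper_sum:
  assumes "nonneg_charge m" "f \<in> B_b" "P \<in> borel_partitions UNIV" "Q \<in> borel_partitions UNIV"
  shows "(\<Sum>B\<in>P. (INF x\<in>B. f x) * m B) \<le> (\<Sum>B\<in>Q. (SUP x\<in>B. f x) * m B)"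
  using assms borel_partitionsD[OF assms(3)]
  by (intro step_le_upper_sum[where A="\<lambda>B. B"] lower_step_le)

lemma upper_integral_eq_lower_integral:
  assumes m: "nonneg_charge m" and f: "f \<in> B_b"
  shows "upper_integral m f = lower_integral m f"
proof (rule antisym)
  have bdd: "bdd_above ((\<lambda>P. \<Sum>B\<in>P. (INF x\<in>B. f x) * m B) ` borel_partitions UNIV)"
    "bdd_below ((\<lambda>P. \<Sum>B\<in>P. (SUP x\<in>B. f x) * m B) ` borel_partitions UNIV)"
    using lower_sum_le_upper_sum[OF m f _ trivial_borel_partition]
      lower_sum_le_upper_sum[OF m f trivial_borel_partition]
    by (auto intro!: bdd_aboveI2 bdd_belowI2)
  show "lower_integral m f \<le> upper_integral m f"
    unfolding lower_integral_def upper_integral_def using trivial_borel_partition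
    by (intro cSUP_least cINF_greatest lower_sum_le_upper_sum m f) auto
  have "upper_integral m f \<le> lower_integral m f + e * m UNIV" if e: "0 < e" for e
  proof -
    obtain P where P: "P \<in> borel_partitions UNIV"
      "\<And>B x y. B \<in> P \<Longrightarrow> x \<in> B \<Longrightarrow> y \<in> B \<Longrightarrow> \<bar>f x - f y\<bar> \<le> e"
      by (rule small_oscillation_partition[OF f e]) blast
    note PD = borel_partitionsD[OF P(1)]
    have osc: "(SUP x\<in>B. f x) \<le> (INF x\<in>B. f x) + e" if "B \<in> P" for B
    proof (rule cSUP_least)
      fix x assume "x \<in> B"
      then have "f x - e \<le> f y" if "y \<in> B" for y using P(2)[OF \<open>B \<in> P\<close> _ that, of x] by auto
      then have "f x - e \<le> (INF y\<in>B. f y)" using PD(3)[OF that] by (intro cINF_greatest)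
      then show "f x \<le> (INF x\<in>B. f x) + e" by simp
    qed (use PD(3)[OF that] in auto)
    have "upper_integral m f \<le> (\<Sum>B\<in>P. (SUP x\<in>B. f x) * m B)"
      unfolding upper_integral_def by (intro cINF_lower bdd P)
    also have "\<dots> \<le> (\<Sum>B\<in>P. ((INF x\<in>B. f x) + e) * m B)"
      using osc m PD(2) unfolding nonneg_charge_def by (intro sum_mono mult_right_mono) auto
    also have "\<dots> = (\<Sum>B\<in>P. (INF x\<in>B. f x) * m B) + (\<Sum>B\<in>P. e * m B)"
      by (simp add: distrib_right sum.distrib)
    also have "(\<Sum>B\<in>P. (INF x\<in>B. f x) * m B) \<le> lower_integral m f"
      unfolding lower_integral_def by (intro cSUP_upper bdd P)
    also have "(\<Sum>B\<in>P. e * m B) \<le> (\<Sum>i\<in>{()}. e * m UNIV)"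
    proof (rule simple_sum_mono[OF m])
      fix x
      obtain B where B: "B \<in> P" "x \<in> B" using PD(4) by blast
      show "(\<Sum>B\<in>P. e * indicat_real B x) \<le> (\<Sum>i\<in>{()}. e * indicat_real UNIV x)"
        using sum_partition_indicator[OF P(1) B, of "\<lambda>_. e"] by simp
    qed (use PD in auto)
    finally show ?thesis by simp
  qed
  note gap = this
  show "upper_integral m f \<le> lower_integral m f"
  proof (rule field_le_epsilon)
    fix e :: real assume "0 < e"
    have "0 \<le> m UNIV" using m unfolding nonneg_charge_def by auto
    then have "e / (m UNIV + 1) * m UNIV \<le> e" "0 < e / (m UNIV + 1)"
      using \<open>0 < e\<close> by (auto simp: field_simps)
    then show "upper_integral m f \<le> lower_integral m f + e" using gap[of "e / (m UNIV + 1)"] by simp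
  qed
qed

lemma pos_darboux_eq:
  assumes "nonneg_charge m" "f \<in> B_b"
  shows "pos_darboux_integral m f = lower_integral m f" "pos_darboux_integral m f = upper_integral m f"
  using upper_integral_eq_lower_integral[OF assms] unfolding pos_darboux_integral_def by auto

lemma step_le_pos_darboux:
  assumes "nonneg_charge m" "f \<in> B_b" "finite F" "\<And>i. i \<in> F \<Longrightarrow> A i \<in> sets borel"
    and "\<And>x. (\<Sum>i\<in>F. c i * indicat_real (A i) x) \<le> f x"
  shows "(\<Sum>i\<in>F. c i * m (A i)) \<le> pos_darboux_integral m f"
  unfolding pos_darboux_eq(2)[OF assms(1,2)] upper_integral_def
  using trivial_borel_partition assms by (intro cINF_greatest step_le_upper_sum) auto

lemma pos_darboux_le_step:
  assumes "nonneg_charge m" "f \<in> B_b" "finite F" "\<And>i. i \<in> F \<Longrightarrow> A i \<in> sets borel"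
    and "\<And>x. f x \<le> (\<Sum>i\<in>F. c i * indicat_real (A i) x)"
  shows "pos_darboux_integral m f \<le> (\<Sum>i\<in>F. c i * m (A i))"
  unfolding pos_darboux_eq(1)[OF assms(1,2)] lower_integral_def
  using trivial_borel_partition assms by (intro cSUP_least lower_sum_le_step) auto

lemma pos_darboux_leI:
  assumes "nonneg_charge m" "f \<in> B_b"
    and "\<And>P. P \<in> borel_partitions UNIV \<Longrightarrow> (\<Sum>B\<in>P. (INF x\<in>B. f x) * m B) \<le> J"
  shows "pos_darboux_integral m f \<le> J"
  unfolding pos_darboux_eq(1)[OF assms(1,2)] lower_integral_def
  using trivial_borel_partition assms(3) by (intro cSUP_least) auto

text \<open>The lower sums of \<open>f\<close> and \<open>g\<close> need not come from the same partition: together they are the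
  integral of one step function below \<open>f + g\<close>, indexed by the disjoint union of the two partitions.\<close>

lemma pos_darboux_superadditive:
  assumes m: "nonneg_charge m" and f: "f \<in> B_b" and g: "g \<in> B_b"
  shows "pos_darboux_integral m f + pos_darboux_integral m g \<le> pos_darboux_integral m (\<lambda>x. f x + g x)"
    (is "_ + ?Ig \<le> ?J")
proof -
  have PQ: "(\<Sum>B\<in>P. (INF x\<in>B. f x) * m B) + (\<Sum>B\<in>Q. (INF x\<in>B. g x) * m B) \<le> ?J"
    if P: "P \<in> borel_partitions UNIV" and Q: "Q \<in> borel_partitions UNIV" for P Q
  proof -
    note fin = borel_partitionsD(1)[OF P] borel_partitionsD(1)[OF Q]
    define S where "S = case_sum (\<lambda>B::'a set. B) (\<lambda>B. B)"
    define h where "h = case_sum (\<lambda>B. INF x\<in>B. f x) (\<lambda>B. INF x\<in>B. g x)"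
    have "(\<Sum>i\<in>P <+> Q. h i * m (S i)) \<le> ?J"
    proof (rule step_le_pos_darboux[OF m B_b_add[OF f g]])
      show "(\<Sum>i\<in>P <+> Q. h i * indicat_real (S i) x) \<le> f x + g x" for x
        using lower_step_le[OF f P, of x] lower_step_le[OF g Q, of x] fin
        unfolding sum.Plus[OF fin] by (simp add: h_def S_def)
    qed (use borel_partitionsD[OF P] borel_partitionsD[OF Q] in \<open>auto simp: S_def\<close>)
    then show ?thesis using fin by (simp add: sum.Plus h_def S_def)
  qed
  have "pos_darboux_integral m f \<le> ?J - ?Ig"
  proof (rule pos_darboux_leI[OF m f])
    fix P :: "'a set set" assume P: "P \<in> borel_partitions UNIV"
    have "?Ig \<le> ?J - (\<Sum>B\<in>P. (INF x\<in>B. f x) * m B)"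
      using PQ[OF P] by (intro pos_darboux_leI[OF m g]) (simp add: algebra_simps)
    then show "(\<Sum>B\<in>P. (INF x\<in>B. f x) * m B) \<le> ?J - ?Ig" by simp
  qed
  then show ?thesis by simp
qed

lemma pos_darboux_bounds:
  assumes m: "nonneg_charge m" and f: "f \<in> B_b"
  shows "(\<And>x. f x \<le> c) \<Longrightarrow> pos_darboux_integral m f \<le> c * m UNIV"
    and "(\<And>x. c \<le> f x) \<Longrightarrow> c * m UNIV \<le> pos_darboux_integral m f"
  using pos_darboux_le_step[OF m f, of "{()}" "\<lambda>_. UNIV" "\<lambda>_. c"]
    step_le_pos_darboux[OF m f, of "{()}" "\<lambda>_. UNIV" "\<lambda>_. c"] by auto

lemma pos_darboux_indicator:
  assumes m: "nonneg_charge m" and "A \<in> sets borel"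
  shows "pos_darboux_integral m (indicat_real A) = m A"
  using pos_darboux_le_step[OF m B_b_indicator[OF assms(2)], of "{()}" "\<lambda>_. A" "\<lambda>_. 1"]
    step_le_pos_darboux[OF m B_b_indicator[OF assms(2)], of "{()}" "\<lambda>_. A" "\<lambda>_. 1"] assms(2)
  by (simp add: order_antisym)

lemma pos_darboux_uminus:
  assumes m: "nonneg_charge m" and f: "f \<in> B_b"
  shows "pos_darboux_integral m (\<lambda>x. - f x) = - pos_darboux_integral m f"
proof (rule antisym)
  have mf: "(\<lambda>x. - f x) \<in> B_b" using B_b_scale[OF f, of "-1"] by simp
  show "pos_darboux_integral m (\<lambda>x. - f x) \<le> - pos_darboux_integral m f"
    using pos_darboux_superadditive[OF m f mf] pos_darboux_bounds(1)[OF m B_b_const, of 0 0] by simp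
  have "- pos_darboux_integral m (\<lambda>x. - f x) \<le> pos_darboux_integral m f"
  proof -
    have "- (\<Sum>B\<in>P. (SUP x\<in>B. - f x) * m B) \<le> pos_darboux_integral m f"
      if P: "P \<in> borel_partitions UNIV" for P
    proof -
      have "(\<Sum>B\<in>P. - (SUP x\<in>B. - f x) * m B) \<le> pos_darboux_integral m f"
      proof (rule step_le_pos_darboux[OF m f])
        fix x
        obtain B where B: "B \<in> P" "x \<in> B" using borel_partitionsD(4)[OF P] by blast
        then have "- f x \<le> (SUP x\<in>B. - f x)" using B_b_bdd[OF mf] by (intro cSUP_upper)
        then show "(\<Sum>B\<in>P. - (SUP x\<in>B. - f x) * indicat_real B x) \<le> f x"
          unfolding sum_partition_indicator[OF P B] by simp
      qed (use borel_partitionsD[OF P] in auto)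
      then show ?thesis by (simp add: sum_negf)
    qed
    then have "- pos_darboux_integral m f \<le> (\<Sum>B\<in>P. (SUP x\<in>B. - f x) * m B)"
      if "P \<in> borel_partitions UNIV" for P using that by (simp add: minus_le_iff)
    then have "- pos_darboux_integral m f \<le> upper_integral m (\<lambda>x. - f x)"
      unfolding upper_integral_def using trivial_borel_partition by (intro cINF_greatest) auto
    then show ?thesis unfolding pos_darboux_eq(2)[OF m mf] by simp
  qed
  then show "- pos_darboux_integral m f \<le> pos_darboux_integral m (\<lambda>x. - f x)" by simp
qed

lemma pos_darboux_add:
  assumes m: "nonneg_charge m" and f: "f \<in> B_b" and g: "g \<in> B_b"
  shows "pos_darboux_integral m (\<lambda>x. f x + g x) = pos_darboux_integral m f + pos_darboux_integral m g"
proof -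
  have "(\<lambda>x. - f x) \<in> B_b" "(\<lambda>x. - g x) \<in> B_b" using B_b_scale[OF f, of "-1"] B_b_scale[OF g, of "-1"] by simp_all
  from pos_darboux_superadditive[OF m this]
  have "- pos_darboux_integral m f - pos_darboux_integral m g \<le> pos_darboux_integral m (\<lambda>x. - (f x + g x))"
    using m f g by (simp add: pos_darboux_uminus)
  then show ?thesis using pos_darboux_uminus[OF m B_b_add[OF f g]] pos_darboux_superadditive[OF m f g]
    by simp
qed

lemma pos_darboux_scale:
  assumes m: "nonneg_charge m" and f: "f \<in> B_b"
  shows "pos_darboux_integral m (\<lambda>x. c * f x) = c * pos_darboux_integral m f"
proof -
  have le: "c * pos_darboux_integral m f \<le> pos_darboux_integral m (\<lambda>x. c * f x)"
    if "0 < c" and f: "f \<in> B_b" for c f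
  proof -
    have "pos_darboux_integral m f \<le> pos_darboux_integral m (\<lambda>x. c * f x) / c"
    proof (rule pos_darboux_leI[OF m f])
      fix P :: "'a set set" assume P: "P \<in> borel_partitions UNIV"
      have "(\<Sum>B\<in>P. (c * (INF x\<in>B. f x)) * m B) \<le> pos_darboux_integral m (\<lambda>x. c * f x)"
      proof (rule step_le_pos_darboux[OF m B_b_scale[OF f]])
        show "(\<Sum>B\<in>P. (c * (INF x\<in>B. f x)) * indicat_real B x) \<le> c * f x" for x
          using mult_left_mono[OF lower_step_le[OF f P, of x], of c] that(1)
          by (simp add: sum_distrib_left mult.assoc)
      qed (use borel_partitionsD[OF P] in auto)
      then show "(\<Sum>B\<in>P. (INF x\<in>B. f x) * m B) \<le> pos_darboux_integral m (\<lambda>x. c * f x) / c"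
        using that(1) by (simp add: le_divide_eq mult.commute sum_distrib_left mult.left_commute)
    qed
    then show ?thesis using that(1) by (simp add: le_divide_eq mult.commute)
  qed
  have pos: "pos_darboux_integral m (\<lambda>x. c * f x) = c * pos_darboux_integral m f" if "0 < c" for c
  proof -
    have "inverse c * pos_darboux_integral m (\<lambda>x. c * f x) \<le> pos_darboux_integral m f"
      using le[of "inverse c" "\<lambda>x. c * f x"] that B_b_scale[OF f] by (simp add: mult.assoc[symmetric])
    then show ?thesis using le[OF that f] that by (simp add: field_simps)
  qed
  have zero: "pos_darboux_integral m (\<lambda>x. 0) = 0"
    using pos_darboux_bounds[OF m B_b_const, of 0 0] by simp
  consider "0 < c" | "c = 0" | "0 < - c" by linarith
  then show ?thesis
  proof cases
    case 3
    then show ?thesis using pos[OF 3] pos_darboux_uminus[OF m B_b_scale[OF f, of "- c"]] by simp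
  qed (use pos zero in auto)
qed

lemma pos_darboux_bounded_functional:
  assumes m: "nonneg_charge m"
  shows "bounded_functional_on B_b (pos_darboux_integral m)"
proof -
  have "\<bar>pos_darboux_integral m f\<bar> \<le> m UNIV * c" if "f \<in> B_b" "\<forall>x. \<bar>f x\<bar> \<le> c" for f c
    using pos_darboux_bounds[OF m that(1)] that(2)
    by (simp add: abs_le_iff minus_le_iff mult.commute) (metis mult_minus_left mult.commute minus_le_iff)
  then show ?thesis unfolding bounded_functional_on_def linear_functional_on_def
    using pos_darboux_add[OF m] pos_darboux_scale[OF m] by blast
qed

section \<open>Bounded charges and their Jordan decomposition\<close>

lemma baD:
  assumes "\<mu> \<in> ba"
  shows "A \<notin> sets borel \<Longrightarrow> \<mu> A = 0" "\<mu> {} = 0"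
    "A \<in> sets borel \<Longrightarrow> B \<in> sets borel \<Longrightarrow> A \<inter> B = {} \<Longrightarrow> \<mu> (A \<union> B) = \<mu> A + \<mu> B"
  using assms unfolding ba_def by auto

lemma abs_le_total_variation:
  assumes "\<mu> {} = 0" "A \<in> sets borel" "B \<in> sets borel" "B \<subseteq> A"
  shows "ennreal \<bar>\<mu> B\<bar> \<le> total_variation \<mu> A"
proof (cases "B = {}")
  case False
  have "{B, A - B} - {{}} \<in> borel_partitions A"
    using assms unfolding borel_partitions_def partition_on_def disjoint_def by auto
  moreover have "ennreal \<bar>\<mu> B\<bar> \<le> (\<Sum>C\<in>{B, A - B} - {{}}. ennreal \<bar>\<mu> C\<bar>)"
    using False by (intro member_le_sum) auto
  ultimately show ?thesis unfolding total_variation_def by (meson SUP_upper2)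
qed (use assms in auto)

lemma total_variation_eq_0I:
  assumes "\<And>B. B \<in> sets borel \<Longrightarrow> B \<subseteq> A \<Longrightarrow> \<mu> B = 0"
  shows "total_variation \<mu> A = 0"
proof -
  have "(\<Sum>B\<in>P. ennreal \<bar>\<mu> B\<bar>) = 0" if "P \<in> borel_partitions A" for P
    using that assms unfolding borel_partitions_def partition_on_def by (intro sum.neutral) auto
  then have "total_variation \<mu> A \<le> 0" unfolding total_variation_def by (intro SUP_least) simp
  then show ?thesis by simp
qed

lemma charge_finite_Union:
  fixes \<mu> :: "'a::topological_space set \<Rightarrow> real"
  assumes "\<mu> {} = 0"
    "\<And>A B. A \<in> sets borel \<Longrightarrow> B \<in> sets borel \<Longrightarrow> A \<inter> B = {} \<Longrightarrow> \<mu> (A \<union> B) = \<mu> A + \<mu> B"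
    and "finite P" "P \<subseteq> sets borel" "disjoint P"
  shows "\<mu> (\<Union>P) = (\<Sum>B\<in>P. \<mu> B)"
  using assms(3-)
proof (induction P rule: finite_induct)
  case (insert B P)
  have "\<Union>P \<in> sets borel" using insert by (intro sets.finite_Union) auto
  moreover have "B \<inter> C = {}" if "C \<in> P" for C
    using disjointD[OF insert.prems(2), of B C] insert.hyps that by auto
  then have "B \<inter> \<Union>P = {}" by blast
  ultimately have "\<mu> (B \<union> \<Union>P) = \<mu> B + \<mu> (\<Union>P)" using insert.prems assms(2) by auto
  moreover have "\<mu> (\<Union>P) = (\<Sum>B\<in>P. \<mu> B)"
    using insert.prems pairwise_subset[OF insert.prems(2), of P] by (intro insert.IH) auto
  ultimately show ?case using insert.hyps by simp
qed (use assms in auto)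

lemma charge_initial_Union:
  fixes A :: "nat \<Rightarrow> 'a::topological_space set"
  assumes null: "\<mu> {} = 0"
    and add: "\<And>A B. A \<in> sets borel \<Longrightarrow> B \<in> sets borel \<Longrightarrow> A \<inter> B = {} \<Longrightarrow> \<mu> (A \<union> B) = \<mu> A + \<mu> B"
    and A: "\<And>i. A i \<in> sets borel" "disjoint_family A"
  shows "\<mu> (\<Union>i<n. A i) = (\<Sum>i<n. \<mu> (A i))"
proof (induction n)
  case (Suc n)
  have "A i \<inter> A n = {}" if "i < n" for i
    using disjoint_family_onD[OF A(2), of i n] that by simp
  then have "(\<Union>i<n. A i) \<inter> A n = {}" by blast
  moreover have "(\<Union>i<n. A i) \<in> sets borel" using A(1) by blast
  ultimately have "\<mu> ((\<Union>i<n. A i) \<union> A n) = \<mu> (\<Union>i<n. A i) + \<mu> (A n)"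
    using A(1) by (intro add)
  moreover have "(\<Union>i<Suc n. A i) = (\<Union>i<n. A i) \<union> A n" by (simp add: lessThan_Suc Un_commute)
  ultimately show ?case using Suc by simp
qed (use null in simp)

text \<open>Splitting a partition into the cells of nonnegative and of negative charge bounds the variation
  sum by twice the bound on the charge.\<close>

lemma ba_iff_bounded:
  "\<mu> \<in> ba \<longleftrightarrow> (\<forall>A. A \<notin> sets borel \<longrightarrow> \<mu> A = 0) \<and> \<mu> {} = 0 \<and>
     (\<forall>A\<in>sets borel. \<forall>B\<in>sets borel. A \<inter> B = {} \<longrightarrow> \<mu> (A \<union> B) = \<mu> A + \<mu> B) \<and>
     (\<exists>C. \<forall>A\<in>sets borel. \<bar>\<mu> A\<bar> \<le> C)" (is "_ \<longleftrightarrow> _ \<and> ?null \<and> ?add \<and> _")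
proof -
  have "\<bar>\<mu> A\<bar> \<le> enn2real (total_variation \<mu> UNIV)"
    if "total_variation \<mu> UNIV < \<infinity>" "\<mu> {} = 0" "A \<in> sets borel" for A
    using enn2real_mono[OF abs_le_total_variation[of \<mu> UNIV A]] that by simp
  moreover have "total_variation \<mu> UNIV < \<infinity>"
    if C: "\<forall>A\<in>sets borel. \<bar>\<mu> A\<bar> \<le> C" and charge: ?null ?add for C
  proof -
    have "(\<Sum>B\<in>P. ennreal \<bar>\<mu> B\<bar>) \<le> ennreal (2 * C)" if P: "P \<in> borel_partitions UNIV" for P
    proof -
      have fin: "finite P" "P \<subseteq> sets borel" "disjoint P"
        using P unfolding borel_partitions_def partition_on_def by auto
      define N where "N = {B \<in> P. \<mu> B < 0}"
      define M where "M = P - N"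
      have un: "\<mu> (\<Union>Q) = (\<Sum>B\<in>Q. \<mu> B)" "\<bar>\<mu> (\<Union>Q)\<bar> \<le> C" if "Q \<subseteq> P" for Q
      proof -
        have Q: "finite Q" "Q \<subseteq> sets borel" "disjoint Q"
          using that fin by (auto intro: finite_subset pairwise_subset)
        then show "\<mu> (\<Union>Q) = (\<Sum>B\<in>Q. \<mu> B)" using charge by (intro charge_finite_Union) auto
        show "\<bar>\<mu> (\<Union>Q)\<bar> \<le> C" using Q C by (simp add: sets.finite_Union)
      qed
      have sub: "N \<subseteq> P" "M \<subseteq> P" unfolding N_def M_def by auto
      have "(\<Sum>B\<in>P. \<bar>\<mu> B\<bar>) = (\<Sum>B\<in>M. \<bar>\<mu> B\<bar>) + (\<Sum>B\<in>N. \<bar>\<mu> B\<bar>)"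
        unfolding M_def using sub(1) fin(1) by (rule sum.subset_diff)
      also have "\<dots> = (\<Sum>B\<in>M. \<mu> B) + (\<Sum>B\<in>N. - \<mu> B)"
        by (intro arg_cong2[where f="(+)"] sum.cong) (auto simp: M_def N_def)
      also have "\<dots> = \<mu> (\<Union>M) - \<mu> (\<Union>N)" using un(1) sub by (simp add: sum_negf)
      also have "\<dots> \<le> 2 * C" using un(2)[OF sub(1)] un(2)[OF sub(2)] by linarith
      finally show ?thesis by (simp add: sum_ennreal ennreal_leI)
    qed
    then have "total_variation \<mu> UNIV \<le> ennreal (2 * C)"
      unfolding total_variation_def by (rule SUP_least)
    then show ?thesis using ennreal_less_top order_le_less_trans infinity_ennreal_def by metis
  qed
  ultimately show ?thesis unfolding ba_def mem_Collect_eq by meson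
qed

lemma ba_bounded:
  assumes "\<mu> \<in> ba"
  obtains C where "\<And>A. A \<in> sets borel \<Longrightarrow> \<bar>\<mu> A\<bar> \<le> C"
  using assms unfolding ba_iff_bounded by blast

lemma ba_combine:
  assumes "\<mu> \<in> ba" "\<nu> \<in> ba"
  shows "(\<lambda>A. a * \<mu> A + b * \<nu> A) \<in> ba"
proof -
  obtain C D where C: "\<And>A. A \<in> sets borel \<Longrightarrow> \<bar>\<mu> A\<bar> \<le> C" and D: "\<And>A. A \<in> sets borel \<Longrightarrow> \<bar>\<nu> A\<bar> \<le> D"
    using assms by (metis ba_bounded)
  have "\<bar>a * \<mu> A + b * \<nu> A\<bar> \<le> \<bar>a\<bar> * C + \<bar>b\<bar> * D" if "A \<in> sets borel" for A
  proof -
    have "\<bar>a * \<mu> A + b * \<nu> A\<bar> \<le> \<bar>a\<bar> * \<bar>\<mu> A\<bar> + \<bar>b\<bar> * \<bar>\<nu> A\<bar>"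
      by (metis abs_mult abs_triangle_ineq)
    also have "\<dots> \<le> \<bar>a\<bar> * C + \<bar>b\<bar> * D"
      using C[OF that] D[OF that] by (intro add_mono mult_left_mono) auto
    finally show ?thesis .
  qed
  then have "\<exists>C. \<forall>A\<in>sets borel. \<bar>a * \<mu> A + b * \<nu> A\<bar> \<le> C" by blast
  then show ?thesis unfolding ba_iff_bounded[of "\<lambda>A. a * \<mu> A + b * \<nu> A"]
    using baD[OF assms(1)] baD[OF assms(2)] by (simp add: algebra_simps)
qed

lemma ba_uminus: "\<mu> \<in> ba \<Longrightarrow> (\<lambda>A. - \<mu> A) \<in> ba"
  using ba_combine[of \<mu> \<mu> "-1" 0] by simp

lemma le_pos_part:
  assumes "\<mu> \<in> ba" "B \<in> sets borel" "B \<subseteq> A"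
  shows "\<mu> B \<le> pos_part \<mu> A"
proof -
  obtain C where C: "\<And>A. A \<in> sets borel \<Longrightarrow> \<bar>\<mu> A\<bar> \<le> C"
    using ba_bounded[OF assms(1)] by blast
  then have "bdd_above (\<mu> ` {B \<in> sets borel. B \<subseteq> A})"
    by (intro bdd_aboveI2[where M=C]) (auto simp: abs_le_iff)
  then show ?thesis unfolding pos_part_def using assms by (intro cSUP_upper) auto
qed

lemma pos_part_leI:
  assumes "\<And>B. B \<in> sets borel \<Longrightarrow> B \<subseteq> A \<Longrightarrow> \<mu> B \<le> c"
  shows "pos_part \<mu> A \<le> c"
  unfolding pos_part_def using assms by (intro cSUP_least) auto

lemma nonneg_charge_pos_part:
  assumes "\<mu> \<in> ba"
  shows "nonneg_charge (pos_part \<mu>)"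
proof -
  note le = le_pos_part[OF assms] and D = baD[OF assms]
  have nonneg: "0 \<le> pos_part \<mu> A" for A using le[of "{}" A] D(2) by simp
  moreover have "pos_part \<mu> {} = 0"
    using pos_part_leI[of "{}" \<mu> 0] D(2) nonneg[of "{}"] by (simp add: order_antisym)
  moreover have "pos_part \<mu> (A \<union> B) = pos_part \<mu> A + pos_part \<mu> B"
    if A: "A \<in> sets borel" and B: "B \<in> sets borel" and AB: "A \<inter> B = {}" for A B
  proof (rule antisym)
    show "pos_part \<mu> (A \<union> B) \<le> pos_part \<mu> A + pos_part \<mu> B"
    proof (rule pos_part_leI)
      fix C assume C: "C \<in> sets borel" "C \<subseteq> A \<union> B"
      have "C = (C \<inter> A) \<union> (C \<inter> B)" using C by auto
      then have "\<mu> C = \<mu> (C \<inter> A) + \<mu> (C \<inter> B)" using D(3)[of "C \<inter> A" "C \<inter> B"] A B C AB by auto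
      then show "\<mu> C \<le> pos_part \<mu> A + pos_part \<mu> B"
        using le[of "C \<inter> A" A] le[of "C \<inter> B" B] A B C by auto
    qed
    have "pos_part \<mu> A \<le> pos_part \<mu> (A \<union> B) - pos_part \<mu> B"
    proof (rule pos_part_leI)
      fix C assume C: "C \<in> sets borel" "C \<subseteq> A"
      have "pos_part \<mu> B \<le> pos_part \<mu> (A \<union> B) - \<mu> C"
      proof (rule pos_part_leI)
        fix E assume E: "E \<in> sets borel" "E \<subseteq> B"
        then have "\<mu> (C \<union> E) = \<mu> C + \<mu> E" using C AB by (intro D(3)) auto
        then show "\<mu> E \<le> pos_part \<mu> (A \<union> B) - \<mu> C" 
          using le[of "C \<union> E" "A \<union> B"] C E by (simp add: le_supI1 le_supI2)
      qed
      then show "\<mu> C \<le> pos_part \<mu> (A \<union> B) - pos_part \<mu> B" by simp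
    qed
    then show "pos_part \<mu> A + pos_part \<mu> B \<le> pos_part \<mu> (A \<union> B)" by simp
  qed
  ultimately show ?thesis unfolding nonneg_charge_def by blast
qed

text \<open>Passing to complements in \<open>A\<close> exchanges the two suprema, since
  \<open>- \<mu> B = \<mu> (A - B) - \<mu> A\<close>.\<close>

lemma neg_part_eq:
  assumes \<mu>: "\<mu> \<in> ba" and A: "A \<in> sets borel"
  shows "neg_part \<mu> A = pos_part \<mu> A - \<mu> A"
proof (rule antisym)
  have compl: "\<mu> (A - B) = \<mu> A - \<mu> B" if "B \<in> sets borel" "B \<subseteq> A" for B
  proof -
    have "B \<union> (A - B) = A" using that by auto
    then show ?thesis using baD(3)[OF \<mu> that(1), of "A - B"] that A by auto
  qed
  show "neg_part \<mu> A \<le> pos_part \<mu> A - \<mu> A"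
    unfolding neg_part_def
  proof (rule pos_part_leI)
    fix B assume "B \<in> sets borel" "B \<subseteq> A"
    then show "- \<mu> B \<le> pos_part \<mu> A - \<mu> A" using compl le_pos_part[OF \<mu>, of "A - B" A] A by auto
  qed
  have "pos_part \<mu> A \<le> neg_part \<mu> A + \<mu> A"
  proof (rule pos_part_leI)
    fix B assume "B \<in> sets borel" "B \<subseteq> A"
    then show "\<mu> B \<le> neg_part \<mu> A + \<mu> A"
      using compl le_pos_part[OF ba_uminus[OF \<mu>], of "A - B" A] A unfolding neg_part_def by auto
  qed
  then show "pos_part \<mu> A - \<mu> A \<le> neg_part \<mu> A" by simp
qed

section \<open>The Darboux integral against a bounded charge\<close>

lemma darboux_bounded_functional:
  assumes "\<mu> \<in> ba"
  shows "bounded_functional_on B_b (darboux_integral \<mu>)"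
proof -
  have "nonneg_charge (neg_part \<mu>)"
    unfolding neg_part_def using assms by (intro nonneg_charge_pos_part ba_uminus)
  then have "bounded_functional_on B_b (\<lambda>f. 1 * pos_darboux_integral (pos_part \<mu>) f
      + (-1) * pos_darboux_integral (neg_part \<mu>) f)"
    by (intro bounded_functional_on_combine pos_darboux_bounded_functional nonneg_charge_pos_part assms)
  then show ?thesis unfolding darboux_integral_def by simp
qed

lemma darboux_linear: "\<mu> \<in> ba \<Longrightarrow> linear_functional_on B_b (darboux_integral \<mu>)"
  using darboux_bounded_functional unfolding bounded_functional_on_def by blast

lemma darboux_indicator:
  assumes "\<mu> \<in> ba" "A \<in> sets borel"
  shows "darboux_integral \<mu> (indicat_real A) = \<mu> A"
proof -
  have "nonneg_charge (neg_part \<mu>)"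
    unfolding neg_part_def using assms by (intro nonneg_charge_pos_part ba_uminus)
  then show ?thesis using assms
    by (simp add: darboux_integral_def pos_darboux_indicator nonneg_charge_pos_part neg_part_eq)
qed

lemma darboux_unique:
  assumes "\<mu> \<in> ba" "bounded_functional_on B_b \<Lambda>"
    and "\<And>A. A \<in> sets borel \<Longrightarrow> \<Lambda> (indicat_real A) = \<mu> A" and "f \<in> B_b"
  shows "darboux_integral \<mu> f = \<Lambda> f"
  by (rule bounded_functional_eqI[OF darboux_bounded_functional[OF assms(1)] assms(2) _ assms(4)])
    (simp add: darboux_indicator assms(1,3))

lemma darboux_combine:
  assumes "\<mu> \<in> ba" "\<nu> \<in> ba" "f \<in> B_b"
  shows "darboux_integral (\<lambda>A. a * \<mu> A + b * \<nu> A) f = a * darboux_integral \<mu> f + b * darboux_integral \<nu> f"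
  using assms
  by (intro darboux_unique[of _ "\<lambda>f. a * darboux_integral \<mu> f + b * darboux_integral \<nu> f"] ba_combine
      bounded_functional_on_combine darboux_bounded_functional) (auto simp: darboux_indicator)

lemma darboux_add:
  assumes "\<mu> \<in> ba" "\<nu> \<in> ba" "f \<in> B_b"
  shows "darboux_integral (\<lambda>A. \<mu> A + \<nu> A) f = darboux_integral \<mu> f + darboux_integral \<nu> f"
  using darboux_combine[OF assms, of 1 1] by simp

lemma darboux_diff:
  assumes "\<mu> \<in> ba" "\<nu> \<in> ba" "f \<in> B_b"
  shows "darboux_integral (\<lambda>A. \<mu> A - \<nu> A) f = darboux_integral \<mu> f - darboux_integral \<nu> f"
  using darboux_combine[OF assms, of 1 "-1"] by simp

lemma ba_add: "\<mu> \<in> ba \<Longrightarrow> \<nu> \<in> ba \<Longrightarrow> (\<lambda>A. \<mu> A + \<nu> A) \<in> ba"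
  using ba_combine[of \<mu> \<nu> 1 1] by simp

lemma ba_diff: "\<mu> \<in> ba \<Longrightarrow> \<nu> \<in> ba \<Longrightarrow> (\<lambda>A. \<mu> A - \<nu> A) \<in> ba"
  using ba_combine[of \<mu> \<nu> 1 "-1"] by simp

definition charge_of :: "(('a::topological_space \<Rightarrow> real) \<Rightarrow> real) \<Rightarrow> 'a set \<Rightarrow> real" where
  "charge_of \<Lambda> A = (if A \<in> sets borel then \<Lambda> (indicat_real A) else 0)"

text \<open>Together with \<open>darboux_charge_of\<close> this is the duality between \<open>B_b\<close> with the sup norm and
  \<open>ba\<close>.\<close>

lemma charge_of_in_ba:
  assumes "bounded_functional_on B_b \<Lambda>"
  shows "charge_of \<Lambda> \<in> ba"
proof -
  have lin: "linear_functional_on B_b \<Lambda>" using assms unfolding bounded_functional_on_def by simp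
  obtain C where C: "\<And>f c. f \<in> B_b \<Longrightarrow> \<forall>x. \<bar>f x\<bar> \<le> c \<Longrightarrow> \<bar>\<Lambda> f\<bar> \<le> C * c"
    using assms unfolding bounded_functional_on_def by metis
  have "\<bar>charge_of \<Lambda> A\<bar> \<le> C" if "A \<in> sets borel" for A
    using C[of "indicat_real A" 1] that B_b_indicator[OF that] by (simp add: charge_of_def)
  moreover have "charge_of \<Lambda> {} = 0"
    using linear_functional_onD(2)[OF lin B_b_const, of 0 0] by (simp add: charge_of_def indicator_def[abs_def])
  moreover have "charge_of \<Lambda> (A \<union> B) = charge_of \<Lambda> A + charge_of \<Lambda> B"
    if "A \<in> sets borel" "B \<in> sets borel" "A \<inter> B = {}" for A B
  proof -
    have "indicat_real (A \<union> B) = (\<lambda>x. indicat_real A x + indicat_real B x)"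
      using that(3) by (auto simp: indicator_def fun_eq_iff)
    then show ?thesis using linear_functional_onD(1)[OF lin, of "indicat_real A" "indicat_real B"]
        that B_b_indicator by (auto simp: charge_of_def)
  qed
  ultimately show ?thesis unfolding ba_iff_bounded[of "charge_of \<Lambda>"]
    by (auto simp: charge_of_def)
qed

lemma darboux_charge_of:
  assumes "bounded_functional_on B_b \<Lambda>" "f \<in> B_b"
  shows "darboux_integral (charge_of \<Lambda>) f = \<Lambda> f"
  using assms by (intro darboux_unique charge_of_in_ba) (auto simp: charge_of_def)

section \<open>Countably additive charges and finite measures\<close>

lemma ca_subset_ba: "ca \<subseteq> ba"
  unfolding ca_def by auto

lemma caD: "\<nu> \<in> ca \<Longrightarrow> range A \<subseteq> sets borel \<Longrightarrow> disjoint_family A \<Longrightarrow> (\<lambda>i::nat. \<nu> (A i)) sums \<nu> (\<Union>i. A i)"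
  unfolding ca_def by auto

lemma ca_combine:
  assumes "\<mu> \<in> ca" "\<nu> \<in> ca"
  shows "(\<lambda>A. a * \<mu> A + b * \<nu> A) \<in> ca"
  using ba_combine[of \<mu> \<nu> a b] caD[OF assms(1)] caD[OF assms(2)] assms ca_subset_ba
  unfolding ca_def by (auto intro!: sums_add sums_mult)

lemma ca_diff: "\<mu> \<in> ca \<Longrightarrow> \<nu> \<in> ca \<Longrightarrow> (\<lambda>A. \<mu> A - \<nu> A) \<in> ca"
  using ca_combine[of \<mu> \<nu> 1 "-1"] by simp

lemma ca_add: "\<mu> \<in> ca \<Longrightarrow> \<nu> \<in> ca \<Longrightarrow> (\<lambda>A. \<mu> A + \<nu> A) \<in> ca"
  using ca_combine[of \<mu> \<nu> 1 1] by simp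

lemma measure_in_ca:
  fixes M :: "'a::topological_space measure"
  assumes "finite_measure M" and M[measurable_cong]: "sets M = sets borel"
  shows "measure M \<in> ca"
proof -
  interpret finite_measure M by fact
  have "measure M \<in> ba" unfolding ba_iff_bounded
    using bounded_measure finite_measure_Union M by (auto simp: measure_notin_sets)
  then show ?thesis unfolding ca_def using finite_measure_UNION M by auto
qed

lemma B_b_integrable:
  assumes "finite_measure M" "sets M = sets borel" "f \<in> B_b"
  shows "integrable M f"
proof -
  obtain c where "\<And>x. \<bar>f x\<bar> \<le> c" using assms(3) B_bE by metis
  moreover have "f \<in> borel_measurable M"
    using B_b_measurable[OF assms(3)] measurable_cong_sets[OF assms(2) refl] by auto
  ultimately show ?thesis using assms(1) by (intro finite_measure.integrable_const_bound[of M _ c]) auto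
qed

lemma lebesgue_bounded_functional:
  assumes M: "finite_measure M" "sets M = sets borel"
  shows "bounded_functional_on B_b (\<lambda>f. \<integral>x. f x \<partial>M)"
proof -
  interpret finite_measure M by fact
  have "\<bar>\<integral>x. f x \<partial>M\<bar> \<le> measure M (space M) * c" if "f \<in> B_b" "\<forall>x. \<bar>f x\<bar> \<le> c" for f c
  proof -
    have "\<bar>\<integral>x. f x \<partial>M\<bar> \<le> (\<integral>x. \<bar>f x\<bar> \<partial>M)" by (rule integral_abs_bound)
    also have "\<dots> \<le> (\<integral>x. c \<partial>M)"
      using that B_b_integrable[OF M that(1)] by (intro integral_mono) auto
    finally show ?thesis by simp
  qed
  then show ?thesis unfolding bounded_functional_on_def linear_functional_on_def
    using B_b_integrable[OF M] by auto
qed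

lemma measure_of_nonneg_countably_additive:
  fixes m :: "'a::topological_space set \<Rightarrow> real"
  assumes "m {} = 0" "\<And>A. A \<in> sets borel \<Longrightarrow> 0 \<le> m A"
    and sums: "\<And>A::nat \<Rightarrow> 'a set. range A \<subseteq> sets borel \<Longrightarrow> disjoint_family A \<Longrightarrow> (\<lambda>i. m (A i)) sums m (\<Union>i. A i)"
  obtains M where "finite_measure M" "sets M = sets borel" "\<And>A. A \<in> sets borel \<Longrightarrow> measure M A = m A"
proof -
  define M where "M = measure_of (UNIV::'a set) (sets borel) (\<lambda>A. ennreal (m A))"
  have sets: "sets M = sets borel" unfolding M_def
    by (metis sets.sets_measure_of_eq space_borel)
  have em: "emeasure M A = ennreal (m A)" if "A \<in> sets borel" for A
    unfolding M_def
  proof (rule emeasure_measure_of_sigma)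
    show "sigma_algebra UNIV (sets borel)" using sets.sigma_algebra_axioms[of borel] by simp
    show "positive (sets borel) (\<lambda>A. ennreal (m A))" unfolding positive_def using assms by simp
    show "countably_additive (sets borel) (\<lambda>A. ennreal (m A))"
    proof (rule countably_additiveI)
      fix A :: "nat \<Rightarrow> 'a set"
      assume A: "range A \<subseteq> sets borel" "disjoint_family A"
      from sums[OF this] show "(\<Sum>i. ennreal (m (A i))) = ennreal (m (\<Union>i. A i))"
        using A assms(2) by (subst suminf_ennreal2) (auto simp: sums_iff)
    qed
  qed (use that in auto)
  have "finite_measure M"
    using em[of UNIV] by (intro finite_measureI) (simp add: sets_eq_imp_space_eq[OF sets])
  moreover have "measure M A = m A" if "A \<in> sets borel" for A
    using em[OF that] assms(2)[OF that] by (simp add: measure_def)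
  ultimately show ?thesis using sets that by blast
qed

text \<open>Monotonicity bounds the partial sums by the value on the union; conversely a Borel subset of the
  union is cut into its pieces in the \<open>A i\<close>, where countable additivity of \<open>\<nu>\<close> applies.\<close>

lemma pos_part_countably_additive:
  assumes \<nu>: "\<nu> \<in> ca" and A: "range A \<subseteq> sets borel" "disjoint_family (A :: nat \<Rightarrow> _)"
  shows "(\<lambda>i. pos_part \<nu> (A i)) sums pos_part \<nu> (\<Union>i. A i)"
proof -
  have ba: "\<nu> \<in> ba" using \<nu> ca_subset_ba by auto
  note charge = nonneg_charge_pos_part[OF ba, unfolded nonneg_charge_def]
  have meas: "A i \<in> sets borel" for i using A by auto
  have fin: "(\<Sum>i<n. pos_part \<nu> (A i)) = pos_part \<nu> (\<Union>i<n. A i)" for n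
    using charge A meas by (intro charge_initial_Union[symmetric]) blast+
  have nn: "0 \<le> pos_part \<nu> (A i)" for i using charge meas by auto
  have part: "(\<Sum>i<n. pos_part \<nu> (A i)) \<le> pos_part \<nu> (\<Union>i. A i)" for n
    unfolding fin by (intro pos_part_leI le_pos_part[OF ba]) auto
  have summable: "summable (\<lambda>i. pos_part \<nu> (A i))"
    by (rule summableI_nonneg_bounded[OF nn part])
  have "pos_part \<nu> (\<Union>i. A i) \<le> (\<Sum>i. pos_part \<nu> (A i))"
  proof (rule pos_part_leI)
    fix B assume B: "B \<in> sets borel" "B \<subseteq> (\<Union>i. A i)"
    have "(\<lambda>i. \<nu> (B \<inter> A i)) sums \<nu> (\<Union>i. B \<inter> A i)"
      using B(1) meas by (intro caD[OF \<nu>] disjoint_family_subset[OF A(2)]) auto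
    moreover have "(\<Union>i. B \<inter> A i) = B" using B by auto
    ultimately have "(\<lambda>i. \<nu> (B \<inter> A i)) sums \<nu> B" by simp
    moreover have "\<nu> (B \<inter> A i) \<le> pos_part \<nu> (A i)" for i
      by (rule le_pos_part[OF ba sets.Int[OF B(1) meas] Int_lower2])
    ultimately show "\<nu> B \<le> (\<Sum>i. pos_part \<nu> (A i))"
      by (intro sums_le[OF _ _ summable_sums[OF summable]])
  qed
  moreover have "(\<Sum>i. pos_part \<nu> (A i)) \<le> pos_part \<nu> (\<Union>i. A i)"
    using part by (rule suminf_le_const[OF summable])
  ultimately show ?thesis using summable by (simp add: sums_iff)
qed

lemma ca_eq_measure_diff:
  assumes \<nu>: "\<nu> \<in> ca"
  obtains M N where "finite_measure M" "sets M = sets borel" "finite_measure N" "sets N = sets borel"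
    "\<nu> = (\<lambda>A. measure M A - measure N A)"
proof -
  have ba: "\<nu> \<in> ba" using \<nu> ca_subset_ba by auto
  have pc: "nonneg_charge (pos_part \<nu>)" "nonneg_charge (neg_part \<nu>)"
    unfolding neg_part_def using ba by (auto intro: nonneg_charge_pos_part ba_uminus)
  obtain M where M: "finite_measure M" "sets M = sets borel"
      "\<And>A. A \<in> sets borel \<Longrightarrow> measure M A = pos_part \<nu> A"
    using measure_of_nonneg_countably_additive[of "pos_part \<nu>"] pos_part_countably_additive[OF \<nu>] pc(1)
    unfolding nonneg_charge_def by blast
  have neg: "(\<lambda>i. neg_part \<nu> (A i)) sums neg_part \<nu> (\<Union>i. A i)"
    if A: "range A \<subseteq> sets borel" "disjoint_family A" for A :: "nat \<Rightarrow> 'a set"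
  proof -
    have "(\<lambda>i. pos_part \<nu> (A i) - \<nu> (A i)) sums (pos_part \<nu> (\<Union>i. A i) - \<nu> (\<Union>i. A i))"
      using A by (intro sums_diff pos_part_countably_additive \<nu> caD)
    moreover have "(\<Union>i. A i) \<in> sets borel" "\<And>i. A i \<in> sets borel" using A by auto
    ultimately show ?thesis by (simp add: neg_part_eq[OF ba])
  qed
  obtain N where N: "finite_measure N" "sets N = sets borel"
      "\<And>A. A \<in> sets borel \<Longrightarrow> measure N A = neg_part \<nu> A"
    using measure_of_nonneg_countably_additive[of "neg_part \<nu>"] neg pc(2)
    unfolding nonneg_charge_def by blast
  have "\<nu> A = measure M A - measure N A" for A
  proof (cases "A \<in> sets borel")
    case True
    then show ?thesis using M(3) N(3) neg_part_eq[OF ba] by simp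
  next
    case False
    then show ?thesis using baD(1)[OF ba] M(2) N(2) by (simp add: measure_notin_sets)
  qed
  then show ?thesis using that[OF M(1,2) N(1,2)] by blast
qed

lemma darboux_measure_diff:
  assumes M: "finite_measure M" "sets M = sets borel" and N: "finite_measure N" "sets N = sets borel"
    and f: "f \<in> B_b"
  shows "darboux_integral (\<lambda>A. measure M A - measure N A) f = (\<integral>x. f x \<partial>M) - (\<integral>x. f x \<partial>N)"
proof (rule darboux_unique[OF _ _ _ f])
  show "(\<lambda>A. measure M A - measure N A) \<in> ba"
    using ca_diff[OF measure_in_ca[OF M] measure_in_ca[OF N]] ca_subset_ba by auto
  show "bounded_functional_on B_b (\<lambda>f. (\<integral>x. f x \<partial>M) - (\<integral>x. f x \<partial>N))"
    using bounded_functional_on_combine[OF lebesgue_bounded_functional[OF M]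
        lebesgue_bounded_functional[OF N], of 1 "-1"] by simp
qed (use M N in auto)

lemma darboux_dominated_convergence:
  assumes \<nu>: "\<nu> \<in> ca" and f: "\<And>n. f n \<in> B_b" and g: "g \<in> B_b"
    and bound: "\<And>n x. \<bar>f n x\<bar> \<le> c" and lim: "\<And>x. (\<lambda>n. f n x) \<longlonglongrightarrow> g x"
  shows "(\<lambda>n. darboux_integral \<nu> (f n)) \<longlonglongrightarrow> darboux_integral \<nu> g"
proof -
  obtain M N where MN: "finite_measure M" "sets M = sets borel" "finite_measure N" "sets N = sets borel"
    "\<nu> = (\<lambda>A. measure M A - measure N A)" using ca_eq_measure_diff[OF \<nu>] by metis
  have conv: "(\<lambda>n. \<integral>x. f n x \<partial>L) \<longlonglongrightarrow> (\<integral>x. g x \<partial>L)"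
    if L: "finite_measure L" "sets L = sets borel" for L
  proof (rule integral_dominated_convergence[where w="\<lambda>_. c"])
    interpret finite_measure L by fact
    show "integrable L (\<lambda>_. c)" by simp
    show "f n \<in> borel_measurable L" "g \<in> borel_measurable L" for n
      using f g B_b_integrable[OF L] borel_measurable_integrable by blast+
  qed (use lim bound in auto)
  show ?thesis unfolding MN(5) using MN f g
    by (auto simp: darboux_measure_diff intro!: tendsto_diff conv)
qed

section \<open>Continuous functionals for the topology of the seminorms\<close>

definition bounded_function_space :: "('a::topological_space \<Rightarrow> real) set \<Rightarrow> bool" where
  "bounded_function_space V \<longleftrightarrow> V \<subseteq> B_b \<and> (\<lambda>x. 0) \<in> V \<and>
     (\<forall>f\<in>V. \<forall>g\<in>V. (\<lambda>x. f x + g x) \<in> V) \<and> (\<forall>c. \<forall>f\<in>V. (\<lambda>x. c * f x) \<in> V)"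

lemma bounded_function_spaceD:
  assumes "bounded_function_space V"
  shows "f \<in> V \<Longrightarrow> f \<in> B_b" "(\<lambda>x. 0) \<in> V" "f \<in> V \<Longrightarrow> g \<in> V \<Longrightarrow> (\<lambda>x. f x + g x) \<in> V"
    "f \<in> V \<Longrightarrow> (\<lambda>x. c * f x) \<in> V" "f \<in> V \<Longrightarrow> g \<in> V \<Longrightarrow> (\<lambda>x. f x - g x) \<in> V"
proof -
  show sc: "f \<in> V \<Longrightarrow> (\<lambda>x. c * f x) \<in> V" for c f
    using assms unfolding bounded_function_space_def by blast
  show add: "f \<in> V \<Longrightarrow> g \<in> V \<Longrightarrow> (\<lambda>x. f x + g x) \<in> V" for f g
    using assms unfolding bounded_function_space_def by blast
  show "f \<in> V \<Longrightarrow> g \<in> V \<Longrightarrow> (\<lambda>x. f x - g x) \<in> V"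
    using add[OF _ sc[of g "-1"], of f] by simp
qed (use assms in \<open>auto simp: bounded_function_space_def\<close>)

lemma bounded_function_space_B_b: "bounded_function_space B_b"
  unfolding bounded_function_space_def by (auto intro: B_b_add B_b_scale)

lemma bounded_function_space_C_b: "bounded_function_space C_b"
  unfolding bounded_function_space_def using C_b_subset_B_b by (auto intro: C_b_add C_b_scale)

lemma zero_in_ca: "(\<lambda>A. 0) \<in> ca"
  unfolding ca_def mem_Collect_eq ba_iff_bounded by auto

lemma darboux_zero_function:
  assumes "\<mu> \<in> ba"
  shows "darboux_integral \<mu> (\<lambda>x. 0) = 0"
  using linear_functional_onD(2)[OF darboux_linear[OF assms] B_b_const, of 0 0] by simp

lemma abs_le_SUP_abs:
  assumes "f \<in> B_b" "x \<in> K"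
  shows "\<bar>f x\<bar> \<le> (SUP x\<in>K. \<bar>f x\<bar>)"
proof -
  obtain c where "\<And>x. \<bar>f x\<bar> \<le> c" using assms(1) B_bE by metis
  then show ?thesis using assms(2) by (intro cSUP_upper bdd_aboveI2[where M=c])
qed

lemma p_K_add:
  assumes "\<mu> \<in> ba" "K \<noteq> {}" "f \<in> B_b" "g \<in> B_b"
  shows "p_K K \<mu> (\<lambda>x. f x + g x) \<le> p_K K \<mu> f + p_K K \<mu> g"
proof -
  have "(SUP x\<in>K. \<bar>f x + g x\<bar>) \<le> (SUP x\<in>K. \<bar>f x\<bar>) + (SUP x\<in>K. \<bar>g x\<bar>)"
  proof (rule cSUP_least[OF assms(2)])
    fix x assume "x \<in> K"
    then show "\<bar>f x + g x\<bar> \<le> (SUP x\<in>K. \<bar>f x\<bar>) + (SUP x\<in>K. \<bar>g x\<bar>)"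
      using abs_le_SUP_abs[OF assms(3)] abs_le_SUP_abs[OF assms(4)] abs_triangle_ineq[of "f x" "g x"]
      by (meson add_mono order_trans)
  qed
  moreover have "\<bar>darboux_integral \<mu> (\<lambda>x. f x + g x)\<bar> \<le> \<bar>darboux_integral \<mu> f\<bar> + \<bar>darboux_integral \<mu> g\<bar>"
    unfolding linear_functional_onD(1)[OF darboux_linear[OF assms(1)] assms(3,4)] by (rule abs_triangle_ineq)
  ultimately show ?thesis unfolding p_K_def by linarith
qed

lemma p_K_scale:
  assumes "\<mu> \<in> ba" "K \<noteq> {}" "f \<in> B_b"
  shows "p_K K \<mu> (\<lambda>x. c * f x) \<le> \<bar>c\<bar> * p_K K \<mu> f"
proof -
  have "(SUP x\<in>K. \<bar>c * f x\<bar>) \<le> \<bar>c\<bar> * (SUP x\<in>K. \<bar>f x\<bar>)"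
    using abs_le_SUP_abs[OF assms(3)] by (intro cSUP_least[OF assms(2)]) (auto simp: abs_mult mult_left_mono)
  then show ?thesis unfolding p_K_def linear_functional_onD(2)[OF darboux_linear[OF assms(1)] assms(3)]
    by (simp add: abs_mult distrib_left)
qed

lemma p_K_zero:
  assumes "\<mu> \<in> ba" "K \<noteq> {}"
  shows "p_K K \<mu> (\<lambda>x. 0) = 0"
  unfolding p_K_def using assms by (simp add: darboux_zero_function)

text \<open>The subbasic sets are balls with arbitrary centres; the triangle inequality recentres them.\<close>

lemma seminorm_ball_neighbourhood:
  assumes V: "bounded_function_space V"
    and sub: "\<And>p f g. p \<in> S \<Longrightarrow> f \<in> V \<Longrightarrow> g \<in> V \<Longrightarrow> p (\<lambda>x. f x + g x) \<le> p f + p g"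
    and U: "openin (seminorm_topology V S) U" and f: "f \<in> V" "f \<in> U"
  shows "\<exists>F \<delta>. finite F \<and> F \<subseteq> S \<and> 0 < \<delta> \<and> {g \<in> V. \<forall>p\<in>F. p (\<lambda>x. g x - f x) < \<delta>} \<subseteq> U"
proof -
  define ball where "ball F \<delta> = {g \<in> V. \<forall>p\<in>F. p (\<lambda>x. g x - f x) < \<delta>}" for F and \<delta> :: real
  have "generate_topology_on {{g \<in> V. p (\<lambda>x. g x - h x) < e} | p h e. p \<in> S \<and> h \<in> V \<and> 0 < e} U"
    using U unfolding seminorm_topology_def by (rule openin_topology_generated_by)
  then have "\<exists>F \<delta>. finite F \<and> F \<subseteq> S \<and> 0 < \<delta> \<and> ball F \<delta> \<subseteq> U" using f(2)
  proof (induction rule: generate_topology_on.induct)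
    case (Int U W)
    obtain F \<delta> where F: "finite F" "F \<subseteq> S" "0 < \<delta>" "ball F \<delta> \<subseteq> U" using Int by auto
    obtain G \<epsilon> where G: "finite G" "G \<subseteq> S" "0 < \<epsilon>" "ball G \<epsilon> \<subseteq> W" using Int by auto
    have "ball (F \<union> G) (min \<delta> \<epsilon>) \<subseteq> ball F \<delta> \<inter> ball G \<epsilon>"
      unfolding ball_def by (simp add: subset_eq ball_Un)
    then have "ball (F \<union> G) (min \<delta> \<epsilon>) \<subseteq> U \<inter> W" using F(4) G(4) by blast
    then show ?case using F(1-3) G(1-3) by (intro exI[of _ "F \<union> G"] exI[of _ "min \<delta> \<epsilon>"]) simp
  next
    case (UN K)
    then obtain U where "U \<in> K" "f \<in> U" by blast
    with UN.IH[of U] obtain F \<delta> where "finite F" "F \<subseteq> S" "0 < \<delta>" "ball F \<delta> \<subseteq> U" by auto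
    moreover have "U \<subseteq> \<Union>K" using \<open>U \<in> K\<close> by (rule Union_upper)
    ultimately show ?case by (meson order_trans)
  next
    case (Basis U)
    then obtain p h e where U: "U = {g \<in> V. p (\<lambda>x. g x - h x) < e}" "p \<in> S" "h \<in> V" by blast
    have "p (\<lambda>x. g x - h x) < e" if "g \<in> V" "p (\<lambda>x. g x - f x) < e - p (\<lambda>x. f x - h x)" for g
      using sub[OF U(2) bounded_function_spaceD(5)[OF V that(1) f(1)]
          bounded_function_spaceD(5)[OF V f(1) U(3)]] that(2) by simp
    then have "ball {p} (e - p (\<lambda>x. f x - h x)) \<subseteq> U" unfolding U(1) ball_def by auto
    moreover have "0 < e - p (\<lambda>x. f x - h x)" using Basis.prems unfolding U(1) by simp
    ultimately show ?case using U(2) by (intro exI[of _ "{p}"] exI[of _ "e - p (\<lambda>x. f x - h x)"]) simp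
  qed simp
  then show ?thesis unfolding ball_def .
qed

lemma topspace_tau_K:
  assumes V: "bounded_function_space V"
  shows "topspace (tau_K V) = V"
proof -
  have "\<exists>p. p \<in> {p_K K \<mu> | K \<mu>. compact K \<and> K \<noteq> {} \<and> \<mu> \<in> ca} \<and> p (\<lambda>x. 0) = 0"
    using zero_in_ca ca_subset_ba p_K_zero[of "\<lambda>A. 0" "{undefined}"]
    by (intro exI[of _ "p_K {undefined} (\<lambda>A. 0)"]) force
  then obtain p where p: "p \<in> {p_K K \<mu> | K \<mu>. compact K \<and> K \<noteq> {} \<and> \<mu> \<in> ca}" "p (\<lambda>x::'a. 0) = 0"
    by blast
  have "f \<in> {g \<in> V. p (\<lambda>x. g x - f x) < 1}" if "f \<in> V" for f using p(2) that by simp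
  moreover have "{g \<in> V. p (\<lambda>x. g x - f x) < 1} \<in> {{g \<in> V. p (\<lambda>x. g x - h x) < e} | p h e.
      p \<in> {p_K K \<mu> | K \<mu>. compact K \<and> K \<noteq> {} \<and> \<mu> \<in> ca} \<and> h \<in> V \<and> 0 < e}" if "f \<in> V" for f
    using p(1) that zero_less_one[where 'a=real] by blast
  ultimately have "V \<subseteq> topspace (tau_K V)"
    unfolding tau_K_def seminorm_topology_def topology_generated_by_topspace by (meson UnionI subsetI)
  moreover have "topspace (tau_K V) \<subseteq> V"
    unfolding tau_K_def seminorm_topology_def topology_generated_by_topspace by blast
  ultimately show ?thesis by blast
qed

text \<open>The bound on \<open>\<Lambda> f\<close> by finitely many seminorms is not monotone in \<open>\<bar>f\<bar>\<close>, since \<open>\<bar>\<integral>f d\<mu>\<bar>\<close> is not. 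
  Smoothness modulo \<open>K\<close>, a consequence of continuity, has hypotheses that pass to any functions squeezed
  between \<open>0\<close> and the given ones, which is what the positive part of \<open>\<Lambda>\<close> calls for.\<close>

definition smooth_modulo ::
    "('a::topological_space \<Rightarrow> real) set \<Rightarrow> 'a set \<Rightarrow> (('a \<Rightarrow> real) \<Rightarrow> real) \<Rightarrow> bool" where
  "smooth_modulo V K \<Lambda> \<longleftrightarrow>
     (\<forall>f c. (\<forall>n. f n \<in> V) \<longrightarrow> (\<forall>n x. \<bar>f n x\<bar> \<le> c) \<longrightarrow> (\<forall>x. (\<lambda>n. f n x) \<longlonglongrightarrow> 0) \<longrightarrow>
        uniform_limit K f (\<lambda>x. 0) sequentially \<longrightarrow> (\<lambda>n::nat. \<Lambda> (f n)) \<longlonglongrightarrow> 0)"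

lemma p_K_tendsto_0:
  assumes \<mu>: "\<mu> \<in> ca" and "K \<noteq> {}" and f: "\<And>n. f n \<in> B_b" and bound: "\<And>n x. \<bar>f n x\<bar> \<le> c"
    and lim: "\<And>x. (\<lambda>n. f n x) \<longlonglongrightarrow> 0" and unif: "uniform_limit K f (\<lambda>x. 0) sequentially"
  shows "(\<lambda>n. p_K K \<mu> (f n)) \<longlonglongrightarrow> 0"
proof -
  have "(\<lambda>n. SUP x\<in>K. \<bar>f n x\<bar>) \<longlonglongrightarrow> 0"
  proof (rule tendstoI)
    fix e :: real assume "0 < e"
    with uniform_limitD[OF unif, of "e / 2"] have "\<forall>\<^sub>F n in sequentially. \<forall>x\<in>K. \<bar>f n x\<bar> < e / 2" by simp
    then show "\<forall>\<^sub>F n in sequentially. dist (SUP x\<in>K. \<bar>f n x\<bar>) 0 < e"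
    proof (rule eventually_mono)
      fix n assume n: "\<forall>x\<in>K. \<bar>f n x\<bar> < e / 2"
      then have "(SUP x\<in>K. \<bar>f n x\<bar>) \<le> e / 2" using assms(2) by (intro cSUP_least) (auto intro: less_imp_le)
      moreover obtain x where "x \<in> K" using assms(2) by blast
      then have "0 \<le> (SUP x\<in>K. \<bar>f n x\<bar>)" using abs_le_SUP_abs[OF f, of x K n] by simp
      ultimately show "dist (SUP x\<in>K. \<bar>f n x\<bar>) 0 < e" using \<open>0 < e\<close> by simp
    qed
  qed
  moreover have "(\<lambda>n. darboux_integral \<mu> (f n)) \<longlonglongrightarrow> 0"
    using darboux_dominated_convergence[OF \<mu> f B_b_const bound lim] \<mu> ca_subset_ba
    by (auto simp: darboux_zero_function)
  ultimately show ?thesis unfolding p_K_def by (auto intro: tendsto_add_zero tendsto_rabs_zero)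
qed

lemma dual_tau_K_smooth_modulo:
  assumes V: "bounded_function_space V" and \<Lambda>: "\<Lambda> \<in> dual_tau_K V"
  obtains K where "compact K" "smooth_modulo V K \<Lambda>"
proof -
  let ?S = "{p_K K \<mu> | K \<mu>. compact K \<and> K \<noteq> {} \<and> \<mu> \<in> ca}"
  note VD = bounded_function_spaceD[OF V]
  have lin: "linear_functional_on V \<Lambda>" and cont: "continuous_map (tau_K V) euclideanreal \<Lambda>"
    using \<Lambda> unfolding dual_tau_K_def by auto
  define U where "U = {f \<in> V. \<Lambda> f \<in> ball 0 1}"
  have U: "openin (seminorm_topology V ?S) U"
    using openin_continuous_map_preimage[OF cont, of "ball 0 1"]
    unfolding topspace_tau_K[OF V] U_def by (simp add: tau_K_def)
  have "\<Lambda> (\<lambda>x. 0) = 0" using linear_functional_onD(2)[OF lin VD(2), of 0] by simp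
  then have 0: "(\<lambda>x. 0) \<in> U" unfolding U_def using VD(2) by simp
  have sub: "p (\<lambda>x. f x + g x) \<le> p f + p g" if "p \<in> ?S" "f \<in> V" "g \<in> V" for p f g
    using that VD(1) ca_subset_ba by (auto intro!: p_K_add)
  have "\<exists>F \<delta>. finite F \<and> F \<subseteq> ?S \<and> 0 < \<delta> \<and> {g \<in> V. \<forall>p\<in>F. p (\<lambda>x. g x - 0) < \<delta>} \<subseteq> U"
    by (rule seminorm_ball_neighbourhood[OF V sub U VD(2) 0])
  then obtain F \<delta> where F: "finite F" "F \<subseteq> ?S" "0 < \<delta>" and ball: "{g \<in> V. \<forall>p\<in>F. p g < \<delta>} \<subseteq> U"
    by auto
  have \<Lambda>_less: "\<bar>\<Lambda> g\<bar> < 1" if "g \<in> V" "\<forall>p\<in>F. p g < \<delta>" for g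
  proof -
    have "g \<in> U" using ball that by blast
    then show ?thesis unfolding U_def by simp
  qed
  have "\<forall>p\<in>F. \<exists>K \<mu>. p = p_K K \<mu> \<and> compact K \<and> K \<noteq> {} \<and> \<mu> \<in> ca" using F(2) by blast
  then obtain \<kappa> m where \<kappa>m: "\<And>p. p \<in> F \<Longrightarrow> p = p_K (\<kappa> p) (m p)" "\<And>p. p \<in> F \<Longrightarrow> compact (\<kappa> p)"
    "\<And>p. p \<in> F \<Longrightarrow> \<kappa> p \<noteq> {}" "\<And>p. p \<in> F \<Longrightarrow> m p \<in> ca" by metis
  have "smooth_modulo V (\<Union>p\<in>F. \<kappa> p) \<Lambda>"
    unfolding smooth_modulo_def
  proof (intro allI impI)
    fix f :: "nat \<Rightarrow> 'a \<Rightarrow> real" and c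
    assume f: "\<forall>n. f n \<in> V" "\<forall>n x. \<bar>f n x\<bar> \<le> c" "\<forall>x. (\<lambda>n. f n x) \<longlonglongrightarrow> 0"
      "uniform_limit (\<Union>p\<in>F. \<kappa> p) f (\<lambda>x. 0) sequentially"
    have to0: "(\<lambda>n. p (f n)) \<longlonglongrightarrow> 0" if "p \<in> F" for p
    proof -
      have "uniform_limit (\<kappa> p) f (\<lambda>x. 0) sequentially"
        by (rule uniform_limit_on_subset[OF f(4)]) (use that in auto)
      then have "(\<lambda>n. p_K (\<kappa> p) (m p) (f n)) \<longlonglongrightarrow> 0"
        using f(1-3) VD(1) \<kappa>m that by (intro p_K_tendsto_0) auto
      then show ?thesis using \<kappa>m(1)[OF that] by simp
    qed
    show "(\<lambda>n. \<Lambda> (f n)) \<longlonglongrightarrow> 0"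
    proof (rule tendstoI)
      fix e :: real assume e: "0 < e"
      have "\<forall>\<^sub>F n in sequentially. \<forall>p\<in>F. p (f n) < e * \<delta>"
        using F(1,3) e order_tendstoD(2)[OF to0] by (intro eventually_ball_finite) auto
      then show "\<forall>\<^sub>F n in sequentially. dist (\<Lambda> (f n)) 0 < e"
      proof (rule eventually_mono)
        fix n assume n: "\<forall>p\<in>F. p (f n) < e * \<delta>"
        have "p (\<lambda>x. inverse e * f n x) < \<delta>" if "p \<in> F" for p
        proof -
          have "p (\<lambda>x. inverse e * f n x) \<le> inverse e * p (f n)"
            using p_K_scale[of "m p" "\<kappa> p" "f n" "inverse e"] \<kappa>m(3,4)[OF that] \<kappa>m(1)[OF that]
              ca_subset_ba VD(1) f(1) e by auto
          also have "\<dots> < \<delta>" using n that e by (simp add: field_simps)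
          finally show ?thesis .
        qed
        then have "\<bar>\<Lambda> (\<lambda>x. inverse e * f n x)\<bar> < 1" using f(1) VD(4) by (intro \<Lambda>_less) auto
        moreover have "\<Lambda> (\<lambda>x. inverse e * f n x) = inverse e * \<Lambda> (f n)"
          using f(1) by (intro linear_functional_onD(2)[OF lin]) auto
        ultimately have "inverse e * \<bar>\<Lambda> (f n)\<bar> < 1" using e by (simp only: abs_mult) simp
        then show "dist (\<Lambda> (f n)) 0 < e" using e by (simp add: field_simps)
      qed
    qed
  qed
  moreover have "compact (\<Union>p\<in>F. \<kappa> p)" using F(1) \<kappa>m(2) by (intro compact_UN) auto
  ultimately show ?thesis using that by blast
qed

lemma continuous_map_tau_K:
  assumes V: "bounded_function_space V" and lin: "linear_functional_on V \<Lambda>"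
    and K: "compact K" "K \<noteq> {}" and \<mu>: "\<mu> \<in> ca"
    and bound: "\<And>f. f \<in> V \<Longrightarrow> \<bar>\<Lambda> f\<bar> \<le> C * p_K K \<mu> f"
  shows "continuous_map (tau_K V) euclideanreal \<Lambda>"
  unfolding continuous_map_def topspace_tau_K[OF V]
proof (intro conjI allI impI)
  note VD = bounded_function_spaceD[OF V]
  fix W :: "real set" assume "openin euclideanreal W"
  then have W: "open W" by simp
  show "openin (tau_K V) {f \<in> V. \<Lambda> f \<in> W}"
  proof (subst openin_subopen, intro ballI)
    fix f assume "f \<in> {f \<in> V. \<Lambda> f \<in> W}"
    then have f: "f \<in> V" "\<Lambda> f \<in> W" by auto
    obtain e where e: "0 < e" "ball (\<Lambda> f) e \<subseteq> W" using W f(2) open_contains_ball by blast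
    define T where "T = {g \<in> V. p_K K \<mu> (\<lambda>x. g x - f x) < e / (\<bar>C\<bar> + 1)}"
    have "0 < e / (\<bar>C\<bar> + 1)" using e(1) by simp
    then have "openin (tau_K V) T" unfolding tau_K_def seminorm_topology_def T_def
      using f K \<mu> by (intro topology_generated_by_Basis) blast
    moreover have "f \<in> T" unfolding T_def using f p_K_zero[of \<mu> K] \<mu> ca_subset_ba K(2) e(1) by auto
    moreover have "\<Lambda> g \<in> W" if "g \<in> T" for g
    proof -
      have g: "g \<in> V" "p_K K \<mu> (\<lambda>x. g x - f x) < e / (\<bar>C\<bar> + 1)" using that unfolding T_def by auto
      have gf: "(\<lambda>x. g x - f x) \<in> V" using VD(5) g f by blast
      have nonneg: "0 \<le> p_K K \<mu> (\<lambda>x. g x - f x)"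
      proof -
        obtain x where "x \<in> K" using K(2) by blast
        then show ?thesis using abs_le_SUP_abs[OF VD(1)[OF gf], of x K] unfolding p_K_def by simp
      qed
      have "\<bar>\<Lambda> g - \<Lambda> f\<bar> \<le> C * p_K K \<mu> (\<lambda>x. g x - f x)"
        using bound[OF gf] linear_functional_on_diff[OF lin VD(4) g(1) f(1)] by simp
      also have "\<dots> \<le> (\<bar>C\<bar> + 1) * p_K K \<mu> (\<lambda>x. g x - f x)" using nonneg by (intro mult_right_mono) auto
      also have "\<dots> < e" using g(2) by (simp add: pos_less_divide_eq mult.commute)
      finally show ?thesis using e(2) by (auto simp: subset_eq dist_real_def abs_minus_commute)
    qed
    ultimately show "\<exists>T. openin (tau_K V) T \<and> f \<in> T \<and> T \<subseteq> {f \<in> V. \<Lambda> f \<in> W}"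
      unfolding T_def by blast
  qed
qed simp

text \<open>If boundedness failed, suitably scaled bad functions would tend to \<open>0\<close> uniformly.\<close>

lemma smooth_modulo_bounded:
  assumes V: "bounded_function_space V" and lin: "linear_functional_on V \<Lambda>" and sm: "smooth_modulo V K \<Lambda>"
  shows "bounded_functional_on V \<Lambda>"
proof -
  note VD = bounded_function_spaceD[OF V]
  have "\<exists>C. \<forall>f\<in>V. (\<forall>x. \<bar>f x\<bar> \<le> 1) \<longrightarrow> \<bar>\<Lambda> f\<bar> \<le> C"
  proof (rule ccontr)
    assume "\<not> ?thesis"
    then have "\<forall>n::nat. \<exists>f\<in>V. (\<forall>x. \<bar>f x\<bar> \<le> 1) \<and> real (Suc n) < \<bar>\<Lambda> f\<bar>" by (meson linorder_not_le)
    then obtain f where f: "\<And>n. f n \<in> V" "\<And>n x. \<bar>f n x\<bar> \<le> 1" "\<And>n. real (Suc n) < \<bar>\<Lambda> (f n)\<bar>" by metis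
    define g where "g n x = inverse (real (Suc n)) * f n x" for n x
    have g: "\<bar>g n x\<bar> \<le> inverse (real (Suc n))" for n x
      using mult_left_mono[OF f(2)[of n x], of "inverse (real (Suc n))"] unfolding g_def
      by (simp add: abs_mult)
    have unif: "uniform_limit UNIV g (\<lambda>x. 0) sequentially"
    proof (rule uniform_limitI)
      fix e :: real assume "0 < e"
      then have "\<forall>\<^sub>F n in sequentially. inverse (real (Suc n)) < e"
        using order_tendstoD(2)[OF LIMSEQ_inverse_real_of_nat] by simp
      then show "\<forall>\<^sub>F n in sequentially. \<forall>x\<in>UNIV. dist (g n x) 0 < e"
      proof (rule eventually_mono)
        fix n assume "inverse (real (Suc n)) < e"
        then show "\<forall>x\<in>UNIV. dist (g n x) 0 < e" using le_less_trans[OF g[of n]] by simp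
      qed
    qed
    have "(\<lambda>n. \<Lambda> (g n)) \<longlonglongrightarrow> 0"
    proof (rule sm[unfolded smooth_modulo_def, rule_format])
      show "g n \<in> V" for n unfolding g_def by (intro VD(4) f)
      show "\<bar>g n x\<bar> \<le> 1" for n x using g[of n x] by (rule order_trans) (simp add: field_simps)
      show "(\<lambda>n. g n x) \<longlonglongrightarrow> 0" for x using tendsto_uniform_limitI[OF unif, of x] by simp
      show "uniform_limit K g (\<lambda>x. 0) sequentially" using unif by (rule uniform_limit_on_subset) simp
    qed
    then have "\<forall>\<^sub>F n in sequentially. \<bar>\<Lambda> (g n)\<bar> < 1"
      using order_tendstoD(2)[OF tendsto_rabs_zero, of "\<lambda>n. \<Lambda> (g n)" sequentially 1] by simp
    then obtain n where "\<bar>\<Lambda> (g n)\<bar> < 1" using eventually_happens by force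
    moreover have "\<Lambda> (g n) = inverse (real (Suc n)) * \<Lambda> (f n)"
      unfolding g_def by (rule linear_functional_onD(2)[OF lin f(1)])
    ultimately show False using f(3)[of n] by (simp add: abs_mult field_simps)
  qed
  then obtain C where C: "\<And>f. f \<in> V \<Longrightarrow> \<forall>x. \<bar>f x\<bar> \<le> 1 \<Longrightarrow> \<bar>\<Lambda> f\<bar> \<le> C" by blast
  have C0: "0 \<le> C" using C[OF VD(2)] by simp
  have "\<bar>\<Lambda> f\<bar> \<le> C * c" if f: "f \<in> V" "\<forall>x. \<bar>f x\<bar> \<le> c" for f c
  proof (rule field_le_epsilon)
    fix e :: real assume "0 < e"
    \<comment> \<open>The scale must be positive although \<open>c\<close> may be \<open>0\<close>; the summand costs at most \<open>e\<close>.\<close>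
    define d where "d = c + e / (C + 1)"
    have "0 \<le> c" using f(2) abs_ge_zero order_trans by blast
    then have d: "0 < d" "c \<le> d" unfolding d_def using C0 \<open>0 < e\<close> by (auto intro: add_nonneg_pos)
    have "\<bar>\<Lambda> (\<lambda>x. inverse d * f x)\<bar> \<le> C"
    proof (intro C VD(4) f(1) allI)
      show "\<bar>inverse d * f x\<bar> \<le> 1" for x using f(2)[rule_format, of x] d by (simp add: abs_mult field_simps)
    qed
    then have "inverse d * \<bar>\<Lambda> f\<bar> \<le> C"
      unfolding linear_functional_onD(2)[OF lin f(1)] using d(1) by (simp add: abs_mult)
    then have "\<bar>\<Lambda> f\<bar> \<le> C * d" using d(1) by (simp add: field_simps)
    also have "\<dots> \<le> C * c + e" unfolding d_def using C0 \<open>0 < e\<close> by (simp add: field_simps)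
    finally show "\<bar>\<Lambda> f\<bar> \<le> C * c + e" .
  qed
  then show ?thesis unfolding bounded_functional_on_def using lin by blast
qed

section \<open>Representation of smooth functionals on continuous functions\<close>

text \<open>The functions \<open>min 1 (n d)\<close>, with \<open>d\<close> the distance to the complement. The whole space is treated
  apart because the distance to the empty set is \<open>0\<close> by convention.\<close>

lemma open_indicator_approx:
  fixes U :: "'a::metric_space set"
  assumes "open U"
  obtains h :: "nat \<Rightarrow> 'a \<Rightarrow> real" where "\<And>n. h n \<in> C_b" "\<And>n x. 0 \<le> h n x" "\<And>n x. h n x \<le> 1"
    "\<And>n x. x \<notin> U \<Longrightarrow> h n x = 0" "\<And>x. x \<in> U \<Longrightarrow> \<forall>\<^sub>F n in sequentially. h n x = 1"
proof (cases "U = UNIV")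
  case True
  then show ?thesis by (intro that[of "\<lambda>_ _. 1"]) auto
next
  case False
  define h where "h n x = min 1 (real n * infdist x (- U))" for n x
  have closed: "closed (- U)" using assms by (simp add: closed_def)
  show ?thesis
  proof (rule that[of h])
    show nonneg: "0 \<le> h n x" for n x unfolding h_def by (simp add: infdist_nonneg)
    show "h n x \<le> 1" for n x unfolding h_def by simp
    then show "h n \<in> C_b" for n using nonneg
      by (intro C_bI[where c=1]) (auto simp: h_def intro!: continuous_intros)
    show "h n x = 0" if "x \<notin> U" for n x using that unfolding h_def by simp
    show "\<forall>\<^sub>F n in sequentially. h n x = 1" if "x \<in> U" for x
    proof -
      have pos: "0 < infdist x (- U)" using infdist_pos_not_in_closed[OF closed] False that by auto
      then obtain N where "1 < real N * infdist x (- U)" using ex_less_of_nat_mult by blast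
      moreover have "real N * infdist x (- U) \<le> real n * infdist x (- U)" if "N \<le> n" for n
        using that pos by (intro mult_right_mono) auto
      ultimately have "\<forall>n\<ge>N. h n x = 1" unfolding h_def min_def by force
      then show ?thesis unfolding eventually_sequentially by blast
    qed
  qed
qed

text \<open>A Daniell integral, required only on the nonnegative functions: the positive part of a functional
  is additive there, and the contents below are values at differences \<open>g - f\<close> with \<open>f \<le> g\<close>.\<close>

locale smooth_cone_functional =
  fixes I :: "('a::metric_space \<Rightarrow> real) \<Rightarrow> real"
  assumes I_add: "\<And>f g. f \<in> C_b \<Longrightarrow> g \<in> C_b \<Longrightarrow> (\<And>x. 0 \<le> f x) \<Longrightarrow> (\<And>x. 0 \<le> g x) \<Longrightarrow>
      I (\<lambda>x. f x + g x) = I f + I g"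
    and I_nonneg: "\<And>f. f \<in> C_b \<Longrightarrow> (\<And>x. 0 \<le> f x) \<Longrightarrow> 0 \<le> I f"
    and I_smooth: "\<And>f. (\<And>n. f n \<in> C_b) \<Longrightarrow> (\<And>n x. 0 \<le> f n x) \<Longrightarrow> (\<And>x. decseq (\<lambda>n. f n x)) \<Longrightarrow>
      (\<And>x. (\<lambda>n. f n x) \<longlonglongrightarrow> 0) \<Longrightarrow> (\<lambda>n::nat. I (f n)) \<longlonglongrightarrow> 0"
begin

lemma I_zero: "I (\<lambda>x. 0) = 0"
  using I_add[of "\<lambda>x. 0" "\<lambda>x. 0"] by simp

lemma I_sum:
  fixes f :: "nat \<Rightarrow> 'a \<Rightarrow> real"
  assumes "\<And>k. f k \<in> C_b" "\<And>k x. 0 \<le> f k x"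
  shows "(\<lambda>x. \<Sum>k<n. f k x) \<in> C_b \<and> I (\<lambda>x. \<Sum>k<n. f k x) = (\<Sum>k<n. I (f k))"
proof (induction n)
  case (Suc n)
  then show ?case using I_add[of "\<lambda>x. \<Sum>k<n. f k x" "f n"] assms by (simp add: sum_nonneg C_b_add)
qed (simp add: I_zero)

text \<open>The extra real coordinate turns functions into sets: additivity of \<open>I\<close> becomes additivity of a
  content on the regions between two graphs. These form a semiring because \<open>C_b\<close> is closed under
  \<open>min\<close> and \<open>max\<close>.\<close>

definition slab :: "('a \<Rightarrow> real) \<times> ('a \<Rightarrow> real) \<Rightarrow> ('a \<times> real) set" where
  "slab p = {(x, t). fst p x \<le> t \<and> t < snd p x}"

definition slab_index :: "(('a \<Rightarrow> real) \<times> ('a \<Rightarrow> real)) set" where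
  "slab_index = {(f, g). f \<in> C_b \<and> g \<in> C_b \<and> (\<forall>x. f x \<le> g x)}"

definition slab_content :: "('a \<Rightarrow> real) \<times> ('a \<Rightarrow> real) \<Rightarrow> ennreal" where
  "slab_content p = ennreal (I (\<lambda>x. snd p x - fst p x))"

definition slab_measure :: "('a \<times> real) measure" where
  "slab_measure = extend_measure UNIV slab_index slab slab_content"

lemma slabI: "f \<in> C_b \<Longrightarrow> g \<in> C_b \<Longrightarrow> (\<And>x. f x \<le> g x) \<Longrightarrow> slab (f, g) \<in> slab ` slab_index"
  unfolding slab_index_def by auto

lemma semiring_of_slabs: "semiring_of_sets UNIV (slab ` slab_index)"
proof
  show "slab ` slab_index \<subseteq> Pow UNIV" by simp
  have "slab (\<lambda>x. 0, \<lambda>x. 0) \<in> slab ` slab_index" by (rule slabI) auto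
  moreover have "slab (\<lambda>x. 0, \<lambda>x. 0) = {}" unfolding slab_def by auto
  ultimately show "{} \<in> slab ` slab_index" by simp
  fix a b assume "a \<in> slab ` slab_index" "b \<in> slab ` slab_index"
  then obtain f g f' g' where a: "a = slab (f, g)" "f \<in> C_b" "g \<in> C_b" "\<And>x. f x \<le> g x"
    and b: "b = slab (f', g')" "f' \<in> C_b" "g' \<in> C_b" "\<And>x. f' x \<le> g' x"
    unfolding slab_index_def by auto
  have "slab (\<lambda>x. max (f x) (f' x), \<lambda>x. max (max (f x) (f' x)) (min (g x) (g' x))) \<in> slab ` slab_index"
    using a b by (intro slabI C_b_max C_b_min) auto
  moreover have "a \<inter> b = slab (\<lambda>x. max (f x) (f' x), \<lambda>x. max (max (f x) (f' x)) (min (g x) (g' x)))"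
    unfolding a b slab_def by auto
  ultimately show "a \<inter> b \<in> slab ` slab_index" by simp
  let ?C = "{slab (f, \<lambda>x. min (g x) (max (f x) (f' x))), slab (\<lambda>x. max (f x) (min (g x) (g' x)), g)}"
  have "slab (f, \<lambda>x. min (g x) (max (f x) (f' x))) \<in> slab ` slab_index"
    using a b by (intro slabI C_b_max C_b_min) auto
  moreover have "slab (\<lambda>x. max (f x) (min (g x) (g' x)), g) \<in> slab ` slab_index"
    using a b by (intro slabI C_b_max C_b_min) auto
  moreover have "\<not> ((x, t) \<in> slab (f, \<lambda>x. min (g x) (max (f x) (f' x))) \<and>
      (x, t) \<in> slab (\<lambda>x. max (f x) (min (g x) (g' x)), g))" for x t
    using b(4)[of x] unfolding slab_def by auto
  then have "disjnt (slab (f, \<lambda>x. min (g x) (max (f x) (f' x)))) (slab (\<lambda>x. max (f x) (min (g x) (g' x)), g))"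
    unfolding disjnt_iff by auto
  then have "disjoint ?C" by (simp add: pairwise_insert disjnt_sym)
  moreover have "a - b = \<Union>?C" unfolding a b slab_def using a(4) b(4) by (auto simp: not_le not_less min_def max_def split: if_splits)
  ultimately show "\<exists>C\<subseteq>slab ` slab_index. finite C \<and> disjoint C \<and> a - b = \<Union>C"
    by (intro exI[of _ ?C]) auto
qed

text \<open>The remainder of a countable decomposition decreases pointwise to \<open>0\<close>, so smoothness of \<open>I\<close> makes its
  content tend to \<open>0\<close>.\<close>

lemma slab_content_countably_additive:
  fixes A :: "nat \<Rightarrow> ('a \<Rightarrow> real) \<times> ('a \<Rightarrow> real)"
  assumes A: "A \<in> UNIV \<rightarrow> slab_index" and j: "j \<in> slab_index"
    and disj: "disjoint_family (slab \<circ> A)" and Un: "(\<Union>i. slab (A i)) = slab j"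
  shows "(\<Sum>n. slab_content (A n)) = slab_content j"
proof -
  define k where "k n x = snd (A n) x - fst (A n) x" for n x
  define l where "l x = snd j x - fst j x" for x
  have k: "k n \<in> C_b" "0 \<le> k n x" for n x
    using A unfolding k_def slab_index_def by (auto simp: Pi_iff split_beta intro!: C_b_diff)
  have l: "l \<in> C_b" "0 \<le> l x" for x
    using j unfolding l_def slab_index_def by (auto intro!: C_b_diff)
  \<comment> \<open>Above each point the slabs are intervals, and lengths of intervals are countably additive.\<close>
  have sums: "(\<lambda>n. k n x) sums l x" for x
  proof -
    define S where "S p = {fst p x..<snd p x}" for p :: "('a \<Rightarrow> real) \<times> ('a \<Rightarrow> real)"
    have S: "t \<in> S p \<longleftrightarrow> (x, t) \<in> slab p" for t p unfolding S_def slab_def by auto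
    have "disjoint_family (\<lambda>n. S (A n))"
      using disj unfolding disjoint_family_on_def o_def disjoint_iff S by blast
    then have "(\<Sum>n. emeasure lborel (S (A n))) = emeasure lborel (\<Union>n. S (A n))"
      by (intro suminf_emeasure) (auto simp: S_def)
    also have "(\<Union>n. S (A n)) = S j" using Un S by blast
    finally have "(\<Sum>n. ennreal (k n x)) = ennreal (l x)"
      using k(2)[of _ x] l(2)[of x] unfolding S_def k_def l_def by simp
    then have "(\<lambda>n. ennreal (k n x)) sums ennreal (l x)" by (metis summableI summable_sums)
    then show ?thesis using k(2) l(2) by simp
  qed
  define h where "h N x = l x - (\<Sum>n<N. k n x)" for N x
  have h: "h N \<in> C_b" for N unfolding h_def using l(1) I_sum[of k N] k by (intro C_b_diff) auto
  have h0: "0 \<le> h N x" for N x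
    unfolding h_def using sum_le_suminf[OF sums_summable[OF sums[of x]], of "{..<N}"] k(2) sums_unique[OF sums[of x]]
    by simp
  have "(\<lambda>N. I (h N)) \<longlonglongrightarrow> 0"
  proof (rule I_smooth[OF h h0])
    show "decseq (\<lambda>N. h N x)" for x by (rule decseq_SucI) (simp add: h_def k(2))
    show "(\<lambda>N. h N x) \<longlonglongrightarrow> 0" for x
      using tendsto_diff[OF tendsto_const sums[of x, unfolded sums_def], of "l x"] unfolding h_def by simp
  qed
  moreover have "I l = I (h N) + (\<Sum>n<N. I (k n))" for N
    using I_add[OF h, of "\<lambda>x. \<Sum>n<N. k n x" N] h0 I_sum[of k N] k by (simp add: h_def sum_nonneg)
  then have "I (h N) = I l - (\<Sum>n<N. I (k n))" for N by (simp add: algebra_simps)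
  ultimately have "(\<lambda>N. I l - (I l - (\<Sum>n<N. I (k n)))) \<longlonglongrightarrow> I l - 0"
    by (intro tendsto_diff tendsto_const) simp
  then have "(\<lambda>n. I (k n)) sums I l" unfolding sums_def by simp
  then have "(\<lambda>n. ennreal (I (k n))) sums ennreal (I l)"
    using I_nonneg[OF k] I_nonneg[OF l] by simp
  then show ?thesis unfolding slab_content_def k_def[symmetric] l_def[symmetric] by (simp add: sums_iff)
qed

lemma emeasure_slab:
  assumes "f \<in> C_b" "\<And>x. 0 \<le> f x"
  shows "emeasure slab_measure (slab (\<lambda>x. 0, f)) = ennreal (I f)"
proof -
  have "emeasure slab_measure (slab (\<lambda>x. 0, f)) = slab_content (\<lambda>x. 0, f)"
  proof (rule extend_measure_caratheodory[OF slab_measure_def _ semiring_of_slabs])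
    show "(\<lambda>x. 0, f) \<in> slab_index" using assms unfolding slab_index_def by simp
    show "slab_content i = 0" if "i \<in> slab_index" "slab i = {}" for i
    proof -
      have "fst i x = snd i x" for x
      proof -
        have "(x, fst i x) \<notin> slab i" using that(2) by simp
        then show ?thesis using that(1) unfolding slab_def slab_index_def by (auto simp: split_beta intro: antisym)
      qed
      then show ?thesis unfolding slab_content_def by (simp add: I_zero)
    qed
    show "slab_content i = slab_content j" if "i \<in> slab_index" "j \<in> slab_index" "slab i = slab j" for i j
    proof -
      have "snd i x - fst i x = snd j x - fst j x" for x
      proof -
        have "{fst i x..<snd i x} = {t. (x, t) \<in> slab i}" "{fst j x..<snd j x} = {t. (x, t) \<in> slab j}"
          unfolding slab_def by auto
        then have "emeasure lborel {fst i x..<snd i x} = emeasure lborel {fst j x..<snd j x}"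
          using that(3) by simp
        moreover have "fst i x \<le> snd i x" "fst j x \<le> snd j x"
          using that unfolding slab_index_def by auto
        ultimately show ?thesis by simp
      qed
      then show ?thesis unfolding slab_content_def by simp
    qed
    show "(\<Sum>n. slab_content (A n)) = slab_content j"
      if "A \<in> UNIV \<rightarrow> slab_index" "j \<in> slab_index" "disjoint_family (slab \<circ> A)" "(\<Union>i. slab (A i)) = slab j" for A j
      using that by (rule slab_content_countably_additive)
  qed simp
  then show ?thesis unfolding slab_content_def by simp
qed

lemma slab_in_sets: "f \<in> C_b \<Longrightarrow> (\<And>x. 0 \<le> f x) \<Longrightarrow> slab (\<lambda>x. 0, f) \<in> sets slab_measure"
  unfolding slab_measure_def by (subst sets_extend_measure) (auto intro!: sigma_sets.Basic slabI)

lemma unit_slab: "slab (\<lambda>x. 0, \<lambda>x. 1) = UNIV \<times> {0..<1}"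
  unfolding slab_def by auto

lemma open_cylinder_in_sets:
  assumes "open U"
  shows "U \<times> {0..<1} \<in> sets slab_measure"
proof -
  obtain h :: "nat \<Rightarrow> 'a \<Rightarrow> real" where h: "\<And>n. h n \<in> C_b" "\<And>n x. 0 \<le> h n x" "\<And>n x. h n x \<le> 1"
    "\<And>n x. x \<notin> U \<Longrightarrow> h n x = 0" "\<And>x. x \<in> U \<Longrightarrow> \<forall>\<^sub>F n in sequentially. h n x = 1"
    using open_indicator_approx[OF assms] by metis
  have "U \<times> {0..<1} = (\<Union>n. slab (\<lambda>x. 0, h n))"
  proof (intro equalityI subsetI)
    fix z assume "z \<in> U \<times> {0..<1::real}"
    then obtain x t where z: "z = (x, t)" "x \<in> U" "0 \<le> t" "t < 1" by auto
    then obtain n where "h n x = 1" using h(5) eventually_happens by force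
    then have "z \<in> slab (\<lambda>x. 0, h n)" using z unfolding slab_def by simp
    then show "z \<in> (\<Union>n. slab (\<lambda>x. 0, h n))" by blast
  next
    fix z assume "z \<in> (\<Union>n. slab (\<lambda>x. 0, h n))"
    then obtain n x t where z: "z = (x, t)" "0 \<le> t" "t < h n x" unfolding slab_def by auto
    then show "z \<in> U \<times> {0..<1}" using h(3)[of n x] h(4)[of x n] by force
  qed
  then show ?thesis using slab_in_sets[OF h(1,2)] by auto
qed

text \<open>The slab measure is the product of the measure sought with Lebesgue measure, so its values on
  cylinders of height \<open>1\<close> recover that measure.\<close>

definition base_measure :: "'a measure" where
  "base_measure = distr (restrict_space slab_measure (UNIV \<times> {0..<1})) borel fst"

lemma sets_base_measure: "sets base_measure = sets borel"
  unfolding base_measure_def by simp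

lemma unit_slab_in_sets: "UNIV \<times> {0..<1::real} \<in> sets slab_measure"
  using open_cylinder_in_sets[of UNIV] by simp

lemma space_slab_measure: "space slab_measure = UNIV"
  unfolding slab_measure_def by (subst space_extend_measure) auto

lemma fst_measurable: "fst \<in> borel_measurable (restrict_space slab_measure (UNIV \<times> {0..<1}))"
proof (rule borel_measurableI)
  fix U :: "'a set" assume "open U"
  have "fst -` U \<inter> space (restrict_space slab_measure (UNIV \<times> {0..<1})) = U \<times> {0..<1}"
    by (auto simp: space_restrict_space space_slab_measure)
  then show "fst -` U \<inter> space (restrict_space slab_measure (UNIV \<times> {0..<1})) \<in>
      sets (restrict_space slab_measure (UNIV \<times> {0..<1}))"
    using open_cylinder_in_sets[OF \<open>open U\<close>] unit_slab_in_sets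
    by (subst sets_restrict_space_iff) (auto simp: space_slab_measure)
qed

lemma emeasure_base_measure:
  assumes "A \<in> sets borel"
  shows "emeasure base_measure A = emeasure slab_measure (A \<times> {0..<1})" "A \<times> {0..<1} \<in> sets slab_measure"
proof -
  have eq: "fst -` A \<inter> space (restrict_space slab_measure (UNIV \<times> {0..<1})) = A \<times> {0..<1}"
    by (auto simp: space_restrict_space space_slab_measure)
  show "emeasure base_measure A = emeasure slab_measure (A \<times> {0..<1})"
    unfolding base_measure_def using assms unit_slab_in_sets
    by (subst emeasure_distr[OF fst_measurable assms], unfold eq, subst emeasure_restrict_space)
      (auto simp: space_slab_measure)
  show "A \<times> {0..<1} \<in> sets slab_measure"
    using measurable_sets[OF fst_measurable assms] unit_slab_in_sets unfolding eq
    by (subst (asm) sets_restrict_space_iff) (auto simp: space_slab_measure)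
qed

lemma finite_base_measure: "finite_measure base_measure"
proof (rule finite_measureI)
  have "emeasure base_measure UNIV = ennreal (I (\<lambda>x. 1))"
    using emeasure_base_measure(1)[of UNIV] emeasure_slab[of "\<lambda>x. 1"] unit_slab by simp
  then show "emeasure base_measure (space base_measure) \<noteq> \<infinity>"
    by (simp add: sets_eq_imp_space_eq[OF sets_base_measure])
qed

lemma I_le_base_measure:
  assumes "h \<in> C_b" "\<And>x. 0 \<le> h x" "\<And>x. h x \<le> 1" and A: "A \<in> sets borel" "{x. 0 < h x} \<subseteq> A"
  shows "I h \<le> measure base_measure A"
proof -
  have "slab (\<lambda>x. 0, h) \<subseteq> A \<times> {0..<1}"
  proof
    fix z assume "z \<in> slab (\<lambda>x. 0, h)"
    then obtain x t where z: "z = (x, t)" "0 \<le> t" "t < h x" unfolding slab_def by auto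
    then have "x \<in> A" using A(2) by auto
    then show "z \<in> A \<times> {0..<1}" using z assms(3)[of x] by auto
  qed
  then have "ennreal (I h) \<le> emeasure base_measure A"
    unfolding emeasure_slab[OF assms(1,2), symmetric] emeasure_base_measure(1)[OF A(1)]
    by (rule emeasure_mono) (rule emeasure_base_measure(2)[OF A(1)])
  then show ?thesis
    using finite_measure.emeasure_eq_measure[OF finite_base_measure] by simp
qed

lemma base_measure_le_I:
  assumes "h \<in> C_b" "\<And>x. 0 \<le> h x" and A: "A \<in> sets borel" "\<And>x. x \<in> A \<Longrightarrow> 1 \<le> h x"
  shows "measure base_measure A \<le> I h"
proof -
  have "A \<times> {0..<1} \<subseteq> slab (\<lambda>x. 0, h)" unfolding slab_def using A(2) by force
  then have "emeasure base_measure A \<le> ennreal (I h)"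
    unfolding emeasure_slab[OF assms(1,2), symmetric] emeasure_base_measure(1)[OF A(1)]
    by (rule emeasure_mono) (rule slab_in_sets[OF assms(1,2)])
  then show ?thesis using I_nonneg[OF assms(1,2)]
    by (simp add: finite_measure.emeasure_eq_measure[OF finite_base_measure])
qed

lemma sum_unit_layers: "0 \<le> y \<Longrightarrow> (\<Sum>k<m. max 0 (min 1 (y - real k))) = min y (real m)"
  by (induction m) (auto simp: min_def max_def)

text \<open>Cut \<open>n f\<close> into layers of height \<open>1\<close>. Both functionals take on the \<open>k\<close>-th layer a value between
  the measures of \<open>{n f \<ge> k + 1}\<close> and of \<open>{n f \<ge> k}\<close>, so on \<open>n f\<close> they differ by at most the
  total mass, whatever \<open>n\<close> is.\<close>

lemma I_eq_integral:
  assumes f: "f \<in> C_b" "\<And>x. 0 \<le> f x"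
  shows "I f = (\<integral>x. f x \<partial>base_measure)"
proof -
  let ?J = "\<lambda>f. \<integral>x. f x \<partial>base_measure"
  interpret finite_measure base_measure by (rule finite_base_measure)
  have meas[measurable]: "g \<in> borel_measurable borel" if "g \<in> C_b" for g :: "'a \<Rightarrow> real"
    using that C_b_subset_B_b B_b_measurable by blast
  have int: "integrable base_measure g" if "g \<in> C_b" for g
    using B_b_integrable[OF finite_base_measure sets_base_measure] that C_b_subset_B_b by blast
  have ind_int: "integrable base_measure (indicat_real A)" if "A \<in> sets borel" for A
    using B_b_integrable[OF finite_base_measure sets_base_measure B_b_indicator[OF that]] .
  obtain c where c: "0 < c" "\<And>x. \<bar>f x\<bar> \<le> c" using f(1) C_bE by metis
  have bound: "real n * \<bar>I f - ?J f\<bar> \<le> measure base_measure UNIV" for n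
  proof -
    obtain m :: nat where m: "real n * c \<le> real m" using real_arch_simple by blast
    define g where "g k x = max 0 (min 1 (real n * f x - real k))" for k :: nat and x
    define b where "b k = measure base_measure {x. real k \<le> real n * f x}" for k :: nat
    have level: "{x. real k \<le> real n * f x} \<in> sets borel" for k :: nat
      using meas[OF f(1)] by measurable
    have g: "g k \<in> C_b" "0 \<le> g k x" "g k x \<le> 1" for k x
      unfolding g_def using f(1) by (auto intro!: C_b_max C_b_min C_b_diff C_b_scale)
    have sum_g: "(\<Sum>k<m. g k x) = real n * f x" for x
    proof -
      have "real n * f x \<le> real n * c" using c(2)[of x] by (intro mult_left_mono) auto
      then show ?thesis unfolding g_def using sum_unit_layers[of "real n * f x" m] f(2)[of x] m by simp
    qed
    have "I (\<lambda>x. \<Sum>k<n. f x) = (\<Sum>k<n. I f)" using I_sum[of "\<lambda>_. f" n] f by auto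
    then have "real n * I f = (\<Sum>k<m. I (g k))"
      using I_sum[of g m] g by (simp add: sum_g)
    moreover have "real n * ?J f = (\<Sum>k<m. ?J (g k))"
    proof -
      have "real n * ?J f = ?J (\<lambda>x. \<Sum>k<m. g k x)" by (simp add: sum_g)
      then show ?thesis using int[OF g(1)] by (simp add: Bochner_Integration.integral_sum)
    qed
    ultimately have "real n * (I f - ?J f) = (\<Sum>k<m. I (g k) - ?J (g k))"
      by (simp add: right_diff_distrib sum_subtractf)
    then have "real n * \<bar>I f - ?J f\<bar> = \<bar>\<Sum>k<m. I (g k) - ?J (g k)\<bar>"
      by (metis abs_mult abs_of_nat)
    also have "\<dots> \<le> (\<Sum>k<m. \<bar>I (g k) - ?J (g k)\<bar>)" by (rule sum_abs)
    also have "\<dots> \<le> (\<Sum>k<m. b k - b (Suc k))"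
    proof (rule sum_mono)
      fix k
      have "I (g k) \<le> b k" unfolding b_def
        by (rule I_le_base_measure[OF g level]) (auto simp: g_def)
      moreover have "b (Suc k) \<le> I (g k)" unfolding b_def
        by (rule base_measure_le_I[OF g(1,2) level]) (auto simp: g_def)
      moreover have "?J (g k) \<le> ?J (indicat_real {x. real k \<le> real n * f x})"
      proof (rule integral_mono[OF int[OF g(1)] ind_int[OF level]])
        show "g k x \<le> indicat_real {x. real k \<le> real n * f x} x" for x
          using g(3)[of k x] by (simp add: indicator_def) (simp add: g_def)
      qed
      moreover have "?J (indicat_real {x. real (Suc k) \<le> real n * f x}) \<le> ?J (g k)"
      proof (rule integral_mono[OF ind_int[OF level] int[OF g(1)]])
        show "indicat_real {x. real (Suc k) \<le> real n * f x} x \<le> g k x" for x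
          using g(2)[of k x] by (simp add: indicator_def) (simp add: g_def)
      qed
      ultimately show "\<bar>I (g k) - ?J (g k)\<bar> \<le> b k - b (Suc k)"
        using sets_eq_imp_space_eq[OF sets_base_measure] unfolding b_def by auto
    qed
    also have "\<dots> = b 0 - b m" by (rule sum_lessThan_telescope')
    also have "\<dots> \<le> measure base_measure UNIV"
      unfolding b_def using f(2) by simp
    finally show ?thesis .
  qed
  have "\<bar>I f - ?J f\<bar> \<le> 0"
  proof (rule ccontr)
    assume "\<not> ?thesis"
    then obtain n where "measure base_measure UNIV < real n * \<bar>I f - ?J f\<bar>"
      using ex_less_of_nat_mult by (metis not_le)
    then show False using bound[of n] by simp
  qed
  then show ?thesis by simp
qed

end

lemma Dini_uniform_limit:
  fixes f :: "nat \<Rightarrow> 'a::topological_space \<Rightarrow> real"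
  assumes K: "compact K" and cont: "\<And>n. continuous_on UNIV (f n)" and nonneg: "\<And>n x. 0 \<le> f n x"
    and dec: "\<And>x. decseq (\<lambda>n. f n x)" and lim: "\<And>x. (\<lambda>n. f n x) \<longlonglongrightarrow> 0"
  shows "uniform_limit K f (\<lambda>x. 0) sequentially"
proof (rule uniform_limitI)
  fix e :: real assume e: "0 < e"
  have "open {x. f n x < e}" for n
    using open_Collect_less[OF cont continuous_on_const] .
  moreover have "K \<subseteq> (\<Union>n. {x. f n x < e})"
  proof
    fix x
    have "\<exists>n. f n x < e" using order_tendstoD(2)[OF lim e, of x] eventually_happens by force
    then show "x \<in> (\<Union>n. {x. f n x < e})" by blast
  qed
  ultimately obtain T where T: "finite T" "K \<subseteq> (\<Union>n\<in>T. {x. f n x < e})"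
    using compactE_image[OF K, of UNIV "\<lambda>n. {x. f n x < e}"] by auto
  have "dist (f n x) 0 < e" if n: "Max (insert 0 T) \<le> n" and x: "x \<in> K" for n x
  proof -
    obtain k where k: "k \<in> T" "f k x < e" using T x by auto
    then have "k \<le> n" using n T(1) by simp
    then have "f n x \<le> f k x" using dec decseqD by blast
    then show ?thesis using k nonneg[of n x] by simp
  qed
  then show "\<forall>\<^sub>F n in sequentially. \<forall>x\<in>K. dist (f n x) 0 < e"
    unfolding eventually_sequentially by blast
qed

definition positive_part :: "(('a::topological_space \<Rightarrow> real) \<Rightarrow> real) \<Rightarrow> ('a \<Rightarrow> real) \<Rightarrow> real" where
  "positive_part \<Lambda> f = (SUP g \<in> {g \<in> C_b. \<forall>x. 0 \<le> g x \<and> g x \<le> f x}. \<Lambda> g)"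

lemma positive_part_leI:
  assumes "\<And>x. 0 \<le> f x" "\<And>g. g \<in> C_b \<Longrightarrow> (\<And>x. 0 \<le> g x) \<Longrightarrow> (\<And>x. g x \<le> f x) \<Longrightarrow> \<Lambda> g \<le> c"
  shows "positive_part \<Lambda> f \<le> c"
  unfolding positive_part_def
proof (rule cSUP_least)
  have "(\<lambda>x. 0) \<in> {g \<in> C_b. \<forall>x. 0 \<le> g x \<and> g x \<le> f x}" using assms(1) by simp
  then show "{g \<in> C_b. \<forall>x. 0 \<le> g x \<and> g x \<le> f x} \<noteq> {}" by blast
qed (use assms(2) in auto)

lemma le_positive_part:
  assumes \<Lambda>: "bounded_functional_on C_b \<Lambda>" and f: "f \<in> C_b"
    and g: "g \<in> C_b" "\<And>x. 0 \<le> g x" "\<And>x. g x \<le> f x"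
  shows "\<Lambda> g \<le> positive_part \<Lambda> f"
proof -
  obtain c where c: "\<And>x. \<bar>f x\<bar> \<le> c" using f C_bE by metis
  obtain C where C: "\<And>g c. g \<in> C_b \<Longrightarrow> \<forall>x. \<bar>g x\<bar> \<le> c \<Longrightarrow> \<bar>\<Lambda> g\<bar> \<le> C * c"
    using \<Lambda> unfolding bounded_functional_on_def by metis
  have "\<Lambda> h \<le> C * c" if "h \<in> C_b" "\<forall>x. 0 \<le> h x \<and> h x \<le> f x" for h
  proof -
    have "\<bar>h x\<bar> \<le> c" for x using that(2) c[of x] by (metis abs_le_iff abs_of_nonneg order_trans)
    then show ?thesis using C[OF that(1)] by (simp add: abs_le_iff)
  qed
  then have "bdd_above (\<Lambda> ` {g \<in> C_b. \<forall>x. 0 \<le> g x \<and> g x \<le> f x})"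
    by (intro bdd_aboveI2) auto
  then show ?thesis unfolding positive_part_def using g by (intro cSUP_upper) auto
qed

text \<open>Riesz decomposition: a function \<open>h\<close> between \<open>0\<close> and \<open>f + g\<close> is the sum of \<open>min h f\<close>, below \<open>f\<close>, and
  of a remainder below \<open>g\<close>, both continuous.\<close>

lemma positive_part_add:
  assumes \<Lambda>: "bounded_functional_on C_b \<Lambda>" and f: "f \<in> C_b" "\<And>x. 0 \<le> f x" and g: "g \<in> C_b" "\<And>x. 0 \<le> g x"
  shows "positive_part \<Lambda> (\<lambda>x. f x + g x) = positive_part \<Lambda> f + positive_part \<Lambda> g"
proof (rule antisym)
  have lin: "linear_functional_on C_b \<Lambda>" using \<Lambda> unfolding bounded_functional_on_def by simp
  note fg = C_b_add[OF f(1) g(1)]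
  show "positive_part \<Lambda> (\<lambda>x. f x + g x) \<le> positive_part \<Lambda> f + positive_part \<Lambda> g"
  proof (rule positive_part_leI)
    fix h assume h: "h \<in> C_b" "\<And>x. 0 \<le> h x" "\<And>x. h x \<le> f x + g x"
    define u where "u x = min (h x) (f x)" for x
    have u: "u \<in> C_b" unfolding u_def using h(1) f(1) by (rule C_b_min)
    have "\<Lambda> u \<le> positive_part \<Lambda> f"
      using f h by (intro le_positive_part[OF \<Lambda> f(1) u]) (auto simp: u_def)
    moreover have "\<Lambda> (\<lambda>x. h x - u x) \<le> positive_part \<Lambda> g"
      using h g by (intro le_positive_part[OF \<Lambda> g(1) C_b_diff[OF h(1) u]]) (auto simp: u_def min_def algebra_simps)
    moreover have "\<Lambda> (\<lambda>x. h x - u x) = \<Lambda> h - \<Lambda> u"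
      by (rule linear_functional_on_diff[OF lin C_b_scale h(1) u])
    ultimately show "\<Lambda> h \<le> positive_part \<Lambda> f + positive_part \<Lambda> g" by simp
  qed (use f g in auto)
  have "positive_part \<Lambda> f \<le> positive_part \<Lambda> (\<lambda>x. f x + g x) - positive_part \<Lambda> g"
  proof (rule positive_part_leI[OF f(2)])
    fix u assume u: "u \<in> C_b" "\<And>x. 0 \<le> u x" "\<And>x. u x \<le> f x"
    have "positive_part \<Lambda> g \<le> positive_part \<Lambda> (\<lambda>x. f x + g x) - \<Lambda> u"
    proof (rule positive_part_leI[OF g(2)])
      fix v assume v: "v \<in> C_b" "\<And>x. 0 \<le> v x" "\<And>x. v x \<le> g x"
      have "\<Lambda> (\<lambda>x. u x + v x) \<le> positive_part \<Lambda> (\<lambda>x. f x + g x)"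
        using u v by (intro le_positive_part[OF \<Lambda> fg C_b_add]) (auto intro: add_mono)
      then show "\<Lambda> v \<le> positive_part \<Lambda> (\<lambda>x. f x + g x) - \<Lambda> u"
        using linear_functional_onD(1)[OF lin u(1) v(1)] by simp
    qed
    then show "\<Lambda> u \<le> positive_part \<Lambda> (\<lambda>x. f x + g x) - positive_part \<Lambda> g" by simp
  qed
  then show "positive_part \<Lambda> f + positive_part \<Lambda> g \<le> positive_part \<Lambda> (\<lambda>x. f x + g x)" by simp
qed

text \<open>Both \<open>positive_part \<Lambda>\<close> and \<open>positive_part \<Lambda> - \<Lambda>\<close> are Daniell integrals. For the smoothness of the
  positive part, pick \<open>g n\<close> between \<open>0\<close> and \<open>f n\<close> that almost attains the supremum: \<open>g n\<close> tends to
  \<open>0\<close> as \<open>f n\<close> does, so \<open>\<Lambda> (g n)\<close> tends to \<open>0\<close>.\<close>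

theorem smooth_functional_representation:
  fixes \<Lambda> :: "('a::metric_space \<Rightarrow> real) \<Rightarrow> real"
  assumes lin: "linear_functional_on C_b \<Lambda>" and K: "compact K" and sm: "smooth_modulo C_b K \<Lambda>"
  shows "\<exists>\<nu>\<in>ca. \<forall>f\<in>C_b. \<Lambda> f = darboux_integral \<nu> f"
proof -
  have \<Lambda>: "bounded_functional_on C_b \<Lambda>"
    using bounded_function_space_C_b lin sm by (rule smooth_modulo_bounded)
  let ?pos = "positive_part \<Lambda>"
  have nonneg: "0 \<le> ?pos f" if "f \<in> C_b" "\<And>x. 0 \<le> f x" for f
    using le_positive_part[OF \<Lambda> that(1) C_b_const, of 0] that(2)
      linear_functional_onD(2)[OF lin C_b_const, of 0 0] by simp
  have pos_smooth: "(\<lambda>n. ?pos (f n)) \<longlonglongrightarrow> 0" and \<Lambda>_smooth: "(\<lambda>n. \<Lambda> (f n)) \<longlonglongrightarrow> 0"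
    if f: "\<And>n. f n \<in> C_b" "\<And>n x. 0 \<le> f n x" "\<And>x. decseq (\<lambda>n. f n x)" "\<And>x. (\<lambda>n. f n x) \<longlonglongrightarrow> 0"
    for f :: "nat \<Rightarrow> 'a \<Rightarrow> real"
  proof -
    obtain c where c: "\<And>x. \<bar>f 0 x\<bar> \<le> c" using C_bE[OF f(1)] by metis
    have fc: "f n x \<le> c" for n x
      using decseqD[OF f(3), of 0 n x] c[of x] by (simp add: abs_le_iff)
    have unif: "uniform_limit K f (\<lambda>x. 0) sequentially"
      using K C_b_continuous[OF f(1)] f(2-4) by (rule Dini_uniform_limit)
    \<comment> \<open>Anything squeezed between \<open>0\<close> and \<open>f n\<close> inherits all the hypotheses of smoothness.\<close>
    have below: "(\<lambda>n. \<Lambda> (g n)) \<longlonglongrightarrow> 0"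
      if g: "\<And>n. g n \<in> C_b" "\<And>n x. 0 \<le> g n x" "\<And>n x. g n x \<le> f n x" for g
    proof (rule sm[unfolded smooth_modulo_def, rule_format])
      show "\<bar>g n x\<bar> \<le> c" for n x using g(2,3)[of n x] fc[of n x] by simp
      show "(\<lambda>n. g n x) \<longlonglongrightarrow> 0" for x
        by (rule tendsto_sandwich[OF _ _ tendsto_const f(4)[of x]]) (use g(2,3) in auto)
      show "uniform_limit K g (\<lambda>x. 0) sequentially"
      proof (rule uniform_limitI)
        fix e :: real assume "0 < e"
        from uniform_limitD[OF unif this]
        show "\<forall>\<^sub>F n in sequentially. \<forall>x\<in>K. dist (g n x) 0 < e"
        proof (rule eventually_mono)
          fix n assume n: "\<forall>x\<in>K. dist (f n x) 0 < e"
          show "\<forall>x\<in>K. dist (g n x) 0 < e"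
          proof
            fix x assume "x \<in> K"
            then show "dist (g n x) 0 < e" using n g(2,3)[of n x] by force
          qed
        qed
      qed
    qed (use g in auto)
    show "(\<lambda>n. \<Lambda> (f n)) \<longlonglongrightarrow> 0" by (rule below[OF f(1,2)]) simp
    have "\<exists>g\<in>C_b. (\<forall>x. 0 \<le> g x \<and> g x \<le> f n x) \<and> ?pos (f n) \<le> \<Lambda> g + inverse (real (Suc n))" for n
    proof (rule ccontr)
      assume *: "\<not> ?thesis"
      have "?pos (f n) \<le> ?pos (f n) - inverse (real (Suc n))"
      proof (rule positive_part_leI[OF f(2)])
        fix g assume "g \<in> C_b" "\<And>x. 0 \<le> g x" "\<And>x. g x \<le> f n x"
        then have "\<not> ?pos (f n) \<le> \<Lambda> g + inverse (real (Suc n))" using * by blast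
        then show "\<Lambda> g \<le> ?pos (f n) - inverse (real (Suc n))" by simp
      qed
      then show False by simp
    qed
    then obtain g where g: "\<And>n. g n \<in> C_b" "\<And>n x. 0 \<le> g n x" "\<And>n x. g n x \<le> f n x"
      "\<And>n. ?pos (f n) \<le> \<Lambda> (g n) + inverse (real (Suc n))" by metis
    have "(\<lambda>n. \<Lambda> (g n) + inverse (real (Suc n))) \<longlonglongrightarrow> 0"
      using tendsto_add[OF below[OF g(1-3)] LIMSEQ_inverse_real_of_nat] by simp
    then show "(\<lambda>n. ?pos (f n)) \<longlonglongrightarrow> 0"
      by (rule tendsto_sandwich[OF always_eventually always_eventually tendsto_const, rotated 2])
        (intro allI nonneg f g(4))+
  qed
  interpret pos: smooth_cone_functional ?pos
  proof
    show "?pos (\<lambda>x. f x + g x) = ?pos f + ?pos g"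
      if "f \<in> C_b" "g \<in> C_b" "\<And>x. 0 \<le> f x" "\<And>x. 0 \<le> g x" for f g
      using positive_part_add[OF \<Lambda> that(1,3,2,4)] .
  qed (fact nonneg pos_smooth)+
  interpret neg: smooth_cone_functional "\<lambda>f. ?pos f - \<Lambda> f"
  proof
    show "?pos (\<lambda>x. f x + g x) - \<Lambda> (\<lambda>x. f x + g x) = ?pos f - \<Lambda> f + (?pos g - \<Lambda> g)"
      if "f \<in> C_b" "g \<in> C_b" "\<And>x. 0 \<le> f x" "\<And>x. 0 \<le> g x" for f g
      using positive_part_add[OF \<Lambda> that(1,3,2,4)] linear_functional_onD(1)[OF lin that(1,2)] by simp
    show "0 \<le> ?pos f - \<Lambda> f" if "f \<in> C_b" "\<And>x. 0 \<le> f x" for f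
      using le_positive_part[OF \<Lambda> that(1) that] by simp
    show "(\<lambda>n. ?pos (f n) - \<Lambda> (f n)) \<longlonglongrightarrow> 0"
      if "\<And>n. f n \<in> C_b" "\<And>n x. 0 \<le> f n x" "\<And>x. decseq (\<lambda>n. f n x)" "\<And>x. (\<lambda>n. f n x) \<longlonglongrightarrow> 0" for f
      using tendsto_diff[OF pos_smooth[OF that] \<Lambda>_smooth[OF that]] by simp
  qed
  note M = pos.finite_base_measure pos.sets_base_measure
  note N = neg.finite_base_measure neg.sets_base_measure
  define \<nu> where "\<nu> = (\<lambda>A. measure pos.base_measure A - measure neg.base_measure A)"
  have \<nu>: "\<nu> \<in> ca" unfolding \<nu>_def by (intro ca_diff measure_in_ca M N)
  have nonneg_case: "\<Lambda> f = darboux_integral \<nu> f" if "f \<in> C_b" "\<And>x. 0 \<le> f x" for f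
    using pos.I_eq_integral[OF that] neg.I_eq_integral[OF that] darboux_measure_diff[OF M N, of f]
      that(1) C_b_subset_B_b unfolding \<nu>_def by auto
  have "\<Lambda> f = darboux_integral \<nu> f" if f: "f \<in> C_b" for f
  proof -
    obtain c where c: "0 < c" "\<And>x. \<bar>f x\<bar> \<le> c" using C_bE[OF f] by metis
    have lin': "linear_functional_on C_b (darboux_integral \<nu>)"
      using darboux_linear[of \<nu>] \<nu> ca_subset_ba C_b_subset_B_b by (blast intro: linear_functional_on_subset)
    have "0 \<le> f x + c" for x using c(2)[of x] by (simp add: abs_le_iff)
    then have "\<Lambda> (\<lambda>x. f x + c) = darboux_integral \<nu> (\<lambda>x. f x + c)"
      by (intro nonneg_case C_b_add f C_b_const)
    moreover have "\<Lambda> (\<lambda>x. c) = darboux_integral \<nu> (\<lambda>x. c)" using c(1) by (intro nonneg_case) auto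
    ultimately show ?thesis
      using linear_functional_onD(1)[OF lin f C_b_const] linear_functional_onD(1)[OF lin' f C_b_const] by simp
  qed
  then show ?thesis using \<nu> by blast
qed

section \<open>Uniqueness of the countably additive part\<close>

text \<open>Dominated convergence carries the vanishing from continuous functions to indicators of open sets,
  which form a generator of the Borel sets stable under intersection.\<close>

lemma ca_determined_by_C_b:
  fixes \<nu> :: "'a::metric_space set \<Rightarrow> real"
  assumes \<nu>: "\<nu> \<in> ca" and zero: "\<And>f. f \<in> C_b \<Longrightarrow> darboux_integral \<nu> f = 0"
  shows "\<nu> = (\<lambda>A. 0)"
proof -
  have ba: "\<nu> \<in> ba" using \<nu> ca_subset_ba by auto
  obtain M N where MN: "finite_measure M" "sets M = sets borel" "finite_measure N" "sets N = sets borel"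
    "\<nu> = (\<lambda>A. measure M A - measure N A)" using ca_eq_measure_diff[OF \<nu>] by metis
  have \<nu>_open: "\<nu> U = 0" if U: "open U" for U
  proof -
    obtain h :: "nat \<Rightarrow> 'a \<Rightarrow> real" where h: "\<And>n. h n \<in> C_b" "\<And>n x. 0 \<le> h n x" "\<And>n x. h n x \<le> 1"
      "\<And>n x. x \<notin> U \<Longrightarrow> h n x = 0" "\<And>x. x \<in> U \<Longrightarrow> \<forall>\<^sub>F n in sequentially. h n x = 1"
      using open_indicator_approx[OF U] by metis
    have "(\<lambda>n. darboux_integral \<nu> (h n)) \<longlonglongrightarrow> darboux_integral \<nu> (indicat_real U)"
    proof (rule darboux_dominated_convergence[OF \<nu>])
      show "\<bar>h n x\<bar> \<le> 1" for n x using h(2,3)[of n x] by simp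
      show "(\<lambda>n. h n x) \<longlonglongrightarrow> indicat_real U x" for x
        using h(4)[of x] h(5)[of x] by (cases "x \<in> U") (auto intro: tendsto_eventually)
    qed (use h(1) C_b_subset_B_b U in \<open>auto intro: B_b_indicator\<close>)
    then have "(\<lambda>n::nat. 0) \<longlonglongrightarrow> \<nu> U" using zero[OF h(1)] U by (simp add: darboux_indicator[OF ba])
    then show ?thesis using LIMSEQ_unique tendsto_const by blast
  qed
  have borel: "sets borel = sigma_sets UNIV {U :: 'a set. open U}" by (simp add: borel_def)
  have "M = N"
  proof (rule measure_eqI_generator_eq[where E="{U. open U}" and \<Omega>=UNIV and A="\<lambda>_. UNIV"])
    show "emeasure M U = emeasure N U" if "U \<in> {U. open U}" for U
      using \<nu>_open[of U] that MN by (simp add: finite_measure.emeasure_eq_measure)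
    show "emeasure M UNIV \<noteq> \<infinity>" using finite_measure.emeasure_finite[OF MN(1)] by simp
  qed (use MN borel in \<open>auto simp: Int_stable_def\<close>)
  then show ?thesis using MN(5) by simp
qed

section \<open>Restriction to a Borel set\<close>

lemma bounded_functional_restrict:
  assumes \<Lambda>: "bounded_functional_on B_b \<Lambda>" and A: "A \<in> sets borel"
  shows "bounded_functional_on B_b (\<lambda>f. \<Lambda> (\<lambda>x. f x * indicator A x))"
proof -
  have lin: "linear_functional_on B_b \<Lambda>" using \<Lambda> unfolding bounded_functional_on_def by simp
  obtain C where C: "\<And>f c. f \<in> B_b \<Longrightarrow> \<forall>x. \<bar>f x\<bar> \<le> c \<Longrightarrow> \<bar>\<Lambda> f\<bar> \<le> C * c"
    using \<Lambda> unfolding bounded_functional_on_def by metis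
  have "\<bar>\<Lambda> (\<lambda>x. f x * indicator A x)\<bar> \<le> C * c" if "f \<in> B_b" "\<forall>x. \<bar>f x\<bar> \<le> c" for f c
  proof (rule C[OF B_b_indicator_mult[OF A that(1)]], rule allI)
    fix x
    show "\<bar>f x * indicat_real A x\<bar> \<le> c"
      using that(2) order_trans[OF abs_ge_zero, of "f x" c] by (simp add: indicator_def)
  qed
  moreover have "linear_functional_on B_b (\<lambda>f. \<Lambda> (\<lambda>x. f x * indicator A x))"
    unfolding linear_functional_on_def
    using linear_functional_onD(1)[OF lin B_b_indicator_mult[OF A] B_b_indicator_mult[OF A]]
      linear_functional_onD(2)[OF lin B_b_indicator_mult[OF A]]
    by (simp add: distrib_right mult.assoc)
  ultimately show ?thesis unfolding bounded_functional_on_def by blast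
qed

lemma charge_of_restrict_ca:
  assumes \<nu>: "\<nu> \<in> ca" and K: "K \<in> sets borel"
  shows "charge_of (\<lambda>f. darboux_integral \<nu> (\<lambda>x. f x * indicator K x)) \<in> ca" (is "?\<nu>K \<in> ca")
proof -
  have ba: "\<nu> \<in> ba" using \<nu> ca_subset_ba by auto
  have eq: "?\<nu>K A = \<nu> (A \<inter> K)" if "A \<in> sets borel" for A
  proof -
    have "(\<lambda>x. indicat_real A x * indicat_real K x) = indicat_real (A \<inter> K)"
      by (simp add: fun_eq_iff indicator_inter_arith)
    then show ?thesis using that K darboux_indicator[OF ba, of "A \<inter> K"] by (simp add: charge_of_def)
  qed
  have "(\<lambda>i. ?\<nu>K (A i)) sums ?\<nu>K (\<Union>i. A i)"
    if A: "range A \<subseteq> sets borel" "disjoint_family A" for A :: "nat \<Rightarrow> _"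
  proof -
    have meas: "A i \<in> sets borel" for i using A(1) by auto
    have "(\<lambda>i. \<nu> (A i \<inter> K)) sums \<nu> (\<Union>i. A i \<inter> K)"
      using meas K by (intro caD[OF \<nu>] disjoint_family_subset[OF A(2)]) auto
    moreover have "(\<Union>i. A i \<inter> K) = (\<Union>i. A i) \<inter> K" by blast
    moreover have "(\<Union>i. A i) \<in> sets borel" using meas by blast
    ultimately show ?thesis using eq meas by simp
  qed
  moreover have "?\<nu>K \<in> ba"
    by (intro charge_of_in_ba bounded_functional_restrict darboux_bounded_functional ba K)
  ultimately show ?thesis unfolding ca_def by blast
qed

section \<open>Integration against the representing charges is continuous\<close>

text \<open>Turns the support condition on a charge, which speaks of sets, into a statement on integrals from
  which a bound by the supremum over \<open>K\<close> can be read off.\<close>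

lemma ba_C_restrict:
  fixes \<mu> :: "'a::metric_space set \<Rightarrow> real"
  assumes \<mu>: "\<mu> \<in> ba_C"
  obtains K where "compact K" "K \<noteq> {}"
    "\<And>f. f \<in> B_b \<Longrightarrow> darboux_integral \<mu> f = darboux_integral \<mu> (\<lambda>x. f x * indicator K x)"
proof -
  obtain K where K: "compact K" "total_variation \<mu> (- K) = 0" and ba: "\<mu> \<in> ba"
    using \<mu> unfolding ba_C_def by blast
  \<comment> \<open>The support may be empty, whereas the seminorms range over nonempty compact sets.\<close>
  define L where "L = insert undefined K"
  have L: "compact L" "L \<noteq> {}" unfolding L_def using K(1) by auto
  have meas: "K \<in> sets borel" "L \<in> sets borel"
    using K(1) L(1) by (auto intro: borel_closed compact_imp_closed)
  have "darboux_integral \<mu> f = darboux_integral \<mu> (\<lambda>x. f x * indicator L x)" if "f \<in> B_b" for f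
  proof (rule darboux_unique[OF ba _ _ that])
    show "bounded_functional_on B_b (\<lambda>f. darboux_integral \<mu> (\<lambda>x. f x * indicator L x))"
      by (intro bounded_functional_restrict darboux_bounded_functional ba meas)
    fix A :: "'a set" assume A: "A \<in> sets borel"
    have "(\<lambda>x. indicat_real A x * indicat_real L x) = indicat_real (A \<inter> L)"
      by (simp add: fun_eq_iff indicator_inter_arith)
    then have "darboux_integral \<mu> (\<lambda>x. indicat_real A x * indicator L x) = \<mu> (A \<inter> L)"
      using A meas darboux_indicator[OF ba, of "A \<inter> L"] by simp
    moreover have "\<mu> (A - L) = 0"
      using abs_le_total_variation[of \<mu> "- K" "A - L"] baD(2)[OF ba] A meas K(2) by (auto simp: L_def)
    moreover have "\<mu> ((A \<inter> L) \<union> (A - L)) = \<mu> (A \<inter> L) + \<mu> (A - L)"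
      using A meas by (intro baD(3)[OF ba]) auto
    moreover have "(A \<inter> L) \<union> (A - L) = A" by blast
    ultimately show "darboux_integral \<mu> (\<lambda>x. indicat_real A x * indicator L x) = \<mu> A" by simp
  qed
  then show ?thesis using that L by blast
qed

lemma integration_on_in_dual:
  assumes V: "bounded_function_space V" and \<mu>: "\<mu> \<in> ba" and K: "compact K" "K \<noteq> {}" and \<nu>: "\<nu> \<in> ca"
    and bound: "\<And>f. f \<in> V \<Longrightarrow> \<bar>darboux_integral \<mu> f\<bar> \<le> C * p_K K \<nu> f"
  shows "integration_on V \<mu> \<in> dual_tau_K V"
proof -
  note VD = bounded_function_spaceD[OF V]
  have lin: "linear_functional_on V (integration_on V \<mu>)"
    using darboux_linear[OF \<mu>] VD(1,3,4) unfolding linear_functional_on_def integration_on_def by simp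
  moreover have "continuous_map (tau_K V) euclideanreal (integration_on V \<mu>)"
    using bound by (intro continuous_map_tau_K[OF V lin K \<nu>]) (simp add: integration_on_def)
  ultimately show ?thesis unfolding dual_tau_K_def by (simp add: integration_on_def)
qed

lemma integration_on_B_b_in_dual:
  fixes \<mu> :: "'a::metric_space set \<Rightarrow> real"
  assumes \<mu>: "\<mu> \<in> ba_C" and \<nu>: "\<nu> \<in> ca"
  shows "integration_on B_b (\<lambda>A. \<mu> A + \<nu> A) \<in> dual_tau_K B_b"
proof -
  have ba: "\<mu> \<in> ba" "\<nu> \<in> ba" using \<mu> \<nu> ca_subset_ba unfolding ba_C_def by auto
  obtain K where K: "compact K" "K \<noteq> {}"
    "\<And>f. f \<in> B_b \<Longrightarrow> darboux_integral \<mu> f = darboux_integral \<mu> (\<lambda>x. f x * indicator K x)"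
    using ba_C_restrict[OF \<mu>] by blast
  have meas: "K \<in> sets borel" using K(1) by (intro borel_closed compact_imp_closed)
  obtain C where C: "\<And>f c. f \<in> B_b \<Longrightarrow> \<forall>x. \<bar>f x\<bar> \<le> c \<Longrightarrow> \<bar>darboux_integral \<mu> f\<bar> \<le> C * c"
    using darboux_bounded_functional[OF ba(1)] unfolding bounded_functional_on_def by metis
  have "\<bar>darboux_integral (\<lambda>A. \<mu> A + \<nu> A) f\<bar> \<le> (\<bar>C\<bar> + 1) * p_K K \<nu> f" if f: "f \<in> B_b" for f
  proof -
    define s where "s = (SUP x\<in>K. \<bar>f x\<bar>)"
    have s: "\<bar>f x\<bar> \<le> s" if "x \<in> K" for x unfolding s_def using f that by (rule abs_le_SUP_abs)
    then have s0: "0 \<le> s" using K(2) abs_ge_zero order_trans by blast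
    have "\<bar>darboux_integral \<mu> f\<bar> \<le> C * s"
      unfolding K(3)[OF f] using s s0
      by (intro C B_b_indicator_mult meas f allI) (simp add: indicator_def)
    also have "\<dots> \<le> \<bar>C\<bar> * s" using s0 by (intro mult_right_mono) auto
    finally have "\<bar>darboux_integral (\<lambda>A. \<mu> A + \<nu> A) f\<bar> \<le> \<bar>C\<bar> * s + \<bar>darboux_integral \<nu> f\<bar>"
      unfolding darboux_add[OF ba f] by linarith
    moreover have "0 \<le> \<bar>C\<bar> * \<bar>darboux_integral \<nu> f\<bar>" by simp
    moreover have "(\<bar>C\<bar> + 1) * (s + \<bar>darboux_integral \<nu> f\<bar>) =
        \<bar>C\<bar> * s + \<bar>C\<bar> * \<bar>darboux_integral \<nu> f\<bar> + s + \<bar>darboux_integral \<nu> f\<bar>" by algebra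
    ultimately show ?thesis unfolding p_K_def s_def[symmetric] using s0 by linarith
  qed
  then show ?thesis
    by (intro integration_on_in_dual[OF bounded_function_space_B_b ba_add[OF ba] K(1,2) \<nu>])
qed

lemma integration_on_C_b_in_dual:
  fixes \<nu> :: "'a::metric_space set \<Rightarrow> real"
  assumes \<nu>: "\<nu> \<in> ca"
  shows "integration_on C_b \<nu> \<in> dual_tau_K C_b"
proof (rule integration_on_in_dual[OF bounded_function_space_C_b _ _ _ \<nu>])
  show "\<nu> \<in> ba" using \<nu> ca_subset_ba by auto
  show "compact {undefined :: 'a}" "{undefined :: 'a} \<noteq> {}" by auto
  show "\<bar>darboux_integral \<nu> f\<bar> \<le> 1 * p_K {undefined} \<nu> f" for f unfolding p_K_def by simp
qed

section \<open>Decomposition of a continuous functional\<close>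

text \<open>Off the compact set, smoothness is continuity from above at the empty set.\<close>

lemma charge_of_off_compact_ca:
  fixes \<Lambda> :: "('a::topological_space \<Rightarrow> real) \<Rightarrow> real"
  assumes \<Lambda>: "bounded_functional_on B_b \<Lambda>" and sm: "smooth_modulo B_b K \<Lambda>" and K: "K \<in> sets borel"
  shows "charge_of (\<lambda>f. \<Lambda> (\<lambda>x. f x * indicator (- K) x)) \<in> ca" (is "?\<nu> \<in> ca")
proof -
  have Kc: "- K \<in> sets borel" using K by auto
  have ba: "?\<nu> \<in> ba" by (intro charge_of_in_ba bounded_functional_restrict \<Lambda> Kc)
  have "(\<lambda>i. ?\<nu> (A i)) sums ?\<nu> (\<Union>i. A i)"
    if A: "range A \<subseteq> sets borel" "disjoint_family A" for A :: "nat \<Rightarrow> 'a set"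
  proof -
    have meas: "A i \<in> sets borel" for i using A(1) by auto
    define R where "R n = (\<Union>i. A i) - (\<Union>i<n. A i)" for n
    have Un: "(\<Union>i. A i) \<in> sets borel" "(\<Union>i<n. A i) \<in> sets borel" for n using meas by blast+
    then have R: "R n \<in> sets borel" for n unfolding R_def by blast
    have split: "(\<Sum>i<n. ?\<nu> (A i)) = ?\<nu> (\<Union>i. A i) - ?\<nu> (R n)" for n
    proof -
      have "?\<nu> ((\<Union>i<n. A i) \<union> R n) = ?\<nu> (\<Union>i<n. A i) + ?\<nu> (R n)"
        using Un R by (intro baD(3)[OF ba]) (auto simp: R_def)
      moreover have "(\<Union>i<n. A i) \<union> R n = (\<Union>i. A i)" unfolding R_def by blast
      moreover have "?\<nu> (\<Union>i<n. A i) = (\<Sum>i<n. ?\<nu> (A i))"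
        using meas A(2) by (intro charge_initial_Union baD[OF ba])
      ultimately show ?thesis by simp
    qed
    have "(\<lambda>n. \<Lambda> (\<lambda>x. indicator (R n) x * indicator (- K) x)) \<longlonglongrightarrow> 0"
    proof (rule sm[unfolded smooth_modulo_def, rule_format])
      show "(\<lambda>x. indicator (R n) x * indicator (- K) x) \<in> B_b" for n
        by (intro B_b_indicator_mult B_b_indicator R Kc)
      show "\<bar>indicat_real (R n) x * indicat_real (- K) x\<bar> \<le> 1" for n x by (simp add: indicator_def)
      show "(\<lambda>n. indicat_real (R n) x * indicat_real (- K) x) \<longlonglongrightarrow> 0" for x
      proof -
        obtain N where N: "x \<in> (\<Union>i. A i) \<Longrightarrow> x \<in> A N" by blast
        have "x \<notin> R n" if "Suc N \<le> n" for n using N that unfolding R_def by force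
        then have "\<forall>\<^sub>F n in sequentially. indicat_real (R n) x * indicat_real (- K) x = 0"
          unfolding eventually_sequentially by (intro exI[of _ "Suc N"]) simp
        then show ?thesis by (rule tendsto_eventually)
      qed
      show "uniform_limit K (\<lambda>n x. indicat_real (R n) x * indicat_real (- K) x) (\<lambda>x. 0) sequentially"
        by (rule uniform_limitI) simp
    qed
    then have "(\<lambda>n. ?\<nu> (R n)) \<longlonglongrightarrow> 0" using R by (simp add: charge_of_def)
    from tendsto_diff[OF tendsto_const this, of "?\<nu> (\<Union>i. A i)"]
    show ?thesis unfolding sums_def using split by simp
  qed
  then show ?thesis unfolding ca_def using ba by blast
qed

text \<open>The charge \<open>m\<close> carries \<open>\<Lambda>\<close> on \<open>K\<close> and \<open>\<nu>1\<close> carries it off \<open>K\<close>. On \<open>C_b\<close> the charge \<open>m\<close> acts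
  like some countably additive \<open>\<nu>0\<close>, whose restriction \<open>\<nu>2\<close> to \<open>K\<close> is moved from \<open>m\<close> to the countably
  additive part. The restriction makes the difference \<open>m - \<nu>2\<close> vanish off \<open>K\<close>.\<close>

lemma dual_B_b_decomposition:
  fixes \<Lambda> :: "('a::metric_space \<Rightarrow> real) \<Rightarrow> real"
  assumes dual: "\<Lambda> \<in> dual_tau_K B_b"
  shows "\<exists>\<mu>\<in>ba_C \<inter> C_b_perp. \<exists>\<nu>\<in>ca. \<forall>f\<in>B_b. \<Lambda> f = darboux_integral (\<lambda>A. \<mu> A + \<nu> A) f"
proof -
  have lin: "linear_functional_on B_b \<Lambda>" using dual unfolding dual_tau_K_def by simp
  obtain K where K: "compact K" and sm: "smooth_modulo B_b K \<Lambda>"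
    using dual_tau_K_smooth_modulo[OF bounded_function_space_B_b dual] by blast
  have \<Lambda>: "bounded_functional_on B_b \<Lambda>"
    using bounded_function_space_B_b lin sm by (rule smooth_modulo_bounded)
  have Kc: "open (- K)" using K by (intro open_Compl compact_imp_closed)
  then have meas: "K \<in> sets borel" "- K \<in> sets borel"
    using K by (auto intro: borel_closed borel_open compact_imp_closed)
  define \<Lambda>K where "\<Lambda>K f = \<Lambda> (\<lambda>x. f x * indicator K x)" for f
  define m where "m = charge_of \<Lambda>K"
  define \<nu>1 where "\<nu>1 = charge_of (\<lambda>f. \<Lambda> (\<lambda>x. f x * indicator (- K) x))"
  have \<Lambda>K: "bounded_functional_on B_b \<Lambda>K"
    unfolding \<Lambda>K_def using \<Lambda> meas(1) by (rule bounded_functional_restrict)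
  have m: "m \<in> ba" "\<And>f. f \<in> B_b \<Longrightarrow> darboux_integral m f = \<Lambda>K f"
    unfolding m_def using charge_of_in_ba[OF \<Lambda>K] darboux_charge_of[OF \<Lambda>K] by auto
  have \<nu>1: "\<nu>1 \<in> ca" unfolding \<nu>1_def by (rule charge_of_off_compact_ca[OF \<Lambda> sm meas(1)])
  have split: "\<Lambda> f = darboux_integral m f + darboux_integral \<nu>1 f" if f: "f \<in> B_b" for f
  proof -
    have "\<Lambda> f = \<Lambda> (\<lambda>x. f x * indicator K x + f x * indicator (- K) x)"
      by (rule arg_cong[where f=\<Lambda>]) (auto simp: fun_eq_iff indicator_def)
    also have "\<dots> = \<Lambda>K f + \<Lambda> (\<lambda>x. f x * indicator (- K) x)"
      unfolding \<Lambda>K_def by (intro linear_functional_onD(1)[OF lin] B_b_indicator_mult meas f)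
    also have "\<Lambda> (\<lambda>x. f x * indicator (- K) x) = darboux_integral \<nu>1 f"
      unfolding \<nu>1_def using darboux_charge_of[OF bounded_functional_restrict[OF \<Lambda> meas(2)] f] by simp
    finally show ?thesis using m(2)[OF f] by simp
  qed
  have "smooth_modulo C_b K \<Lambda>K"
    unfolding smooth_modulo_def
  proof (intro allI impI)
    fix f :: "nat \<Rightarrow> 'a \<Rightarrow> real" and c
    assume f: "\<forall>n. f n \<in> C_b" "\<forall>n x. \<bar>f n x\<bar> \<le> c" "\<forall>x. (\<lambda>n. f n x) \<longlonglongrightarrow> 0"
      "uniform_limit K f (\<lambda>x. 0) sequentially"
    show "(\<lambda>n. \<Lambda>K (f n)) \<longlonglongrightarrow> 0"
      unfolding \<Lambda>K_def
    proof (rule sm[unfolded smooth_modulo_def, rule_format])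
      show "(\<lambda>x. f n x * indicator K x) \<in> B_b" for n
        using f(1) C_b_subset_B_b meas(1) by (intro B_b_indicator_mult) auto
      show "\<bar>f n x * indicat_real K x\<bar> \<le> c" for n x
        using f(2) order_trans[OF abs_ge_zero, of "f n x" c] by (simp add: indicator_def)
      show "(\<lambda>n. f n x * indicat_real K x) \<longlonglongrightarrow> 0" for x
        using f(3) by (intro tendsto_mult_left_zero) auto
      show "uniform_limit K (\<lambda>n x. f n x * indicat_real K x) (\<lambda>x. 0) sequentially"
        by (rule uniform_limit_cong'[THEN iffD1, OF _ _ f(4)]) auto
    qed
  qed
  moreover have "linear_functional_on C_b \<Lambda>K"
    using \<Lambda>K C_b_subset_B_b unfolding bounded_functional_on_def by (blast intro: linear_functional_on_subset)
  ultimately obtain \<nu>0 where \<nu>0: "\<nu>0 \<in> ca" "\<And>f. f \<in> C_b \<Longrightarrow> \<Lambda>K f = darboux_integral \<nu>0 f"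
    using smooth_functional_representation[OF _ K] by blast
  have \<nu>0_ba: "\<nu>0 \<in> ba" using \<nu>0(1) ca_subset_ba by auto
  note res = bounded_functional_restrict[OF darboux_bounded_functional[OF \<nu>0_ba] meas(1)]
  define \<nu>2 where "\<nu>2 = charge_of (\<lambda>f. darboux_integral \<nu>0 (\<lambda>x. f x * indicator K x))"
  have \<nu>2: "\<nu>2 \<in> ca" unfolding \<nu>2_def using \<nu>0(1) meas(1) by (rule charge_of_restrict_ca)
  then have \<nu>2_ba: "\<nu>2 \<in> ba" using ca_subset_ba by auto
  have \<nu>2_eq: "darboux_integral \<nu>2 f = \<Lambda>K f" if f: "f \<in> C_b" for f
  proof -
    \<comment> \<open>Restricting \<open>\<nu>0\<close> to \<open>K\<close> does not change its action on \<open>f\<close>: the functions \<open>f * h n\<close> vanish on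
      \<open>K\<close>, so \<open>\<Lambda>K\<close> kills them, and they tend to \<open>f\<close> cut off to the complement of \<open>K\<close>.\<close>
    obtain h :: "nat \<Rightarrow> 'a \<Rightarrow> real" where h: "\<And>n. h n \<in> C_b" "\<And>n x. 0 \<le> h n x" "\<And>n x. h n x \<le> 1"
      "\<And>n x. x \<notin> - K \<Longrightarrow> h n x = 0" "\<And>x. x \<in> - K \<Longrightarrow> \<forall>\<^sub>F n in sequentially. h n x = 1"
      using open_indicator_approx[OF Kc] by metis
    obtain c where c: "\<And>x. \<bar>f x\<bar> \<le> c" using C_bE[OF f] by metis
    have fB: "f \<in> B_b" using f C_b_subset_B_b by auto
    have "(\<lambda>n. darboux_integral \<nu>0 (\<lambda>x. f x * h n x)) \<longlonglongrightarrow>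
        darboux_integral \<nu>0 (\<lambda>x. f x * indicator (- K) x)"
    proof (rule darboux_dominated_convergence[OF \<nu>0(1)])
      show "(\<lambda>x. f x * h n x) \<in> B_b" for n using C_b_mult[OF f h(1)] C_b_subset_B_b by auto
      show "(\<lambda>x. f x * indicator (- K) x) \<in> B_b" by (rule B_b_indicator_mult[OF meas(2) fB])
      show "\<bar>f x * h n x\<bar> \<le> c" for n x
        using mult_mono[OF c[of x], of "\<bar>h n x\<bar>" 1] h(2,3)[of n x] order_trans[OF abs_ge_zero c[of x]]
        by (simp add: abs_mult)
      show "(\<lambda>n. f x * h n x) \<longlonglongrightarrow> f x * indicat_real (- K) x" for x
        using h(4)[of x] h(5)[of x]
        by (intro tendsto_mult_left, cases "x \<in> K") (auto intro: tendsto_eventually)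
    qed
    moreover have "darboux_integral \<nu>0 (\<lambda>x. f x * h n x) = 0" for n
    proof -
      have "(\<lambda>x. f x * h n x * indicator K x) = (\<lambda>x. 0 * 0)"
        using h(4)[of _ n] by (auto simp: fun_eq_iff indicator_def)
      then have "\<Lambda>K (\<lambda>x. f x * h n x) = \<Lambda> (\<lambda>x. 0 * 0)" unfolding \<Lambda>K_def by simp
      also have "\<dots> = 0 * \<Lambda> (\<lambda>x. 0)" by (rule linear_functional_onD(2)[OF lin B_b_const])
      finally show ?thesis using \<nu>0(2)[OF C_b_mult[OF f h(1)]] by simp
    qed
    ultimately have off: "darboux_integral \<nu>0 (\<lambda>x. f x * indicator (- K) x) = 0"
      by (simp add: LIMSEQ_const_iff)
    have "\<Lambda>K f = darboux_integral \<nu>0 (\<lambda>x. f x * indicator K x + f x * indicator (- K) x)"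
      unfolding \<nu>0(2)[OF f] by (rule arg_cong[where f="darboux_integral \<nu>0"]) (auto simp: fun_eq_iff indicator_def)
    also have "\<dots> = darboux_integral \<nu>0 (\<lambda>x. f x * indicator K x) + darboux_integral \<nu>0 (\<lambda>x. f x * indicator (- K) x)"
      by (intro linear_functional_onD(1)[OF darboux_linear[OF \<nu>0_ba]] B_b_indicator_mult meas fB)
    also have "\<dots> = darboux_integral \<nu>2 f"
      unfolding \<nu>2_def off using darboux_charge_of[OF res fB] by simp
    finally show ?thesis by simp
  qed
  define \<mu> where "\<mu> = (\<lambda>A. m A - \<nu>2 A)"
  have \<mu>: "\<mu> \<in> ba" unfolding \<mu>_def using m(1) \<nu>2_ba by (rule ba_diff)
  have "\<mu> B = 0" if B: "B \<in> sets borel" "B \<subseteq> - K" for B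
  proof -
    have z: "(\<lambda>x. indicat_real B x * indicat_real K x) = (\<lambda>x. 0)"
      using B(2) by (auto simp: fun_eq_iff indicator_def)
    have "m B = 0 * \<Lambda> (\<lambda>x. 0)"
      unfolding m_def charge_of_def \<Lambda>K_def z
      using B(1) linear_functional_onD(2)[OF lin B_b_const, of 0 0] by simp
    moreover have "\<nu>2 B = 0"
      unfolding \<nu>2_def charge_of_def z using B(1) darboux_zero_function[OF \<nu>0_ba] by simp
    ultimately show ?thesis unfolding \<mu>_def by simp
  qed
  then have "\<mu> \<in> ba_C" unfolding ba_C_def using \<mu> K total_variation_eq_0I by blast
  moreover have "\<mu> \<in> C_b_perp"
  proof -
    have "darboux_integral \<mu> f = 0" if "f \<in> C_b" for f
      using darboux_diff[OF m(1) \<nu>2_ba, of f] m(2)[of f] \<nu>2_eq[OF that] that C_b_subset_B_b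
      unfolding \<mu>_def by auto
    then show ?thesis unfolding C_b_perp_def using \<mu> by blast
  qed
  moreover have "(\<lambda>A. \<nu>1 A + \<nu>2 A) \<in> ca" using \<nu>1 \<nu>2 by (rule ca_add)
  moreover have "\<Lambda> f = darboux_integral (\<lambda>A. \<mu> A + (\<nu>1 A + \<nu>2 A)) f" if "f \<in> B_b" for f
  proof -
    have "(\<lambda>A. \<mu> A + (\<nu>1 A + \<nu>2 A)) = (\<lambda>A. m A + \<nu>1 A)" unfolding \<mu>_def by simp
    then show ?thesis using split[OF that] darboux_add[OF m(1) _ that, of \<nu>1] \<nu>1 ca_subset_ba by auto
  qed
  ultimately show ?thesis by (meson IntI)
qed

lemma dual_C_b_representation:
  fixes \<Lambda> :: "('a::metric_space \<Rightarrow> real) \<Rightarrow> real"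
  assumes dual: "\<Lambda> \<in> dual_tau_K C_b"
  shows "\<exists>\<nu>\<in>ca. \<forall>f\<in>C_b. \<Lambda> f = darboux_integral \<nu> f"
proof -
  obtain K where "compact K" "smooth_modulo C_b K \<Lambda>"
    using dual_tau_K_smooth_modulo[OF bounded_function_space_C_b dual] by blast
  then show ?thesis using dual unfolding dual_tau_K_def by (intro smooth_functional_representation) auto
qed

lemma ca_eqI:
  fixes \<nu> :: "'a::metric_space set \<Rightarrow> real"
  assumes "\<nu> \<in> ca" "\<nu>' \<in> ca" and "\<And>f. f \<in> C_b \<Longrightarrow> darboux_integral \<nu> f = darboux_integral \<nu>' f"
  shows "\<nu> = \<nu>'"
proof -
  have "darboux_integral (\<lambda>A. \<nu> A - \<nu>' A) f = 0" if "f \<in> C_b" for f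
    using darboux_diff[of \<nu> \<nu>' f] assms that ca_subset_ba C_b_subset_B_b by auto
  then have "(\<lambda>A. \<nu> A - \<nu>' A) = (\<lambda>A. 0)"
    by (intro ca_determined_by_C_b ca_diff assms)
  then show ?thesis by (simp add: fun_eq_iff)
qed

lemma C_b_perp_ca_sum_unique:
  fixes \<mu> :: "'a::metric_space set \<Rightarrow> real"
  assumes \<mu>: "\<mu> \<in> C_b_perp" "\<mu>' \<in> C_b_perp" and \<nu>: "\<nu> \<in> ca" "\<nu>' \<in> ca"
    and eq: "\<And>f. f \<in> B_b \<Longrightarrow> darboux_integral (\<lambda>A. \<mu> A + \<nu> A) f = darboux_integral (\<lambda>A. \<mu>' A + \<nu>' A) f"
  shows "\<mu> = \<mu>' \<and> \<nu> = \<nu>'"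
proof -
  have ba: "\<mu> \<in> ba" "\<mu>' \<in> ba" "\<nu> \<in> ba" "\<nu>' \<in> ba"
    using \<mu> \<nu> ca_subset_ba unfolding C_b_perp_def by auto
  have "\<nu> = \<nu>'"
  proof (rule ca_eqI[OF \<nu>])
    fix f :: "'a \<Rightarrow> real" assume f: "f \<in> C_b"
    then have "darboux_integral \<mu> f = 0" "darboux_integral \<mu>' f = 0"
      using \<mu> unfolding C_b_perp_def by auto
    moreover have "f \<in> B_b" using f C_b_subset_B_b by auto
    ultimately show "darboux_integral \<nu> f = darboux_integral \<nu>' f"
      using eq[of f] darboux_add[OF ba(1,3), of f] darboux_add[OF ba(2,4), of f] by simp
  qed
  moreover have "\<mu> A = \<mu>' A" for A
  proof (cases "A \<in> sets borel")
    case True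
    then show ?thesis using eq[OF B_b_indicator[OF True]] \<open>\<nu> = \<nu>'\<close>
      darboux_indicator[OF ba_add[OF ba(1,3)] True] darboux_indicator[OF ba_add[OF ba(2,4)] True] by simp
  next
    case False
    then show ?thesis using baD(1)[OF ba(1)] baD(1)[OF ba(2)] by simp
  qed
  ultimately show ?thesis by auto
qed

lemma zero_in_ba_C_C_b_perp: "(\<lambda>A. 0) \<in> ba_C \<inter> C_b_perp"
proof -
  have ba: "(\<lambda>A. 0) \<in> ba" using zero_in_ca ca_subset_ba by auto
  have "darboux_integral (\<lambda>A. 0) f = 0" if "f \<in> C_b" for f :: "'a \<Rightarrow> real"
    using darboux_combine[OF ba ba, of f 0 0] that C_b_subset_B_b by auto
  moreover have "total_variation (\<lambda>A. 0) (- {}) = 0" by (rule total_variation_eq_0I) simp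
  ultimately show ?thesis unfolding ba_C_def C_b_perp_def using ba compact_empty by blast
qed

theorem proposition4p16:
  shows
    "(dual_tau_K (B_b :: ('a::metric_space \<Rightarrow> real) set) =
        {integration_on B_b (\<lambda>A. \<mu> A + \<nu> A) | \<mu> \<nu>. \<mu> \<in> ba_C \<inter> C_b_perp \<and> \<nu> \<in> ca}) \<and>
     (ba_C \<inter> C_b_perp) \<inter> (ca :: ('a set \<Rightarrow> real) set) = {\<lambda>A. 0} \<and>
     (\<forall>\<Lambda> \<in> dual_tau_K (B_b :: ('a \<Rightarrow> real) set).
        \<exists>!p. p \<in> (ba_C \<inter> C_b_perp) \<times> ca \<and>
          (\<forall>f\<in>B_b. \<Lambda> f = darboux_integral (\<lambda>A. fst p A + snd p A) f)) \<and>
     (dual_tau_K (C_b :: ('a \<Rightarrow> real) set) = {integration_on C_b \<nu> | \<nu>. \<nu> \<in> ca}) \<and>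
     (\<forall>\<Lambda> \<in> dual_tau_K (C_b :: ('a \<Rightarrow> real) set).
        \<exists>!\<nu>. \<nu> \<in> ca \<and> (\<forall>f\<in>C_b. \<Lambda> f = darboux_integral \<nu> f))"
proof (intro conjI)
  \<comment> \<open>Both sides are \<open>undefined\<close> off \<open>V\<close>.\<close>
  have ext: "\<Lambda> = integration_on V \<mu>"
    if "\<Lambda> \<in> dual_tau_K V" "\<forall>f\<in>V. \<Lambda> f = darboux_integral \<mu> f" for \<Lambda> V and \<mu> :: "'a set \<Rightarrow> real"
    using that by (intro extensionalityI[where A=V]) (auto simp: dual_tau_K_def integration_on_def)
  show "dual_tau_K (B_b :: ('a \<Rightarrow> real) set) =
      {integration_on B_b (\<lambda>A. \<mu> A + \<nu> A) | \<mu> \<nu>. \<mu> \<in> ba_C \<inter> C_b_perp \<and> \<nu> \<in> ca}"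
  proof (intro equalityI subsetI)
    fix \<Lambda> :: "('a \<Rightarrow> real) \<Rightarrow> real" assume \<Lambda>: "\<Lambda> \<in> dual_tau_K B_b"
    obtain \<mu> \<nu> where "\<mu> \<in> ba_C \<inter> C_b_perp" "\<nu> \<in> ca"
      "\<forall>f\<in>B_b. \<Lambda> f = darboux_integral (\<lambda>A. \<mu> A + \<nu> A) f"
      using dual_B_b_decomposition[OF \<Lambda>] by blast
    then show "\<Lambda> \<in> {integration_on B_b (\<lambda>A. \<mu> A + \<nu> A) | \<mu> \<nu>. \<mu> \<in> ba_C \<inter> C_b_perp \<and> \<nu> \<in> ca}"
      using ext[OF \<Lambda>, of "\<lambda>A. \<mu> A + \<nu> A"] by blast
  qed (use integration_on_B_b_in_dual in blast)
  show "(ba_C \<inter> C_b_perp) \<inter> (ca :: ('a set \<Rightarrow> real) set) = {\<lambda>A. 0}"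
  proof (intro equalityI subsetI)
    fix \<nu> :: "'a set \<Rightarrow> real" assume "\<nu> \<in> (ba_C \<inter> C_b_perp) \<inter> ca"
    then have "\<nu> = (\<lambda>A. 0)" by (intro ca_determined_by_C_b) (auto simp: C_b_perp_def)
    then show "\<nu> \<in> {\<lambda>A. 0}" by simp
  qed (use zero_in_ba_C_C_b_perp zero_in_ca in auto)
  show "\<forall>\<Lambda> \<in> dual_tau_K (B_b :: ('a \<Rightarrow> real) set).
        \<exists>!p. p \<in> (ba_C \<inter> C_b_perp) \<times> ca \<and>
          (\<forall>f\<in>B_b. \<Lambda> f = darboux_integral (\<lambda>A. fst p A + snd p A) f)"
  proof
    fix \<Lambda> :: "('a \<Rightarrow> real) \<Rightarrow> real" assume \<Lambda>: "\<Lambda> \<in> dual_tau_K B_b"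
    obtain \<mu> \<nu> where \<mu>\<nu>: "\<mu> \<in> ba_C \<inter> C_b_perp" "\<nu> \<in> ca"
      "\<forall>f\<in>B_b. \<Lambda> f = darboux_integral (\<lambda>A. \<mu> A + \<nu> A) f"
      using dual_B_b_decomposition[OF \<Lambda>] by blast
    show "\<exists>!p. p \<in> (ba_C \<inter> C_b_perp) \<times> ca \<and>
          (\<forall>f\<in>B_b. \<Lambda> f = darboux_integral (\<lambda>A. fst p A + snd p A) f)"
    proof (rule ex1I[of _ "(\<mu>, \<nu>)"])
      fix p assume p: "p \<in> (ba_C \<inter> C_b_perp) \<times> ca \<and>
          (\<forall>f\<in>B_b. \<Lambda> f = darboux_integral (\<lambda>A. fst p A + snd p A) f)"
      have "fst p = \<mu> \<and> snd p = \<nu>"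
        using p \<mu>\<nu> by (intro C_b_perp_ca_sum_unique) auto
      then show "p = (\<mu>, \<nu>)" by (simp add: prod_eq_iff)
    qed (use \<mu>\<nu> in auto)
  qed
  show "dual_tau_K (C_b :: ('a \<Rightarrow> real) set) = {integration_on C_b \<nu> | \<nu>. \<nu> \<in> ca}"
  proof (intro equalityI subsetI)
    fix \<Lambda> :: "('a \<Rightarrow> real) \<Rightarrow> real" assume \<Lambda>: "\<Lambda> \<in> dual_tau_K C_b"
    then show "\<Lambda> \<in> {integration_on C_b \<nu> | \<nu>. \<nu> \<in> ca}"
      using dual_C_b_representation[OF \<Lambda>] ext[OF \<Lambda>] by blast
  qed (use integration_on_C_b_in_dual in blast)
  show "\<forall>\<Lambda> \<in> dual_tau_K (C_b :: ('a \<Rightarrow> real) set).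
        \<exists>!\<nu>. \<nu> \<in> ca \<and> (\<forall>f\<in>C_b. \<Lambda> f = darboux_integral \<nu> f)"
  proof
    fix \<Lambda> :: "('a \<Rightarrow> real) \<Rightarrow> real" assume \<Lambda>: "\<Lambda> \<in> dual_tau_K C_b"
    obtain \<nu> where \<nu>: "\<nu> \<in> ca" "\<forall>f\<in>C_b. \<Lambda> f = darboux_integral \<nu> f"
      using dual_C_b_representation[OF \<Lambda>] by blast
    then show "\<exists>!\<nu>. \<nu> \<in> ca \<and> (\<forall>f\<in>C_b. \<Lambda> f = darboux_integral \<nu> f)"
      by (intro ex1I[of _ \<nu>]) (auto intro: ca_eqI)
  qed
qed

end
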